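(* Assume (A1), (A2), (A3) (stated in the context) and let $\mu\in\rho(A)$. Then $$\mu\in\rho(\mathfrak{A})\iff 1\in\rho(\Delta(\mu))\iff 1\in\rho(MD_\mu)\cap\rho(De_\mu^X),$$ where $$\Delta(\mu):=e_\mu^X(I-De_\mu^X)^{-1}R(\mu,A_{G,M})L .$$ In addition, for $1\in\rho(MD_\mu)\cap\rho(De_\mu^X)$, $R(\mu,\mathfrak{A})$ is the operator matrix $$\begin{pmatrix} R(\mu,A_{G,M})[I+L\Gamma(\mu)R(\mu,A_{G,M})] & R(\mu,A_{G,M})LR(1,\Delta(\mu))R(\mu,\mathcal{Q}_D) & \Lambda(\mu)R(\mu,Q^U)\\ \Gamma(\mu)R(\mu,A_{G,M}) & R(1,\Delta(\mu))R(\mu,\mathcal{Q}_D) & \Omega(\mu)R(\mu,Q^U)\\ 0&0&R(\mu,Q^U)\end{pmatrix},$$ where $\Gamma(\mu):=R(1,\Delta(\mu))e_\mu^X(I-De_\mu^X)^{-1}$, $\Omega(\mu):=\Gamma(\mu)\big(K_1+R(\mu,A_{G,M})B_1\big)$ and $\Lambda(\mu):=R(\mu,A_{G,M})\big(L\Omega(\mu)+B_1\big)$.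
   Context: **Spaces and operators.** $X,\partial X,U$ are Banach spaces, $r>0$, $1\le p<\infty$. $A_m:D(A_m)\subset X\to X$ is a closed linear operator whose domain $Z:=D(A_m)$ (a Banach space for the graph norm) is densely and continuously embedded in $X$; $G,M:Z\to\partial X$ are linear and bounded on $Z$ (possibly unbounded with respect to the norm of $X$). **Assumptions.** (A1) $A:=A_m|_{\ker G}$ (domain $D(A)=\ker G$) generates a $C_0$-semigroup $(T(t))_{t\ge0}$ on $X$. (A2) $G$ is surjective. For $\mu\in\rho(A)$ put $D_\mu:=(G|_{\ker(\mu-A_m)})^{-1}\in\mathcal{L}(\partial X,Z)$. Let $X_{-1}$ be the extrapolation space of $X$ associated with $A$, with extensions $A_{-1},T_{-1}$, and let $B:=(\mu-A_{-1})D_\mu\in\mathcal{L}(\partial X,X_{-1})$ (independent of $\mu$) and $C:=M|_{D(A)}$. (A3) $(A,B,C)$ is a regular triple of state-space operators on $\partial X,X,\partial X$ with $I_{\partial X}$ as admissible feedback, i.e.: - for some $\tau>0$, $\Phi_\tau v:=\int_0^\tau T_{-1}(\tau-s)Bv(s)ds\in X$ for all $v\in L^p([0,\infty);\partial X)$; - $\int_0^\tau\|CT(s)z\|^pds\le\gamma^p\|z\|^p$ for all $z\in D(A)$, with some $\tau,\gamma>0$; - for every $\tau>0$ there is $\kappa$ such that $(\mathbb{F}v)(t):=M\Phi_tv$ satisfies $\|\mathbb{F}v\|_{L^p([0,\tau];\partial X)}\le\kappa\|v\|_{L^p([0,\tau];\partial X)}$ for all $v\in W^{2,p}_{loc}([0,\infty);\partial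 X)$ with $v(0)=v'(0)=0$, so that $\mathbb F$ extends to $L^p_{loc}$ and $\mathbb{F}_\tau$ denotes its restriction to $[0,\tau]$; - $\lim_{\tau\to0}\frac1\tau\int_0^\tau(\mathbb{F}(\mathbf{1}_{\mathbb{R}_+}v))(\sigma)d\sigma=0$ for all $v\in\partial X$; - $I-\mathbb{F}_\tau$ is boundedly invertible on $L^p([0,\tau];\partial X)$ for some $\tau>0$. **Operator $A_{G,M}$.** $A_{G,M}:=A_m$ with domain $\{z\in Z: Gz=Mz\}$; for $\mu\in\rho(A)$, $\mu\in\rho(A_{G,M})$ if and only if $1\in\rho(MD_\mu)$. **Delay operators.** $D,L:W^{1,p}([-r,0],X)\to X$ and $K_1,B_1:W^{1,p}([-r,0],U)\to X$ are given by $D\varphi=\int_{-r}^0d\eta(\theta)\varphi(\theta)$, $L\varphi=\int_{-r}^0d\gamma(\theta)\varphi(\theta)$, $B_1\psi=\int_{-r}^0d\nu(\theta)\psi(\theta)$, $K_1\psi=\int_{-r}^0d\vartheta(\theta)\psi(\theta)$, where $\eta,\gamma:[-r,0]\to\mathcal{L}(X)$ and $\nu,\vartheta:[-r,0]\to\mathcal{L}(U,X)$ are of bounded variation with total variations on $[-\varepsilon,0]$ tending to $0$ as $\varepsilon\to0$. **Shift operators.** For a Banach space $E$: $Q_m^E\xi=\xi'$ with $D(Q_m^E)=W^{1,p}([-r,0],E)$; $Q^E$ is its restriction to $\{\xi:\xi(0)=0\}$; $(e_\mu^Ez)(\theta)=e^{\mu\theta}z$ for $z\in E$. $\mathcal{Q}_D$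 is the restriction of $Q_m^X$ to $\{\varphi\in W^{1,p}([-r,0],X):\varphi(0)=D\varphi\}$, a generator on $L^p([-r,0],X)$, with $\mu\in\rho(\mathcal{Q}_D)$ iff $1\in\rho(De_\mu^X)$. **Product-space operators.** $\mathcal{X}:=X\times L^p([-r,0],X)\times L^p([-r,0],U)$, $\mathcal{Z}:=D(A_m)\times W^{1,p}([-r,0],X)\times W^{1,p}([-r,0],U)$. $\mathcal{A}_{G,M}$ is the restriction of $\mathrm{diag}(A_m,Q_m^X,Q_m^U)$ to $$D(\mathcal{A}_{G,M})=\{(\varrho,\varphi,\psi)\in\mathcal{Z}: G\varrho=M\varrho,\ \varphi(0)=\varrho+D\varphi+K_1\psi,\ \psi(0)=0\}.$$ $\mathcal{P}(\varrho,\varphi,\psi):=(L\varphi+B_1\psi,0,0)$, and $\mathfrak{A}:=\mathcal{A}_{G,M}+\mathcal{P}$ with $D(\mathfrak{A})=D(\mathcal{A}_{G,M})$. $R(\mu,\cdot)$ denotes the resolvent.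
   Formalization: The second equivalence is false as printed: 1∈ρ(MD_μ)∩ρ(De_μ) is instead assumed (it makes Δ(μ) defined); under it μ∈ρ(A_{G,M}) and μ∈ρ(𝔄)⇔1∈ρ(Δ(μ)) are proved, and the resolvent matrix is proved when also 1∈ρ(Δ(μ)). *)

theory Defs
  imports "HOL-Analysis.Analysis"
begin

section \<open>Complex vector spaces and complex Banach spaces\<close>

class complex_vector = real_vector +
  fixes scaleC :: "complex \<Rightarrow> 'a \<Rightarrow> 'a" (infixr \<open>*\<^sub>C\<close> 75)
  assumes scaleC_add_right: "a *\<^sub>C (x + y) = a *\<^sub>C x + a *\<^sub>C y"
    and scaleC_add_left: "(a + b) *\<^sub>C x = a *\<^sub>C x + b *\<^sub>C x"
    and scaleC_scaleC: "a *\<^sub>C (b *\<^sub>C x) = (a * b) *\<^sub>C x"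
    and scaleR_scaleC: "r *\<^sub>R x = complex_of_real r *\<^sub>C x"

class complex_banach = banach + complex_vector +
  assumes norm_scaleC: "norm (a *\<^sub>C x) = cmod a * norm x"

instantiation complex :: complex_banach
begin
definition scaleC_complex :: "complex \<Rightarrow> complex \<Rightarrow> complex" where
  "scaleC_complex a x = a * x"
instance
  by standard (simp_all add: scaleC_complex_def algebra_simps norm_mult scaleR_conv_of_real)
end

instantiation prod :: (complex_vector, complex_vector) complex_vector
begin
definition scaleC_prod :: "complex \<Rightarrow> 'a \<times> 'b \<Rightarrow> 'a \<times> 'b" where
  "scaleC_prod a z = (a *\<^sub>C fst z, a *\<^sub>C snd z)"
instance
  by standard (simp_all add: scaleC_prod_def scaleC_add_right scaleC_add_left scaleC_scaleC
      scaleR_scaleC scaleR_prod_def)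
end

definition csubspace :: "'a::complex_vector set \<Rightarrow> bool" where
  "csubspace S \<longleftrightarrow> 0 \<in> S \<and> (\<forall>x\<in>S. \<forall>y\<in>S. x + y \<in> S) \<and> (\<forall>c. \<forall>x\<in>S. c *\<^sub>C x \<in> S)"

definition clinear_on :: "'a::complex_vector set \<Rightarrow> ('a \<Rightarrow> 'b::complex_vector) \<Rightarrow> bool" where
  "clinear_on S f \<longleftrightarrow>
     (\<forall>x\<in>S. \<forall>y\<in>S. f (x + y) = f x + f y) \<and> (\<forall>c. \<forall>x\<in>S. f (c *\<^sub>C x) = c *\<^sub>C f x)"

section \<open>Resolvent sets and resolvents\<close>

text \<open>
  \<open>L\<^sup>p\<close> and Sobolev spaces are subsets of a type of function classes, hence a normed space is given by a carrier \<open>S\<close> and a norm \<open>N\<close> on it; an operator on it by its domain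
  \<open>D\<close>, a subset of \<open>S\<close>, and a function \<open>T\<close> that is only relevant on \<open>D\<close>.  A point belongs to the
  resolvent set if \<open>\<mu> - T\<close> maps \<open>D\<close> bijectively onto \<open>S\<close> with bounded inverse.
\<close>

definition resolvent_set ::
  "'a::complex_vector set \<Rightarrow> ('a \<Rightarrow> real) \<Rightarrow> 'a set \<Rightarrow> ('a \<Rightarrow> 'a) \<Rightarrow> complex set" where
  "resolvent_set S N D T =
     {\<mu>. bij_betw (\<lambda>x. \<mu> *\<^sub>C x - T x) D S \<and> (\<exists>K. \<forall>x\<in>D. N x \<le> K * N (\<mu> *\<^sub>C x - T x))}"

definition resolvent ::
  "'a::complex_vector set \<Rightarrow> ('a \<Rightarrow> 'a) \<Rightarrow> complex \<Rightarrow> 'a \<Rightarrow> 'a" where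
  "resolvent D T \<mu> = the_inv_into D (\<lambda>x. \<mu> *\<^sub>C x - T x)"

section \<open>Functions modulo equality almost everywhere\<close>

text \<open>
  Functions on a subset of the real line are extended by zero.  The classes themselves need not be
  measurable; measurability is required in \<open>Lp\<close> below.
\<close>

quotient_type 'a aefun = "real \<Rightarrow> 'a" / "\<lambda>f g. AE t in lebesgue. f t = g t"
  morphisms rep_ae ae_class
proof (rule equivpI)
  show "reflp (\<lambda>f g::real \<Rightarrow> 'a. AE t in lebesgue. f t = g t)"
    by (simp add: reflp_def)
  show "symp (\<lambda>f g::real \<Rightarrow> 'a. AE t in lebesgue. f t = g t)"
    by (rule sympI) (auto elim: eventually_mono)
  show "transp (\<lambda>f g::real \<Rightarrow> 'a. AE t in lebesgue. f t = g t)"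
    by (rule transpI) (auto elim: eventually_elim2)
qed

instantiation aefun :: (complex_vector) complex_vector
begin
lift_definition zero_aefun :: "'a aefun" is "\<lambda>_. 0" .
lift_definition plus_aefun :: "'a aefun \<Rightarrow> 'a aefun \<Rightarrow> 'a aefun" is "\<lambda>f g t. f t + g t"
  by (auto elim: eventually_elim2)
lift_definition minus_aefun :: "'a aefun \<Rightarrow> 'a aefun \<Rightarrow> 'a aefun" is "\<lambda>f g t. f t - g t"
  by (auto elim: eventually_elim2)
lift_definition uminus_aefun :: "'a aefun \<Rightarrow> 'a aefun" is "\<lambda>f t. - f t"
  by (auto elim: eventually_mono)
lift_definition scaleR_aefun :: "real \<Rightarrow> 'a aefun \<Rightarrow> 'a aefun" is "\<lambda>c f t. c *\<^sub>R f t"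
  by (auto elim: eventually_mono)
lift_definition scaleC_aefun :: "complex \<Rightarrow> 'a aefun \<Rightarrow> 'a aefun" is "\<lambda>c f t. c *\<^sub>C f t"
  by (auto elim: eventually_mono)
instance
  by (standard; transfer) (auto simp: algebra_simps scaleC_add_right scaleC_add_left
      scaleC_scaleC scaleR_scaleC[symmetric])
end

lift_definition ae_restrict :: "real set \<Rightarrow> 'a::complex_vector aefun \<Rightarrow> 'a aefun"
  is "\<lambda>S f t. if t \<in> S then f t else 0"
  by (auto elim: eventually_mono)

section \<open>Lebesgue and Sobolev spaces of vector-valued functions\<close>

text \<open>
  The Banach spaces need not be separable, so the Bochner integral of the library, which requires
  a second countable range, is not available.  Bochner (strong) measurability is defined directly,
  and integrals are Henstock--Kurzweil integrals, which coincide with Bochner integrals for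
  strongly measurable functions with integrable norm; all integrands below are of this kind.
\<close>

definition strongly_measurable :: "(real \<Rightarrow> 'a::complex_banach) \<Rightarrow> bool" where
  "strongly_measurable f \<longleftrightarrow>
     (\<exists>s. (\<forall>n::nat. simple_function lebesgue (s n)) \<and>
          (AE t in lebesgue. (\<lambda>n. s n t) \<longlonglongrightarrow> f t))"

definition Lp_integral :: "real \<Rightarrow> 'a::complex_banach aefun \<Rightarrow> ennreal" where
  "Lp_integral p u = (\<integral>\<^sup>+ t. ennreal (norm (rep_ae u t) powr p) \<partial>lebesgue)"

definition Lp_norm :: "real \<Rightarrow> 'a::complex_banach aefun \<Rightarrow> real" where
  "Lp_norm p u = enn2real (Lp_integral p u) powr (1 / p)"

definition Lp :: "real \<Rightarrow> real set \<Rightarrow> 'a::complex_banach aefun set" where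
  "Lp p S = {u. strongly_measurable (rep_ae u) \<and> ae_restrict S u = u \<and> Lp_integral p u < \<infinity>}"

text \<open>The space \<open>L\<^sup>p\<^sub>l\<^sub>o\<^sub>c\<close> on the half line.\<close>

definition Lp_loc :: "real \<Rightarrow> 'a::complex_banach aefun set" where
  "Lp_loc p = {u. ae_restrict {0..} u = u \<and> (\<forall>\<tau>>0. ae_restrict {0..\<tau>} u \<in> Lp p {0..\<tau>})}"

text \<open>
  \<open>f\<close> is the continuous representative of the class \<open>u\<close> (extended by zero outside \<open>[a, b]\<close>) and
  \<open>g\<close> is the weak derivative of \<open>u\<close>.
\<close>

definition sobolev_triple ::
  "real \<Rightarrow> real \<Rightarrow> real \<Rightarrow> 'a::complex_banach aefun \<Rightarrow> (real \<Rightarrow> 'a) \<Rightarrow> 'a aefun \<Rightarrow> bool" where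
  "sobolev_triple p a b u f g \<longleftrightarrow>
     u = ae_class f \<and> (\<forall>t. t \<notin> {a..b} \<longrightarrow> f t = 0) \<and> g \<in> Lp p {a..b} \<and>
     (\<forall>t\<in>{a..b}. (rep_ae g has_integral (f t - f a)) {a..t})"

definition W1p :: "real \<Rightarrow> real \<Rightarrow> real \<Rightarrow> 'a::complex_banach aefun set" where
  "W1p p a b = {u. \<exists>f g. sobolev_triple p a b u f g}"

definition cont_rep :: "real \<Rightarrow> real \<Rightarrow> real \<Rightarrow> 'a::complex_banach aefun \<Rightarrow> real \<Rightarrow> 'a" where
  "cont_rep p a b u = (THE f. \<exists>g. sobolev_triple p a b u f g)"

definition weak_deriv ::
  "real \<Rightarrow> real \<Rightarrow> real \<Rightarrow> 'a::complex_banach aefun \<Rightarrow> 'a aefun" where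
  "weak_deriv p a b u = (THE g. \<exists>f. sobolev_triple p a b u f g)"

definition W1p_norm :: "real \<Rightarrow> real \<Rightarrow> real \<Rightarrow> 'a::complex_banach aefun \<Rightarrow> real" where
  "W1p_norm p a b u = Lp_norm p u + Lp_norm p (weak_deriv p a b u)"

text \<open>The functions \<open>v\<close> in \<open>W\<^sup>2\<^sup>,\<^sup>p\<^sub>l\<^sub>o\<^sub>c\<close> on the half line with \<open>v(0) = v'(0) = 0\<close>.\<close>

definition W2p_loc_0 :: "real \<Rightarrow> 'a::complex_banach aefun set" where
  "W2p_loc_0 p = {v. \<exists>f f' g. v = ae_class f \<and> (\<forall>t<0. f t = 0) \<and> g \<in> Lp_loc p \<and>
     (\<forall>t\<ge>0. (f' has_integral f t) {0..t}) \<and> (\<forall>t\<ge>0. (rep_ae g has_integral f' t) {0..t})}"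

section \<open>Semigroups, extrapolation spaces and regular triples\<close>

definition C0_semigroup :: "(real \<Rightarrow> 'a::complex_banach \<Rightarrow> 'a) \<Rightarrow> bool" where
  "C0_semigroup T \<longleftrightarrow>
     (\<forall>t\<ge>0. bounded_linear (T t) \<and> clinear_on UNIV (T t)) \<and>
     (\<forall>x. T 0 x = x) \<and> (\<forall>s\<ge>0. \<forall>t\<ge>0. \<forall>x. T (s + t) x = T s (T t x)) \<and>
     (\<forall>x. ((\<lambda>t. T t x) \<longlongrightarrow> x) (at_right 0))"

definition generates ::
  "'a::complex_banach set \<Rightarrow> ('a \<Rightarrow> 'a) \<Rightarrow> (real \<Rightarrow> 'a \<Rightarrow> 'a) \<Rightarrow> bool" where
  "generates D A T \<longleftrightarrow> C0_semigroup T \<and>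
     D = {x. \<exists>y. ((\<lambda>t. (1 / t) *\<^sub>R (T t x - x)) \<longlongrightarrow> y) (at_right 0)} \<and>
     (\<forall>x\<in>D. ((\<lambda>t. (1 / t) *\<^sub>R (T t x - x)) \<longlongrightarrow> A x) (at_right 0))"

text \<open>
  \<open>j\<close> embeds \<open>X\<close> into its extrapolation space, the completion of \<open>X\<close> for the norm
  \<open>\<parallel>R(\<lambda>, A) x\<parallel>\<close>; different \<open>\<lambda>\<close> yield equivalent norms.  \<open>Te\<close> and \<open>Ae\<close> are the continuous
  extensions of the semigroup \<open>T\<close> and of its generator \<open>A\<close>; the domain of the extended generator
  is (the image of) \<open>X\<close>, so \<open>Ae\<close> is regarded as a map on \<open>X\<close>.
\<close>

definition extrapolation ::
  "'a::complex_banach set \<Rightarrow> ('a \<Rightarrow> 'a) \<Rightarrow> (real \<Rightarrow> 'a \<Rightarrow> 'a) \<Rightarrow>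
   ('a \<Rightarrow> 'y::complex_banach) \<Rightarrow> (real \<Rightarrow> 'y \<Rightarrow> 'y) \<Rightarrow> ('a \<Rightarrow> 'y) \<Rightarrow> bool" where
  "extrapolation D A T j Te Ae \<longleftrightarrow>
     clinear_on UNIV j \<and> closure (range j) = UNIV \<and>
     (\<exists>l\<in>resolvent_set UNIV norm D A. \<forall>x. norm (j x) = norm (resolvent D A l x)) \<and>
     (\<forall>t\<ge>0. bounded_linear (Te t) \<and> (\<forall>x. Te t (j x) = j (T t x))) \<and>
     bounded_linear Ae \<and> (\<forall>x\<in>D. Ae x = j (A x))"

text \<open>
  The integral defining \<open>\<Phi>\<^sub>\<tau> v\<close> is taken in the extrapolation space; \<open>input_map\<close> is its preimage
  under the embedding \<open>j\<close>.
\<close>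

definition input_map ::
  "('x::complex_banach \<Rightarrow> 'y::complex_banach) \<Rightarrow> (real \<Rightarrow> 'y \<Rightarrow> 'y) \<Rightarrow>
   ('b::complex_banach \<Rightarrow> 'y) \<Rightarrow> real \<Rightarrow> 'b aefun \<Rightarrow> 'x" where
  "input_map j Te B \<tau> v =
     (THE x. ((\<lambda>s. Te (\<tau> - s) (B (rep_ae v s))) has_integral j x) {0..\<tau>})"

text \<open>
  The input-output map on inputs in \<open>W2p_loc_0\<close>, for which \<open>\<Phi>\<^sub>t v\<close> always lies in the domain
  of \<open>M\<close>, and its continuous extension to \<open>L\<^sup>p\<^sub>l\<^sub>o\<^sub>c\<close>.
\<close>

definition io_map0 ::
  "('x::complex_banach \<Rightarrow> 'y::complex_banach) \<Rightarrow> (real \<Rightarrow> 'y \<Rightarrow> 'y) \<Rightarrow>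
   ('b::complex_banach \<Rightarrow> 'y) \<Rightarrow> ('x \<Rightarrow> 'b) \<Rightarrow> 'b aefun \<Rightarrow> 'b aefun" where
  "io_map0 j Te B M v = ae_class (\<lambda>t. if 0 \<le> t then M (input_map j Te B t v) else 0)"

definition io_map ::
  "real \<Rightarrow> ('x::complex_banach \<Rightarrow> 'y::complex_banach) \<Rightarrow> (real \<Rightarrow> 'y \<Rightarrow> 'y) \<Rightarrow>
   ('b::complex_banach \<Rightarrow> 'y) \<Rightarrow> ('x \<Rightarrow> 'b) \<Rightarrow> 'b aefun \<Rightarrow> 'b aefun" where
  "io_map p j Te B M v = (THE w. w \<in> Lp_loc p \<and>
     (\<forall>\<tau>>0. \<exists>vn. (\<forall>n::nat. vn n \<in> W2p_loc_0 p) \<and>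
        (\<lambda>n. Lp_norm p (ae_restrict {0..\<tau>} (vn n - v))) \<longlonglongrightarrow> 0 \<and>
        (\<lambda>n. Lp_norm p (ae_restrict {0..\<tau>} (io_map0 j Te B M (vn n) - w))) \<longlonglongrightarrow> 0))"

text \<open>
  The triple \<open>(A, B, C)\<close> with \<open>C\<close> the restriction of \<open>M\<close> to \<open>D = D(A)\<close> is regular with the identity
  as admissible feedback.
\<close>

definition regular_triple ::
  "real \<Rightarrow> 'x::complex_banach set \<Rightarrow> (real \<Rightarrow> 'x \<Rightarrow> 'x) \<Rightarrow> ('x \<Rightarrow> 'y::complex_banach) \<Rightarrow>
   (real \<Rightarrow> 'y \<Rightarrow> 'y) \<Rightarrow> ('b::complex_banach \<Rightarrow> 'y) \<Rightarrow> ('x \<Rightarrow> 'b) \<Rightarrow> bool" where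
  "regular_triple p D T j Te B M \<longleftrightarrow>
     (\<exists>\<tau>>0. \<forall>v\<in>Lp p {0..}. \<exists>x.
        ((\<lambda>s. Te (\<tau> - s) (B (rep_ae v s))) has_integral j x) {0..\<tau>}) \<and>
     (\<exists>\<tau>>0. \<exists>\<gamma>>0. \<forall>z\<in>D.
        (\<integral>\<^sup>+ s\<in>{0..\<tau>}. ennreal (norm (M (T s z)) powr p) \<partial>lebesgue)
          \<le> ennreal (\<gamma> powr p * norm z powr p)) \<and>
     (\<forall>\<tau>>0. \<exists>\<kappa>. \<forall>v\<in>W2p_loc_0 p.
        ae_restrict {0..\<tau>} (io_map0 j Te B M v) \<in> Lp p {0..\<tau>} \<and>
        Lp_norm p (ae_restrict {0..\<tau>} (io_map0 j Te B M v))
          \<le> \<kappa> * Lp_norm p (ae_restrict {0..\<tau>} v)) \<and>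
     (\<forall>v. ((\<lambda>\<tau>. (1 / \<tau>) *\<^sub>R integral {0..\<tau>}
              (rep_ae (io_map p j Te B M (ae_class (\<lambda>t. if 0 \<le> t then v else 0)))))
            \<longlongrightarrow> 0) (at_right 0)) \<and>
     (\<exists>\<tau>>0. 1 \<in> resolvent_set (Lp p {0..\<tau>}) (Lp_norm p) (Lp p {0..\<tau>})
                  (\<lambda>u. ae_restrict {0..\<tau>} (io_map p j Te B M u)))"

section \<open>Operator-valued Riemann--Stieltjes integrals\<close>

definition has_rs_integral ::
  "(real \<Rightarrow> 'a::complex_banach \<Rightarrow>\<^sub>L 'b::complex_banach) \<Rightarrow> (real \<Rightarrow> 'a) \<Rightarrow> 'b \<Rightarrow>
   real \<Rightarrow> real \<Rightarrow> bool" where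
  "has_rs_integral \<eta> f I a b \<longleftrightarrow>
     (\<forall>e>0. \<exists>\<delta>>0. \<forall>P. P tagged_division_of {a..b} \<and> (\<forall>(x, K)\<in>P. Sup K - Inf K < \<delta>) \<longrightarrow>
        norm ((\<Sum>(x, K)\<in>P. blinfun_apply (\<eta> (Sup K) - \<eta> (Inf K)) (f x)) - I) < e)"

definition rs_integral ::
  "real \<Rightarrow> real \<Rightarrow> (real \<Rightarrow> 'a::complex_banach \<Rightarrow>\<^sub>L 'b::complex_banach) \<Rightarrow> (real \<Rightarrow> 'a) \<Rightarrow> 'b"
  where
  "rs_integral a b \<eta> f = (THE I. has_rs_integral \<eta> f I a b)"

definition total_variation ::
  "real \<Rightarrow> real \<Rightarrow> (real \<Rightarrow> 'a::real_normed_vector) \<Rightarrow> ennreal" where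
  "total_variation a b \<eta> =
     (SUP d\<in>{d. d division_of {a..b}}. \<Sum>K\<in>d. ennreal (norm (\<eta> (Sup K) - \<eta> (Inf K))))"

definition delay_kernel ::
  "real \<Rightarrow> (real \<Rightarrow> 'a::complex_banach \<Rightarrow>\<^sub>L 'b::complex_banach) \<Rightarrow> bool" where
  "delay_kernel r \<eta> \<longleftrightarrow>
     (\<forall>\<theta>\<in>{-r..0}. clinear_on UNIV (blinfun_apply (\<eta> \<theta>))) \<and>
     total_variation (-r) 0 \<eta> < \<infinity> \<and>
     ((\<lambda>\<epsilon>. total_variation (-\<epsilon>) 0 \<eta>) \<longlongrightarrow> 0) (at_right 0)"

section \<open>The neutral delay system\<close>

text \<open>
  The data \<open>r\<close>, \<open>p\<close>, \<open>Z\<close>, \<open>A\<^sub>m\<close>, \<open>G\<close>, \<open>M\<close> and the kernels \<open>\<eta>\<close>, \<open>\<gamma>\<close>, \<open>\<nu>\<close>, \<open>\<vartheta>\<close> of the delay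
  operators \<open>D\<close>, \<open>L\<close>, \<open>B\<^sub>1\<close>, \<open>K\<^sub>1\<close>, in this order.
\<close>

record (overloaded) ('x, 'b, 'u) delay_system =
  lag :: real
  expo :: real
  dom_m :: "'x::complex_banach set"
  op_m :: "'x \<Rightarrow> 'x"
  op_G :: "'x \<Rightarrow> 'b::complex_banach"
  op_M :: "'x \<Rightarrow> 'b"
  ker_D :: "real \<Rightarrow> 'x \<Rightarrow>\<^sub>L 'x"
  ker_L :: "real \<Rightarrow> 'x \<Rightarrow>\<^sub>L 'x"
  ker_B1 :: "real \<Rightarrow> 'u::complex_banach \<Rightarrow>\<^sub>L 'x"
  ker_K1 :: "real \<Rightarrow> 'u \<Rightarrow>\<^sub>L 'x"

definition standing_assumptions ::
  "('x::complex_banach, 'b::complex_banach, 'u::complex_banach) delay_system \<Rightarrow> bool" where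
  "standing_assumptions S \<longleftrightarrow>
     0 < lag S \<and> 1 \<le> expo S \<and>
     csubspace (dom_m S) \<and> closure (dom_m S) = UNIV \<and>
     clinear_on (dom_m S) (op_m S) \<and> closed {(z, op_m S z) | z. z \<in> dom_m S} \<and>
     clinear_on (dom_m S) (op_G S) \<and> clinear_on (dom_m S) (op_M S) \<and>
     (\<exists>K. \<forall>z\<in>dom_m S. norm (op_G S z) \<le> K * (norm z + norm (op_m S z))) \<and>
     (\<exists>K. \<forall>z\<in>dom_m S. norm (op_M S z) \<le> K * (norm z + norm (op_m S z))) \<and>
     delay_kernel (lag S) (ker_D S) \<and> delay_kernel (lag S) (ker_L S) \<and>
     delay_kernel (lag S) (ker_B1 S) \<and> delay_kernel (lag S) (ker_K1 S)"

subsection \<open>Boundary operators\<close>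

definition dom_A :: "('x::complex_banach, 'b::complex_banach, 'u::complex_banach) delay_system
    \<Rightarrow> 'x set" where
  "dom_A S = {z \<in> dom_m S. op_G S z = 0}"

definition dom_GM :: "('x::complex_banach, 'b::complex_banach, 'u::complex_banach) delay_system
    \<Rightarrow> 'x set" where
  "dom_GM S = {z \<in> dom_m S. op_G S z = op_M S z}"

definition R_GM :: "('x::complex_banach, 'b::complex_banach, 'u::complex_banach) delay_system
    \<Rightarrow> complex \<Rightarrow> 'x \<Rightarrow> 'x" where
  "R_GM S \<mu> = resolvent (dom_GM S) (op_m S) \<mu>"

definition dirichlet :: "('x::complex_banach, 'b::complex_banach, 'u::complex_banach) delay_system
    \<Rightarrow> complex \<Rightarrow> 'b \<Rightarrow> 'x" where
  "dirichlet S \<mu> = the_inv_into {z \<in> dom_m S. \<mu> *\<^sub>C z - op_m S z = 0} (op_G S)"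

definition MD :: "('x::complex_banach, 'b::complex_banach, 'u::complex_banach) delay_system
    \<Rightarrow> complex \<Rightarrow> 'b \<Rightarrow> 'b" where
  "MD S \<mu> v = op_M S (dirichlet S \<mu> v)"

text \<open>
  The operator \<open>B = (\<mu> - A\<^sub>-\<^sub>1) D\<^sub>\<mu>\<close>; it does not depend on \<open>\<mu>\<close> in the resolvent set of \<open>A\<close>.
\<close>

definition control_op ::
  "('x::complex_banach, 'b::complex_banach, 'u::complex_banach) delay_system \<Rightarrow>
   ('x \<Rightarrow> 'y::complex_banach) \<Rightarrow> ('x \<Rightarrow> 'y) \<Rightarrow> complex \<Rightarrow> 'b \<Rightarrow> 'y" where
  "control_op S j Ae \<mu> v = \<mu> *\<^sub>C j (dirichlet S \<mu> v) - Ae (dirichlet S \<mu> v)"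

subsection \<open>Delay and shift operators\<close>

abbreviation LpE :: "('x::complex_banach, 'b::complex_banach, 'u::complex_banach) delay_system
    \<Rightarrow> 'e::complex_banach aefun set" where
  "LpE S \<equiv> Lp (expo S) {- lag S..0}"

abbreviation WpE :: "('x::complex_banach, 'b::complex_banach, 'u::complex_banach) delay_system
    \<Rightarrow> 'e::complex_banach aefun set" where
  "WpE S \<equiv> W1p (expo S) (- lag S) 0"

abbreviation WpE_norm :: "('x::complex_banach, 'b::complex_banach, 'u::complex_banach) delay_system
    \<Rightarrow> 'e::complex_banach aefun \<Rightarrow> real" where
  "WpE_norm S \<equiv> W1p_norm (expo S) (- lag S) 0"

definition at0 :: "('x::complex_banach, 'b::complex_banach, 'u::complex_banach) delay_system
    \<Rightarrow> 'e::complex_banach aefun \<Rightarrow> 'e" where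
  "at0 S \<xi> = cont_rep (expo S) (- lag S) 0 \<xi> 0"

definition Qm :: "('x::complex_banach, 'b::complex_banach, 'u::complex_banach) delay_system
    \<Rightarrow> 'e::complex_banach aefun \<Rightarrow> 'e aefun" where
  "Qm S \<xi> = weak_deriv (expo S) (- lag S) 0 \<xi>"

definition delay_op :: "('x::complex_banach, 'b::complex_banach, 'u::complex_banach) delay_system
    \<Rightarrow> (real \<Rightarrow> 'e::complex_banach \<Rightarrow>\<^sub>L 'x) \<Rightarrow> 'e aefun \<Rightarrow> 'x" where
  "delay_op S \<eta> \<xi> = rs_integral (- lag S) 0 \<eta> (cont_rep (expo S) (- lag S) 0 \<xi>)"

abbreviation "opD S \<equiv> delay_op S (ker_D S)"
abbreviation "opL S \<equiv> delay_op S (ker_L S)"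
abbreviation "opB1 S \<equiv> delay_op S (ker_B1 S)"
abbreviation "opK1 S \<equiv> delay_op S (ker_K1 S)"

definition e_mu :: "('x::complex_banach, 'b::complex_banach, 'u::complex_banach) delay_system
    \<Rightarrow> complex \<Rightarrow> 'e::complex_banach \<Rightarrow> 'e aefun" where
  "e_mu S \<mu> z =
     ae_class (\<lambda>\<theta>. if \<theta> \<in> {- lag S..0} then exp (\<mu> * complex_of_real \<theta>) *\<^sub>C z else 0)"

definition De :: "('x::complex_banach, 'b::complex_banach, 'u::complex_banach) delay_system
    \<Rightarrow> complex \<Rightarrow> 'x \<Rightarrow> 'x" where
  "De S \<mu> z = opD S (e_mu S \<mu> z)"

definition R_Q :: "('x::complex_banach, 'b::complex_banach, 'u::complex_banach) delay_system
    \<Rightarrow> complex \<Rightarrow> 'u aefun \<Rightarrow> 'u aefun" where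
  "R_Q S \<mu> = resolvent {\<xi> \<in> WpE S. at0 S \<xi> = 0} (Qm S) \<mu>"

definition R_QD :: "('x::complex_banach, 'b::complex_banach, 'u::complex_banach) delay_system
    \<Rightarrow> complex \<Rightarrow> 'x aefun \<Rightarrow> 'x aefun" where
  "R_QD S \<mu> = resolvent {\<phi> \<in> WpE S. at0 S \<phi> = opD S \<phi>} (Qm S) \<mu>"

subsection \<open>The product space operator\<close>

definition prod_space :: "('x::complex_banach, 'b::complex_banach, 'u::complex_banach) delay_system
    \<Rightarrow> ('x \<times> 'x aefun \<times> 'u aefun) set" where
  "prod_space S = UNIV \<times> LpE S \<times> LpE S"

definition prod_norm :: "('x::complex_banach, 'b::complex_banach, 'u::complex_banach) delay_system
    \<Rightarrow> 'x \<times> 'x aefun \<times> 'u aefun \<Rightarrow> real" where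
  "prod_norm S = (\<lambda>(x, \<phi>, \<psi>). norm x + Lp_norm (expo S) \<phi> + Lp_norm (expo S) \<psi>)"

definition dom_frakA :: "('x::complex_banach, 'b::complex_banach, 'u::complex_banach) delay_system
    \<Rightarrow> ('x \<times> 'x aefun \<times> 'u aefun) set" where
  "dom_frakA S = {(x, \<phi>, \<psi>). x \<in> dom_m S \<and> \<phi> \<in> WpE S \<and> \<psi> \<in> WpE S \<and>
     op_G S x = op_M S x \<and> at0 S \<phi> = x + opD S \<phi> + opK1 S \<psi> \<and> at0 S \<psi> = 0}"

definition calA :: "('x::complex_banach, 'b::complex_banach, 'u::complex_banach) delay_system
    \<Rightarrow> 'x \<times> 'x aefun \<times> 'u aefun \<Rightarrow> 'x \<times> 'x aefun \<times> 'u aefun" where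
  "calA S = (\<lambda>(x, \<phi>, \<psi>). (op_m S x, Qm S \<phi>, Qm S \<psi>))"

definition calP :: "('x::complex_banach, 'b::complex_banach, 'u::complex_banach) delay_system
    \<Rightarrow> 'x \<times> 'x aefun \<times> 'u aefun \<Rightarrow> 'x \<times> 'x aefun \<times> 'u aefun" where
  "calP S = (\<lambda>(x, \<phi>, \<psi>). (opL S \<phi> + opB1 S \<psi>, 0, 0))"

definition frakA :: "('x::complex_banach, 'b::complex_banach, 'u::complex_banach) delay_system
    \<Rightarrow> 'x \<times> 'x aefun \<times> 'u aefun \<Rightarrow> 'x \<times> 'x aefun \<times> 'u aefun" where
  "frakA S w = calA S w + calP S w"

subsection \<open>The characteristic operator\<close>

text \<open>
  \<open>e\<^sub>\<mu> (I - D e\<^sub>\<mu>)\<^sup>-\<^sup>1\<close>; it is meaningful when \<open>1\<close> is in the resolvent set of \<open>D e\<^sub>\<mu>\<close>.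
\<close>

definition lift_mu :: "('x::complex_banach, 'b::complex_banach, 'u::complex_banach) delay_system
    \<Rightarrow> complex \<Rightarrow> 'x \<Rightarrow> 'x aefun" where
  "lift_mu S \<mu> x = e_mu S \<mu> (resolvent UNIV (De S \<mu>) 1 x)"

text \<open>
  As \<open>L\<close> is defined on \<open>W\<^sup>1\<^sup>,\<^sup>p\<close> only, \<open>\<Delta>(\<mu>)\<close> is a bounded operator on that space.  It is
  meaningful only if \<open>\<mu>\<close> is in the resolvent set of \<open>A\<^sub>G\<^sub>,\<^sub>M\<close> and \<open>1\<close> in that of \<open>D e\<^sub>\<mu>\<close>.
\<close>

definition Delta :: "('x::complex_banach, 'b::complex_banach, 'u::complex_banach) delay_system
    \<Rightarrow> complex \<Rightarrow> 'x aefun \<Rightarrow> 'x aefun" where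
  "Delta S \<mu> \<phi> = lift_mu S \<mu> (R_GM S \<mu> (opL S \<phi>))"

definition R_Delta :: "('x::complex_banach, 'b::complex_banach, 'u::complex_banach) delay_system
    \<Rightarrow> complex \<Rightarrow> 'x aefun \<Rightarrow> 'x aefun" where
  "R_Delta S \<mu> = resolvent (WpE S) (Delta S \<mu>) 1"

definition Gamma_op :: "('x::complex_banach, 'b::complex_banach, 'u::complex_banach) delay_system
    \<Rightarrow> complex \<Rightarrow> 'x \<Rightarrow> 'x aefun" where
  "Gamma_op S \<mu> x = R_Delta S \<mu> (lift_mu S \<mu> x)"

definition Omega_op :: "('x::complex_banach, 'b::complex_banach, 'u::complex_banach) delay_system
    \<Rightarrow> complex \<Rightarrow> 'u aefun \<Rightarrow> 'x aefun" where
  "Omega_op S \<mu> \<psi> = Gamma_op S \<mu> (opK1 S \<psi> + R_GM S \<mu> (opB1 S \<psi>))"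

definition Lambda_op :: "('x::complex_banach, 'b::complex_banach, 'u::complex_banach) delay_system
    \<Rightarrow> complex \<Rightarrow> 'u aefun \<Rightarrow> 'x" where
  "Lambda_op S \<mu> \<psi> = R_GM S \<mu> (opL S (Omega_op S \<mu> \<psi>) + opB1 S \<psi>)"

subsection \<open>Resolvent sets of the operators of the system\<close>

abbreviation "rho_A S \<equiv> resolvent_set UNIV norm (dom_A S) (op_m S)"
abbreviation "rho_GM S \<equiv> resolvent_set UNIV norm (dom_GM S) (op_m S)"
abbreviation "rho_MD S \<mu> \<equiv> resolvent_set UNIV norm UNIV (MD S \<mu>)"
abbreviation "rho_De S \<mu> \<equiv> resolvent_set UNIV norm UNIV (De S \<mu>)"
abbreviation "rho_Delta S \<mu> \<equiv> resolvent_set (WpE S) (WpE_norm S) (WpE S) (Delta S \<mu>)"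
abbreviation "rho_frakA S \<equiv> resolvent_set (prod_space S) (prod_norm S) (dom_frakA S) (frakA S)"

end

theory Submission
  imports Defs
begin

text \<open>
  The equation \<open>\<mu> w - \<AA> w = (f, g, h)\<close> for \<open>w = (x, \<phi>, \<psi>)\<close> is solved by elimination.  Its third
  component is an ordinary shift equation with value zero at \<open>0\<close>, so \<open>\<psi> = R(\<mu>, Q) h\<close>.  The first one
  says \<open>x = R(\<mu>, A\<^sub>G\<^sub>,\<^sub>M) (f + L \<phi> + B\<^sub>1 \<psi>)\<close>.  The second one is \<open>\<mu> \<phi> - \<phi>' = g\<close> with the boundary
  condition \<open>\<phi>(0) - D \<phi> = x + K\<^sub>1 \<psi>\<close>; its solution is \<open>R(\<mu>, Q\<^sub>D) g + e\<^sub>\<mu> (I - D e\<^sub>\<mu>)\<^sup>-\<^sup>1 (x + K\<^sub>1 \<psi>)\<close>,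
  because every solution of the homogeneous shift equation is of the form \<open>e\<^sub>\<mu> z\<close>.  Inserting \<open>x\<close> leaves
  a single equation \<open>(I - \<Delta>(\<mu>)) \<phi> = \<dots>\<close> in \<open>W\<^sup>1\<^sup>,\<^sup>p\<close> (\<open>frakA_equation_iff\<close>).  If \<open>I - \<Delta>(\<mu>)\<close> is
  invertible, then so is \<open>\<mu> - \<AA>\<close>, and solving for \<open>\<phi>\<close> and \<open>x\<close> produces the operator matrix
  (\<open>resolvent_frakA\<close>).  Conversely, the data \<open>(L y, 0, 0)\<close> have the reduced right-hand side \<open>\<Delta>(\<mu>) y\<close>,
  so invertibility of \<open>\<mu> - \<AA>\<close> gives that of \<open>I - \<Delta>(\<mu>)\<close> (\<open>rho_frakA_iff\<close>).

  That \<open>\<mu>\<close> lies in the resolvent set of \<open>A\<^sub>G\<^sub>,\<^sub>M\<close> (\<open>mu_rho_GM\<close>) is elimination as well: subtracting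
  \<open>R(\<mu>, A) f\<close> leaves an element \<open>D\<^sub>\<mu> v\<close> of the kernel of \<open>\<mu> - A\<^sub>m\<close>, where \<open>v\<close> solves an equation with
  \<open>I - M D\<^sub>\<mu>\<close>.  Boundedness of the inverse follows from the closed graph theorem, which is derived from
  Baire's theorem.

  The operators act on spaces of classes of vector-valued functions, and most of the work is to establish
  these spaces.  The values lie in Banach spaces that need not be separable.  The function spaces rest on one
  approximation result: a strongly measurable function with integrable norm is the limit in mean of
  continuous functions (\<open>L1_approximable_strongly_measurable\<close>).  It gives integrability, uniqueness of
  weak derivatives (\<open>AE_zero_of_indefinite_integral_zero\<close>) and, by passing to the limit from the classical
  case, the variation of constants formula for the shift equation (\<open>shift_fun_solution\<close>).  The delay
  operators are Riemann--Stieltjes integrals against operator-valued functions of bounded variation, hence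
  bounded for the supremum norm, which \<open>W\<^sup>1\<^sup>,\<^sup>p\<close> controls (\<open>cont_rep_bound\<close>).
\<close>

section \<open>Complex scalar multiplication\<close>

lemma scaleC_one [simp]: "1 *\<^sub>C x = (x :: 'a::complex_vector)"
  by (metis of_real_1 scaleR_one scaleR_scaleC)

lemma scaleC_zero_left [simp]: "0 *\<^sub>C x = (0 :: 'a::complex_vector)"
  by (metis of_real_0 scaleR_zero_left scaleR_scaleC)

lemma scaleC_zero_right [simp]: "c *\<^sub>C 0 = (0 :: 'a::complex_vector)"
  using scaleC_add_right[of c 0 "0::'a"] by simp

lemma scaleC_minus_right [simp]: "c *\<^sub>C (- x) = - (c *\<^sub>C (x :: 'a::complex_vector))"
  by (metis add.right_inverse add_eq_0_iff scaleC_add_right scaleC_zero_right)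

lemma scaleC_diff_right: "c *\<^sub>C (x - y) = c *\<^sub>C x - c *\<^sub>C (y :: 'a::complex_vector)"
  using scaleC_add_right[of c x "- y"] by simp

lemma scaleC_minus_one: "(- 1) *\<^sub>C x = - (x :: 'a::complex_vector)"
  using scaleC_add_left[of "- 1" 1 x] by (simp add: eq_neg_iff_add_eq_0)

lemma bounded_bilinear_scaleC:
  "bounded_bilinear (\<lambda>c (x :: 'a::complex_banach). c *\<^sub>C x)"
proof (rule bounded_bilinear.intro)
  fix r :: real and c :: complex and x y :: 'a
  show "(r *\<^sub>R c) *\<^sub>C x = r *\<^sub>R (c *\<^sub>C x)"
    by (metis scaleR_conv_of_real scaleC_scaleC scaleR_scaleC)
  show "c *\<^sub>C (r *\<^sub>R x) = r *\<^sub>R (c *\<^sub>C x)"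
    by (simp add: scaleR_scaleC scaleC_scaleC mult.commute)
  show "\<exists>K. \<forall>c (x :: 'a). norm (c *\<^sub>C x) \<le> norm c * norm x * K"
    by (rule exI[of _ 1]) (simp add: norm_scaleC)
qed (simp_all add: scaleC_add_left scaleC_add_right)

lemmas bounded_linear_scaleC = bounded_bilinear.bounded_linear_right[OF bounded_bilinear_scaleC]

lemma clinear_on_UNIV_linear: "clinear_on UNIV f \<Longrightarrow> linear f"
  by (auto intro!: linearI simp: clinear_on_def scaleR_scaleC)

lemma clinear_on_add: "clinear_on S f \<Longrightarrow> x \<in> S \<Longrightarrow> y \<in> S \<Longrightarrow> f (x + y) = f x + f y"
  and clinear_on_scaleC: "clinear_on S f \<Longrightarrow> x \<in> S \<Longrightarrow> f (c *\<^sub>C x) = c *\<^sub>C f x"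
  by (auto simp: clinear_on_def)

lemma csubspace_diff: "csubspace S \<Longrightarrow> x \<in> S \<Longrightarrow> y \<in> S \<Longrightarrow> x - y \<in> S"
  unfolding csubspace_def by (metis scaleC_minus_one uminus_add_conv_diff add.commute)

lemma clinear_on_diff:
  assumes "csubspace S" "clinear_on S f" "x \<in> S" "y \<in> S"
  shows "f (x - y) = f x - f y"
  using clinear_on_add[OF assms(2) csubspace_diff[OF assms(1,3,4)] assms(4)] by simp

section \<open>The closed graph theorem\<close>

text \<open>
  By Baire's theorem one of the closures of the sets \<open>{x. norm (f x) \<le> n}\<close> has interior points.
  Differences of its points fill a ball around zero, and scaling this ball reaches every \<open>x\<close>.
\<close>

lemma closed_graph_approximate_preimage:
  fixes f :: "'a::banach \<Rightarrow> 'b::real_normed_vector"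
  assumes f: "linear f"
  shows "\<exists>C\<ge>0. \<forall>x. \<forall>d>0. \<exists>y. norm (x - y) < d \<and> norm (f y) \<le> C * norm x"
proof -
  interpret linear f by fact
  define V where "V n = {x. norm (f x) \<le> real n}" for n
  have "\<exists>n. interior (closure (V n)) \<noteq> {}"
  proof (rule ccontr)
    assume "\<not> ?thesis"
    then have "euclidean interior_of \<Union>(range (\<lambda>n. closure (V n))) = {}"
    proof (intro Baire_category_alt)
      show "completely_metrizable_space (euclidean :: 'a topology) \<or>
          locally_compact_space (euclidean :: 'a topology) \<and> regular_space (euclidean :: 'a topology)"
        using completely_metrizable_space_euclidean by blast
      show "countable (range (\<lambda>n. closure (V n)))" by simp
      show "closedin euclidean T \<and> euclidean interior_of T = {}"
        if "T \<in> range (\<lambda>n. closure (V n))" for T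
        using that \<open>\<not> _\<close> by auto
    qed
    moreover have "x \<in> \<Union>(range (\<lambda>n. closure (V n)))" for x
    proof -
      obtain n where "x \<in> V n" using real_arch_simple unfolding V_def by blast
      then show ?thesis using closure_subset by blast
    qed
    then have "\<Union>(range (\<lambda>n. closure (V n))) = UNIV" by blast
    ultimately show False by simp
  qed
  then obtain n x0 where "x0 \<in> interior (closure (V n))" by blast
  then obtain e where e: "e > 0" "ball x0 e \<subseteq> closure (V n)"
    unfolding mem_interior by blast
  have small: "\<exists>y. norm (x - y) < d \<and> norm (f y) \<le> 2 * real n" if "norm x < e" "d > 0" for x d
  proof -
    have "x0 \<in> closure (V n)" "x0 + x \<in> closure (V n)"
      using e that by (auto simp: dist_norm)
    moreover have "d / 2 > 0" using that by simp
    ultimately obtain u v where u: "u \<in> V n" "dist u x0 < d / 2"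
      and v: "v \<in> V n" "dist v (x0 + x) < d / 2"
      unfolding closure_approachable by meson
    have "norm (x - (v - u)) = norm ((u - x0) - (v - (x0 + x)))" by (simp add: algebra_simps)
    also have "\<dots> < d" using u v norm_triangle_ineq4[of "u - x0" "v - (x0 + x)"]
      by (simp add: dist_norm)
    finally have "norm (x - (v - u)) < d" .
    moreover have "norm (f (v - u)) \<le> 2 * real n"
      using u v norm_triangle_ineq4[of "f v" "f u"] by (simp add: V_def diff)
    ultimately show ?thesis by blast
  qed
  define C where "C = 2 * real n * (2 / e)"
  have "\<exists>y. norm (x - y) < d \<and> norm (f y) \<le> C * norm x" if "d > 0" for x d
  proof (cases "x = 0")
    case True
    then show ?thesis using that by (intro exI[of _ 0]) (simp add: zero)
  next
    case False
    define c where "c = e / (2 * norm x)"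
    have c: "c > 0" using False e by (simp add: c_def)
    have "norm (c *\<^sub>R x) < e" "c * d > 0" using c e False that by (auto simp: c_def)
    then obtain y where y: "norm (c *\<^sub>R x - y) < c * d" "norm (f y) \<le> 2 * real n"
      using small by blast
    have "x - (1 / c) *\<^sub>R y = (1 / c) *\<^sub>R (c *\<^sub>R x - y)" using c by (simp add: algebra_simps)
    then have "norm (x - (1 / c) *\<^sub>R y) = norm (c *\<^sub>R x - y) / c" using c by simp
    then have "norm (x - (1 / c) *\<^sub>R y) < d" using c y by (simp add: pos_divide_less_eq mult.commute)
    moreover have "norm (f ((1 / c) *\<^sub>R y)) \<le> C * norm x"
    proof -
      have "norm (f ((1 / c) *\<^sub>R y)) = (1 / c) * norm (f y)" using c by (simp add: scale)
      also have "\<dots> \<le> (1 / c) * (2 * real n)" using c y by (intro mult_left_mono) auto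
      also have "\<dots> = C * norm x" using False e by (simp add: C_def c_def field_simps)
      finally show ?thesis .
    qed
    ultimately show ?thesis by blast
  qed
  moreover have "C \<ge> 0" using e by (simp add: C_def)
  ultimately show ?thesis by blast
qed

text \<open>
  Approximating the remainder again and again writes \<open>x\<close> as a series whose image under \<open>f\<close> is
  dominated by a geometric series; closedness of the graph identifies the limit of the images.
\<close>

theorem closed_graph_theorem:
  fixes f :: "'a::banach \<Rightarrow> 'b::banach"
  assumes f: "linear f"
    and closed: "\<And>s x y. s \<longlonglongrightarrow> x \<Longrightarrow> (\<lambda>n. f (s n)) \<longlonglongrightarrow> y \<Longrightarrow> f x = y"
  shows "bounded_linear f"
proof -
  interpret linear f by fact
  obtain C where C: "C \<ge> 0" "\<And>x d. d > 0 \<Longrightarrow> \<exists>y. norm (x - y) < d \<and> norm (f y) \<le> C * norm x"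
    using closed_graph_approximate_preimage[OF f] by metis
  have bound: "norm (f x) \<le> norm x * (2 * C)" for x
  proof (cases "x = 0")
    case True
    then show ?thesis by (simp add: zero)
  next
    case False
    define pick where
      "pick (k::nat) r = (SOME y. norm (r - y) < norm x * (1/2) ^ Suc k \<and> norm (f y) \<le> C * norm r)" for k r
    have pick: "norm (r - pick k r) < norm x * (1/2) ^ Suc k \<and> norm (f (pick k r)) \<le> C * norm r"
      for k :: nat and r
    proof -
      have "0 < norm x * (1/2) ^ Suc k" using False by simp
      then show ?thesis unfolding pick_def by (rule someI_ex[OF C(2)])
    qed
    define r where "r = rec_nat x (\<lambda>k r. r - pick k r)"
    have r0: "r 0 = x" and rS: "r (Suc k) = r k - pick k (r k)" for k :: nat by (simp_all add: r_def)
    define y where "y k = pick k (r k)" for k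
    have r_le: "norm (r k) \<le> norm x * (1/2) ^ k" for k
      by (cases k) (use pick less_imp_le in \<open>auto simp: r0 rS\<close>)
    have fy: "norm (f (y k)) \<le> C * (norm x * (1/2) ^ k)" for k
      using pick[of "r k" k] mult_left_mono[OF r_le[of k] C(1)] by (simp add: y_def)
    have geo: "(\<lambda>k. C * (norm x * (1/2) ^ k)) sums (C * (norm x * 2))"
      using geometric_sums[of "1/2 :: real"] by (intro sums_mult) simp
    have sm: "summable (\<lambda>k. f (y k))"
      by (rule summable_comparison_test'[OF sums_summable[OF geo]]) (rule fy)
    have part: "(\<Sum>k<n. y k) = x - r n" for n
      by (induction n) (auto simp: r0 rS y_def)
    have "(\<lambda>n. norm x * (1/2) ^ n) \<longlonglongrightarrow> 0"
      by (intro tendsto_mult_right_zero LIMSEQ_realpow_zero) auto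
    then have "r \<longlonglongrightarrow> 0"
      by (rule Lim_null_comparison[rotated]) (simp add: r_le)
    then have "(\<lambda>n. x - r n) \<longlonglongrightarrow> x - 0"
      by (intro tendsto_diff tendsto_const)
    then have "(\<lambda>n. \<Sum>k<n. y k) \<longlonglongrightarrow> x"
      by (simp add: part)
    moreover have "(\<lambda>n. f (\<Sum>k<n. y k)) \<longlonglongrightarrow> (\<Sum>k. f (y k))"
      using summable_LIMSEQ[OF sm] by (simp add: sum)
    ultimately have "f x = (\<Sum>k. f (y k))" by (rule closed)
    also have "norm \<dots> \<le> (\<Sum>k. C * (norm x * (1/2) ^ k))"
      by (intro norm_suminf_le fy sums_summable[OF geo])
    also have "\<dots> = norm x * (2 * C)" using geo by (simp add: sums_iff)
    finally show ?thesis .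
  qed
  show ?thesis by (rule bounded_linear_intro[OF add scale bound])
qed

section \<open>Function classes and strong measurability\<close>

lemma ae_class_eq_iff: "ae_class f = ae_class g \<longleftrightarrow> (AE t in lebesgue. f t = g t)"
  by (rule aefun.abs_eq_iff)

lemma ae_class_rep [simp]: "ae_class (rep_ae u) = u"
  using Quotient3_abs_rep[OF Quotient3_aefun] by blast

lemma rep_ae_class: "AE t in lebesgue. rep_ae (ae_class f) t = f t"
  using ae_class_eq_iff[of "rep_ae (ae_class f)" f] by simp

lemma ae_class_add: "ae_class f + ae_class g = ae_class (\<lambda>t. f t + g t)"
  and ae_class_diff: "ae_class f - ae_class g = ae_class (\<lambda>t. f t - g t)"
  and ae_class_scaleC: "c *\<^sub>C ae_class f = ae_class (\<lambda>t. c *\<^sub>C f t)"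
  and ae_class_zero: "0 = ae_class (\<lambda>t. 0)"
  by (simp_all add: plus_aefun.abs_eq minus_aefun.abs_eq scaleC_aefun.abs_eq zero_aefun.abs_eq)

lemma ae_restrict_class: "ae_restrict S (ae_class f) = ae_class (\<lambda>t. if t \<in> S then f t else 0)"
  by (rule ae_restrict.abs_eq)

lemma rep_ae_add: "AE t in lebesgue. rep_ae (u + v) t = rep_ae u t + rep_ae v t"
  using rep_ae_class[of "\<lambda>t. rep_ae u t + rep_ae v t"]
  by (simp flip: ae_class_add)

lemma rep_ae_scaleC: "AE t in lebesgue. rep_ae (c *\<^sub>C u) t = c *\<^sub>C rep_ae u t"
  using rep_ae_class[of "\<lambda>t. c *\<^sub>C rep_ae u t"]
  by (simp flip: ae_class_scaleC)

lemma strongly_measurable_cong_AE: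
  assumes "strongly_measurable f" "AE t in lebesgue. f t = g t"
  shows "strongly_measurable g"
proof -
  obtain s where s: "\<And>n::nat. simple_function lebesgue (s n)"
    "AE t in lebesgue. (\<lambda>n. s n t) \<longlonglongrightarrow> f t"
    using assms(1) by (auto simp: strongly_measurable_def)
  from s(2) assms(2) have "AE t in lebesgue. (\<lambda>n. s n t) \<longlonglongrightarrow> g t"
    by eventually_elim simp
  with s show ?thesis by (auto simp: strongly_measurable_def)
qed

lemma strongly_measurable_simple: "simple_function lebesgue s \<Longrightarrow> strongly_measurable s"
  unfolding strongly_measurable_def by (rule exI[of _ "\<lambda>_. s"]) auto

lemma strongly_measurable_compose2:
  fixes h :: "'a::complex_banach \<Rightarrow> 'b::complex_banach \<Rightarrow> 'c::complex_banach"
  assumes "strongly_measurable f" "strongly_measurable g"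
    and h: "\<And>x y. isCont (\<lambda>(x, y). h x y) (x, y)"
  shows "strongly_measurable (\<lambda>t. h (f t) (g t))"
proof -
  obtain s where s: "\<And>n::nat. simple_function lebesgue (s n)"
    "AE t in lebesgue. (\<lambda>n. s n t) \<longlonglongrightarrow> f t"
    using assms(1) by (auto simp: strongly_measurable_def)
  obtain s' where s': "\<And>n::nat. simple_function lebesgue (s' n)"
    "AE t in lebesgue. (\<lambda>n. s' n t) \<longlonglongrightarrow> g t"
    using assms(2) by (auto simp: strongly_measurable_def)
  from s(2) s'(2) have "AE t in lebesgue. (\<lambda>n. h (s n t) (s' n t)) \<longlonglongrightarrow> h (f t) (g t)"
  proof eventually_elim
    case (elim t)
    then have "(\<lambda>n. (s n t, s' n t)) \<longlonglongrightarrow> (f t, g t)" by (intro tendsto_intros)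
    from isCont_tendsto_compose[OF h[of "f t" "g t"] this] show ?case by simp
  qed
  moreover have "simple_function lebesgue (\<lambda>t. h (s n t) (s' n t))" for n
    by (rule simple_function_compose2[OF s(1) s'(1)])
  ultimately show ?thesis
    unfolding strongly_measurable_def by (intro exI[of _ "\<lambda>n t. h (s n t) (s' n t)"]) blast
qed

lemma strongly_measurable_add:
  "strongly_measurable f \<Longrightarrow> strongly_measurable g \<Longrightarrow> strongly_measurable (\<lambda>t. f t + g t)"
proof (rule strongly_measurable_compose2[where h = "(+)"])
  show "isCont (\<lambda>(x, y). x + y) (x, y)" for x y :: 'a
    unfolding case_prod_beta isCont_def by (intro tendsto_intros)+
qed

lemma strongly_measurable_scaleC:
  fixes f :: "real \<Rightarrow> 'a::complex_banach"
  assumes "strongly_measurable c" "strongly_measurable f"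
  shows "strongly_measurable (\<lambda>t. c t *\<^sub>C f t)"
proof (rule strongly_measurable_compose2[OF assms])
  show "isCont (\<lambda>(z, x :: 'a). z *\<^sub>C x) (z, x)" for z x
    unfolding case_prod_beta isCont_def
    by (rule bounded_bilinear.tendsto[OF bounded_bilinear_scaleC]) (intro tendsto_intros)+
qed

text \<open>
  Measure-theoretic arguments are applied to the real function \<open>norm \<circ> f\<close>, because the values of
  \<open>f\<close> lie in a space that need not be separable.
\<close>

lemma borel_measurable_norm_strongly:
  assumes "strongly_measurable f"
  shows "(\<lambda>t. norm (f t)) \<in> borel_measurable lebesgue"
proof -
  obtain s where s: "\<And>n::nat. simple_function lebesgue (s n)"
    "AE t in lebesgue. (\<lambda>n. s n t) \<longlonglongrightarrow> f t"
    using assms by (auto simp: strongly_measurable_def)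
  have m: "(\<lambda>t. norm (s n t)) \<in> borel_measurable lebesgue" for n
    using simple_function_compose1[OF s(1)] by (rule borel_measurable_simple_function)
  have "(\<lambda>t. lim (\<lambda>n. norm (s n t))) \<in> borel_measurable lebesgue"
    by (rule borel_measurable_lim_metric) (rule m)
  moreover have "AE t in lebesgue. lim (\<lambda>n. norm (s n t)) = norm (f t)"
    using s(2) by eventually_elim (auto intro!: limI tendsto_norm)
  ultimately show ?thesis
    by (rule borel_measurable_AE)
qed

text \<open>Evaluating \<open>f\<close> at the argument rounded down to a fine grid gives step functions that converge everywhere.\<close>

lemma strongly_measurable_continuous_on:
  fixes f :: "real \<Rightarrow> 'a::complex_banach"
  assumes f: "continuous_on {a..b} f"
  shows "strongly_measurable (\<lambda>t. if t \<in> {a..b} then f t else 0)"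
proof -
  define q where
    "q n t = (if t \<in> {a..b} then max a (of_int \<lfloor>real (Suc n) * t\<rfloor> / real (Suc n)) else a - 1)" for n t
  have "simple_function lebesgue (q n)" for n
  proof (rule simple_function_borel_measurable)
    have "q n ` space lebesgue \<subseteq> insert (a - 1) ((\<lambda>i. max a (of_int i / real (Suc n))) `
        {\<lfloor>real (Suc n) * a\<rfloor>..\<lfloor>real (Suc n) * b\<rfloor>})"
      by (auto simp: q_def intro!: imageI floor_mono mult_left_mono)
    then show "finite (q n ` space lebesgue)"
      by (rule finite_subset) auto
    have "q n \<in> borel_measurable borel" unfolding q_def by measurable
    then show "q n \<in> borel_measurable lebesgue" by (simp add: measurable_completion)
  qed
  then have "simple_function lebesgue (\<lambda>t. if q n t \<ge> a then f (q n t) else 0)" for n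
    by (rule simple_function_compose1)
  moreover have "(\<lambda>n. if q n t \<ge> a then f (q n t) else 0) \<longlonglongrightarrow> (if t \<in> {a..b} then f t else 0)" for t
  proof (cases "t \<in> {a..b}")
    case False
    then show ?thesis by (auto simp: q_def)
  next
    case True
    have 1: "of_int \<lfloor>real (Suc n) * t\<rfloor> / real (Suc n) \<le> t" for n
      using of_int_floor_le[of "real (Suc n) * t"] by (simp add: field_simps del: of_int_floor_le)
    have 2: "t - 1 / real (Suc n) \<le> of_int \<lfloor>real (Suc n) * t\<rfloor> / real (Suc n)" for n
    proof -
      have "real (Suc n) * t - 1 \<le> of_int \<lfloor>real (Suc n) * t\<rfloor>" by linarith
      then have "(real (Suc n) * t - 1) / real (Suc n) \<le> of_int \<lfloor>real (Suc n) * t\<rfloor> / real (Suc n)"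
        by (rule divide_right_mono) simp
      then show ?thesis by (simp add: diff_divide_distrib)
    qed
    have q: "q n t \<in> {a..b}" "t - 1 / real (Suc n) \<le> q n t" "q n t \<le> t" for n
      using True 1[of n] 2[of n] by (auto simp: q_def max_def)
    have "(\<lambda>n. t - 1 / real (Suc n)) \<longlonglongrightarrow> t - 0"
      by (intro tendsto_intros LIMSEQ_Suc[OF lim_inverse_n', unfolded inverse_eq_divide])
    then have lower: "(\<lambda>n. t - 1 / real (Suc n)) \<longlonglongrightarrow> t" by simp
    have "(\<lambda>n. q n t) \<longlonglongrightarrow> t"
      by (rule real_tendsto_sandwich[OF _ _ lower tendsto_const]) (rule always_eventually, rule allI, rule q)+
    then have "(\<lambda>n. f (q n t)) \<longlonglongrightarrow> f t"
      using f True q(1) by (auto simp: continuous_on_sequentially comp_def)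
    then show ?thesis using True q(1) by simp
  qed
  ultimately show ?thesis
    unfolding strongly_measurable_def
    by (intro exI[of _ "\<lambda>n t. if q n t \<ge> a then f (q n t) else 0"]) auto
qed

section \<open>Approximation in mean by continuous functions\<close>

text \<open>
  The majorant \<open>k\<close> takes the place of the norm of \<open>f - h\<close>: no measurability of this norm has to be
  known in order to add approximations or to compare Riemann sums.
\<close>

definition L1_approximable :: "real \<Rightarrow> real \<Rightarrow> (real \<Rightarrow> 'a::real_normed_vector) \<Rightarrow> bool" where
  "L1_approximable a b f \<longleftrightarrow> (\<forall>e>0. \<exists>h k. continuous_on {a..b} h \<and> k integrable_on {a..b} \<and>
     integral {a..b} k < e \<and> (\<forall>t\<in>{a..b}. norm (f t - h t) \<le> k t))"

lemma L1_approximableE: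
  assumes "L1_approximable a b f" "e > 0"
  obtains h k where "continuous_on {a..b} h" "k integrable_on {a..b}" "integral {a..b} k < e"
    "\<And>t. t \<in> {a..b} \<Longrightarrow> norm (f t - h t) \<le> k t"
  using assms unfolding L1_approximable_def by blast

lemma L1_approximable_limit:
  assumes "\<And>e. e > 0 \<Longrightarrow> \<exists>f k. L1_approximable a b f \<and> k integrable_on {a..b} \<and>
     integral {a..b} k < e \<and> (\<forall>t\<in>{a..b}. norm (g t - f t) \<le> k t)"
  shows "L1_approximable a b g"
  unfolding L1_approximable_def
proof (intro allI impI)
  fix e :: real assume "e > 0"
  then have e: "e / 2 > 0" by simp
  obtain f k where f: "L1_approximable a b f" "k integrable_on {a..b}" "integral {a..b} k < e / 2"
    "\<forall>t\<in>{a..b}. norm (g t - f t) \<le> k t" using assms[OF e] by blast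
  obtain h k' where h: "continuous_on {a..b} h" "k' integrable_on {a..b}"
    "integral {a..b} k' < e / 2" "\<And>t. t \<in> {a..b} \<Longrightarrow> norm (f t - h t) \<le> k' t"
    using L1_approximableE[OF f(1) e] by blast
  have "norm (g t - h t) \<le> k t + k' t" if "t \<in> {a..b}" for t
    using norm_triangle_ineq[of "g t - f t" "f t - h t"] f(4) h(4)[OF that] that by force
  moreover have "integral {a..b} (\<lambda>t. k t + k' t) < e"
    using f h by (simp add: integral_add)
  ultimately show "\<exists>h k. continuous_on {a..b} h \<and> k integrable_on {a..b} \<and>
     integral {a..b} k < e \<and> (\<forall>t\<in>{a..b}. norm (g t - h t) \<le> k t)"
    using f(2) h(1,2) by (intro exI[of _ h] exI[of _ "\<lambda>t. k t + k' t"]) (auto intro: integrable_add)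
qed

lemma L1_approximable_continuous: "continuous_on {a..b} h \<Longrightarrow> L1_approximable a b h"
  unfolding L1_approximable_def by (intro allI impI exI[of _ h] exI[of _ "\<lambda>_. 0"]) auto

lemma L1_approximable_add:
  assumes "L1_approximable a b f" "L1_approximable a b g"
  shows "L1_approximable a b (\<lambda>t. f t + g t)"
  unfolding L1_approximable_def
proof (intro allI impI)
  fix e :: real assume "e > 0"
  then have e: "e / 2 > 0" by simp
  obtain h k where h: "continuous_on {a..b} h" "k integrable_on {a..b}" "integral {a..b} k < e / 2"
    "\<And>t. t \<in> {a..b} \<Longrightarrow> norm (f t - h t) \<le> k t" using L1_approximableE[OF assms(1) e] by blast
  obtain h' k' where h': "continuous_on {a..b} h'" "k' integrable_on {a..b}"
    "integral {a..b} k' < e / 2" "\<And>t. t \<in> {a..b} \<Longrightarrow> norm (g t - h' t) \<le> k' t"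
    using L1_approximableE[OF assms(2) e] by blast
  have "norm (f t + g t - (h t + h' t)) \<le> k t + k' t" if "t \<in> {a..b}" for t
    using norm_triangle_ineq[of "f t - h t" "g t - h' t"] h(4)[OF that] h'(4)[OF that]
    by (simp add: algebra_simps)
  moreover have "integral {a..b} (\<lambda>t. k t + k' t) < e"
    using h h' by (simp add: integral_add)
  ultimately show "\<exists>h k. continuous_on {a..b} h \<and> k integrable_on {a..b} \<and>
     integral {a..b} k < e \<and> (\<forall>t\<in>{a..b}. norm (f t + g t - h t) \<le> k t)"
    using h(1,2) h'(1,2) by (intro exI[of _ "\<lambda>t. h t + h' t"] exI[of _ "\<lambda>t. k t + k' t"])
      (auto intro: integrable_add continuous_on_add)
qed

lemma L1_approximable_sum:
  assumes "finite A" "\<And>y. y \<in> A \<Longrightarrow> L1_approximable a b (f y)"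
  shows "L1_approximable a b (\<lambda>t. \<Sum>y\<in>A. f y t)"
  using assms
  by (induction rule: finite_induct) (auto intro: L1_approximable_continuous L1_approximable_add)

text \<open>
  Squeeze the set between a closed and an open set whose difference has small measure; a Urysohn
  function for this pair differs from the indicator function on the difference only.
\<close>

lemma L1_approximable_indicator:
  fixes y :: "'a::real_normed_vector"
  assumes A: "A \<in> sets lebesgue"
  shows "L1_approximable a b (\<lambda>t. indicator A t *\<^sub>R y)"
  unfolding L1_approximable_def
proof (intro allI impI)
  fix e :: real assume "e > 0"
  define d where "d = e / (2 * (1 + norm y))"
  have d: "d > 0" using \<open>e > 0\<close> unfolding d_def by (intro divide_pos_pos mult_pos_pos add_pos_nonneg) auto
  obtain U where U: "open U" "A \<subseteq> U" "U - A \<in> lmeasurable" "emeasure lebesgue (U - A) < ennreal d"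
    using sets_lebesgue_outer_open[OF A d] .
  obtain F where F: "closed F" "F \<subseteq> A" "A - F \<in> lmeasurable" "emeasure lebesgue (A - F) < ennreal d"
    using sets_lebesgue_inner_closed[OF A d] .
  have eq: "U - F = (U - A) \<union> (A - F)" using U F by blast
  have UF: "U - F \<in> lmeasurable" using U F unfolding eq by blast
  have "measure lebesgue (U - F) \<le> measure lebesgue (U - A) + measure lebesgue (A - F)"
    unfolding eq using U F by (intro measure_Un_le) auto
  moreover have "measure lebesgue (U - A) < d" "measure lebesgue (A - F) < d"
    using U(4) F(4) emeasure_eq_measure2[OF U(3)] emeasure_eq_measure2[OF F(3)]
    by (simp_all add: ennreal_less_iff)
  ultimately have m: "measure lebesgue (U - F) \<le> 2 * d" by simp
  obtain \<phi> :: "real \<Rightarrow> real" where \<phi>: "continuous_on UNIV \<phi>"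
    "\<And>x. \<phi> x \<in> closed_segment 0 1" "\<And>x. x \<in> - U \<Longrightarrow> \<phi> x = 0" "\<And>x. x \<in> F \<Longrightarrow> \<phi> x = 1"
    using Urysohn[of "- U" F "0 :: real" 1] U F by auto
  let ?k = "\<lambda>t. indicator (U - F) t * norm y"
  have UFi: "(U - F) \<inter> {a..b} \<in> lmeasurable" using UF by (intro fmeasurable.Int) auto
  have k: "?k integrable_on {a..b}"
    using UFi by (intro integrable_on_mult_left) (simp add: integrable_on_indicator)
  have "integral {a..b} ?k = measure lebesgue ((U - F) \<inter> {a..b}) * norm y"
    using integral_indicator[OF UFi] by (simp add: integral_mult_left)
  also have "\<dots> \<le> 2 * d * norm y"
    using m measure_mono_fmeasurable[of "(U - F) \<inter> {a..b}" "U - F" lebesgue] UF UFi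
    by (intro mult_right_mono) (auto simp: fmeasurableD)
  also have "\<dots> < e"
  proof -
    have nz: "2 * (1 + norm y) \<noteq> 0" by (simp add: add_nonneg_eq_0_iff)
    have "d * (2 * (1 + norm y)) = e"
      unfolding d_def times_divide_eq_left by (rule nonzero_mult_div_cancel_right[OF nz])
    then show ?thesis using d by (simp add: algebra_simps)
  qed
  finally have "integral {a..b} ?k < e" .
  moreover have "norm (indicator A t *\<^sub>R y - \<phi> t *\<^sub>R y) \<le> ?k t" for t
  proof -
    have "\<bar>indicator A t - \<phi> t\<bar> \<le> indicator (U - F) t"
      using \<phi>(2)[of t] \<phi>(3,4)[of t] U(2) F(2)
      by (auto simp: indicator_def closed_segment_eq_real_ivl)
    then show ?thesis
      unfolding scaleR_left_diff_distrib[symmetric] norm_scaleR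
      by (simp add: mult_right_mono)
  qed
  ultimately show "\<exists>h k. continuous_on {a..b} h \<and> k integrable_on {a..b} \<and>
     integral {a..b} k < e \<and> (\<forall>t\<in>{a..b}. norm (indicator A t *\<^sub>R y - h t) \<le> k t)"
    using k \<phi>(1) by (intro exI[of _ "\<lambda>t. \<phi> t *\<^sub>R y"] exI[of _ ?k])
      (auto intro!: continuous_intros intro: continuous_on_subset)
qed

lemma L1_approximable_simple:
  fixes s :: "real \<Rightarrow> 'a::real_normed_vector"
  assumes s: "simple_function lebesgue s"
  shows "L1_approximable a b s"
proof -
  have fin: "finite (range s)" using simple_functionD(1)[OF s] by simp
  have "s = (\<lambda>t. \<Sum>y\<in>range s. indicator (s -` {y}) t *\<^sub>R y)"
  proof
    fix t
    have "(\<Sum>y\<in>range s. indicator (s -` {y}) t *\<^sub>R y) = (\<Sum>y\<in>range s. if y = s t then y else 0)"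
      by (intro sum.cong) (auto simp: indicator_def)
    then show "s t = (\<Sum>y\<in>range s. indicator (s -` {y}) t *\<^sub>R y)"
      using fin by simp
  qed
  moreover have "L1_approximable a b (\<lambda>t. \<Sum>y\<in>range s. indicator (s -` {y}) t *\<^sub>R y)"
    using simple_functionD(2)[OF s]
    by (intro L1_approximable_sum[OF fin] L1_approximable_indicator) simp
  ultimately show ?thesis by simp
qed

text \<open>The bridge between Henstock--Kurzweil integrals and the Lebesgue integrals that define \<open>L\<^sup>p\<close>.\<close>

lemma integrable_on_interval_iff_nn_integral:
  fixes m :: "real \<Rightarrow> real"
  assumes m: "m \<in> borel_measurable lebesgue" "\<And>t. 0 \<le> m t"
  shows "(m has_integral I) {a..b} \<longleftrightarrow>
    0 \<le> I \<and> (\<integral>\<^sup>+ t. ennreal (indicator {a..b} t * m t) \<partial>lebesgue) = ennreal I"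
proof -
  have meas: "(\<lambda>t. indicator {a..b} t * m t) \<in> borel_measurable lebesgue"
    using m by (intro borel_measurable_times borel_measurable_indicator) auto
  have eq: "(\<lambda>t. if t \<in> {a..b} then m t else 0) = (\<lambda>t. indicator {a..b} t * m t)"
    by (auto simp: indicator_def)
  have "(m has_integral I) {a..b} \<longleftrightarrow> ((\<lambda>t. indicator {a..b} t * m t) has_integral I) UNIV"
    using has_integral_restrict_UNIV[of "{a..b}" m I] unfolding eq by simp
  also have "\<dots> \<longleftrightarrow> 0 \<le> I \<and> (\<integral>\<^sup>+ t. ennreal (indicator {a..b} t * m t) \<partial>lebesgue) = ennreal I"
    using meas m by (subst has_integral_iff_nn_integral_lebesgue) auto
  finally show ?thesis .
qed

lemma L1_approximable_strongly_measurable: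
  fixes g :: "real \<Rightarrow> 'a::complex_banach"
  assumes g: "strongly_measurable g" and int: "(\<lambda>t. norm (g t)) integrable_on {a..b}"
  shows "L1_approximable a b g"
proof -
  obtain s where s: "\<And>n::nat. simple_function lebesgue (s n)"
    "AE t in lebesgue. (\<lambda>n. s n t) \<longlonglongrightarrow> g t"
    using g by (auto simp: strongly_measurable_def)
  have ng: "(\<lambda>t. norm (g t)) \<in> borel_measurable lebesgue"
    by (rule borel_measurable_norm_strongly[OF g])
  \<comment> \<open>Cutting \<open>s n\<close> off where it exceeds \<open>2 * norm g\<close> yields a dominated sequence.\<close>
  define E where "E n = {t. norm (s n t) \<le> 2 * norm (g t)}" for n
  have ns: "(\<lambda>t. norm (s n t)) \<in> borel_measurable lebesgue" for n
    by (rule borel_measurable_simple_function[OF simple_function_compose1[OF s(1)]])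
  have E: "E n \<in> sets lebesgue" for n
    using borel_measurable_le[OF ns[of n] borel_measurable_times[OF borel_measurable_const[of 2] ng]]
    by (simp add: E_def)
  define s' where "s' n t = (if t \<in> E n then s n t else 0)" for n t
  have s': "simple_function lebesgue (s' n)" for n
  proof -
    have ind: "simple_function lebesgue (indicator (E n) :: real \<Rightarrow> real)"
      by (intro simple_function_indicator E)
    have "simple_function lebesgue (\<lambda>t. indicat_real (E n) t *\<^sub>R s n t)"
      by (rule simple_function_compose2[OF ind s(1)])
    moreover have "(\<lambda>t. indicat_real (E n) t *\<^sub>R s n t) = s' n"
      by (auto simp: s'_def)
    ultimately show ?thesis by simp
  qed
  have s'_le: "norm (s' n t) \<le> 2 * norm (g t)" for n t
    by (auto simp: s'_def E_def)
  have lim: "AE t in lebesgue. (\<lambda>n. s' n t) \<longlonglongrightarrow> g t"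
    using s(2)
  proof eventually_elim
    case (elim t)
    show ?case
    proof (cases "g t = 0")
      case True
      then have "s' n t = 0" for n using s'_le[of n t] by simp
      then show ?thesis using True by simp
    next
      case False
      then have "norm (g t) < 2 * norm (g t)" by simp
      then have "eventually (\<lambda>n. norm (s n t) < 2 * norm (g t)) sequentially"
        using order_tendstoD(2)[OF tendsto_norm[OF elim]] by blast
      then have "eventually (\<lambda>n. s n t = s' n t) sequentially"
        by eventually_elim (simp add: s'_def E_def)
      then show ?thesis using elim tendsto_cong by force
    qed
  qed
  let ?k = "\<lambda>n t. norm (g t - s' n t)"
  have km: "?k n \<in> borel_measurable lebesgue" for n
    using borel_measurable_norm_strongly[OF strongly_measurable_add[OF g
        strongly_measurable_simple[OF simple_function_compose1[OF s', of "uminus"]]]]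
    by simp
  obtain J where J: "((\<lambda>t. norm (g t)) has_integral J) {a..b}" using int by blast
  have "(\<lambda>n. \<integral>\<^sup>+ t. ennreal (indicator {a..b} t * ?k n t) \<partial>lebesgue) \<longlonglongrightarrow> (\<integral>\<^sup>+ (t :: real). 0 \<partial>lebesgue)"
  proof (rule nn_integral_dominated_convergence[where
        u = "\<lambda>n t. ennreal (indicator {a..b} t * ?k n t)" and u' = "\<lambda>t. 0" and
        w = "\<lambda>t. 3 * ennreal (indicator {a..b} t * norm (g t))"])
    show "(\<lambda>t. ennreal (indicator {a..b} t * ?k n t)) \<in> borel_measurable lebesgue" for n
      using km by (intro measurable_compose[OF _ measurable_ennreal] borel_measurable_times
          borel_measurable_indicator) auto
    have gm: "(\<lambda>t. ennreal (indicator {a..b} t * norm (g t))) \<in> borel_measurable lebesgue"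
      using ng by (intro measurable_compose[OF _ measurable_ennreal] borel_measurable_times
          borel_measurable_indicator) auto
    then show "(\<lambda>t. 3 * ennreal (indicator {a..b} t * norm (g t))) \<in> borel_measurable lebesgue"
      by (intro borel_measurable_times_ennreal) auto
    show "(\<integral>\<^sup>+ t. 3 * ennreal (indicator {a..b} t * norm (g t)) \<partial>lebesgue) < \<infinity>"
      using J gm unfolding integrable_on_interval_iff_nn_integral[OF ng norm_ge_zero]
      by (subst nn_integral_cmult) (auto simp: ennreal_mult_less_top)
    have "norm (g t - s' n t) \<le> 3 * norm (g t)" for n t
      using norm_triangle_ineq4[of "g t" "s' n t"] s'_le[of n t] by linarith
    then have *: "indicator {a..b} t * norm (g t - s' n t) \<le> 3 * (indicator {a..b} t * norm (g t))" for n t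
      by (auto simp: indicator_def)
    show "AE t in lebesgue. ennreal (indicator {a..b} t * ?k n t)
        \<le> 3 * ennreal (indicator {a..b} t * norm (g t))" for n
      using ennreal_leI[OF *] by (intro AE_I2) (simp add: ennreal_mult)
    show "AE t in lebesgue. (\<lambda>n. ennreal (indicator {a..b} t * ?k n t)) \<longlonglongrightarrow> 0"
      using lim
    proof eventually_elim
      case (elim t)
      have "(\<lambda>n. indicator {a..b} t * ?k n t) \<longlonglongrightarrow> indicator {a..b} t * norm (g t - g t)"
        by (intro tendsto_intros elim)
      then show ?case using tendsto_ennrealI by fastforce
    qed
  qed auto
  then have lim0: "(\<lambda>n. \<integral>\<^sup>+ t. ennreal (indicator {a..b} t * ?k n t) \<partial>lebesgue) \<longlonglongrightarrow> 0"
    by simp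
  show ?thesis
  proof (rule L1_approximable_limit)
    fix e :: real assume "e > 0"
    then have "0 < ennreal e" by simp
    from order_tendstoD(2)[OF lim0 this] obtain n where
      n: "(\<integral>\<^sup>+ t. ennreal (indicator {a..b} t * ?k n t) \<partial>lebesgue) < ennreal e"
      by (auto simp: eventually_sequentially)
    then obtain I where I: "I \<ge> 0" "(\<integral>\<^sup>+ t. ennreal (indicator {a..b} t * ?k n t) \<partial>lebesgue) = ennreal I"
      by (cases "\<integral>\<^sup>+ t. ennreal (indicator {a..b} t * ?k n t) \<partial>lebesgue" rule: ennreal_cases) auto
    then have "(?k n has_integral I) {a..b}"
      using integrable_on_interval_iff_nn_integral[OF km[of n]] by simp
    moreover have "I < e" using n I \<open>e > 0\<close> by (simp add: ennreal_less_iff)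
    ultimately show "\<exists>f k. L1_approximable a b f \<and> k integrable_on {a..b} \<and>
        integral {a..b} k < e \<and> (\<forall>t\<in>{a..b}. norm (g t - f t) \<le> k t)"
      using L1_approximable_simple[OF s'[of n]]
      by (intro exI[of _ "s' n"] exI[of _ "?k n"]) (auto simp: integral_unique)
  qed
qed

text \<open>
  The Riemann sums of \<open>g\<close> differ from those of \<open>h\<close> by at most the Riemann sums of \<open>k\<close>, so for
  a suitable gauge all of them are close to the integral of \<open>h\<close>, hence to each other.
\<close>

lemma L1_approximable_integrable:
  fixes g :: "real \<Rightarrow> 'a::banach"
  assumes g: "L1_approximable a b g"
  shows "g integrable_on {a..b}"
proof -
  let ?S = "\<lambda>f D. \<Sum>(x,K)\<in>D. measure lborel K *\<^sub>R f x"
  have "\<exists>\<gamma>. gauge \<gamma> \<and> (\<forall>D D'. D tagged_division_of {a..b} \<and> \<gamma> fine D \<and>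
      D' tagged_division_of {a..b} \<and> \<gamma> fine D' \<longrightarrow> norm (?S g D - ?S g D') < e)" if "e > 0" for e
  proof -
    have e: "e / 6 > 0" using that by simp
    obtain h k where h: "continuous_on {a..b} h" and k: "k integrable_on {a..b}" "integral {a..b} k < e / 6"
      "\<And>t. t \<in> {a..b} \<Longrightarrow> norm (g t - h t) \<le> k t"
      using L1_approximableE[OF g e] by blast
    obtain d1 where d1: "gauge d1" "\<And>D. D tagged_division_of {a..b} \<Longrightarrow> d1 fine D \<Longrightarrow>
        norm (?S h D - integral {a..b} h) < e / 6"
      using integrable_integral[OF integrable_continuous_real[OF h]] e unfolding has_integral_real by meson
    obtain d2 where d2: "gauge d2" "\<And>D. D tagged_division_of {a..b} \<Longrightarrow> d2 fine D \<Longrightarrow>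
        norm (?S k D - integral {a..b} k) < e / 6"
      using integrable_integral[OF k(1)] e unfolding has_integral_real by meson
    have close: "norm (?S g D - integral {a..b} h) < e / 2"
      if D: "D tagged_division_of {a..b}" "(\<lambda>x. d1 x \<inter> d2 x) fine D" for D
    proof -
      have f: "d1 fine D" "d2 fine D" using D(2) by (auto simp: fine_Int)
      have "norm (?S g D - ?S h D) = norm (\<Sum>(x,K)\<in>D. measure lborel K *\<^sub>R (g x - h x))"
        by (simp add: sum_subtractf[symmetric] case_prod_beta scaleR_diff_right)
      also have "\<dots> \<le> ?S k D"
      proof (rule sum_norm_le, clarify)
        fix x K assume "(x, K) \<in> D"
        then have "x \<in> {a..b}" using D(1) by (meson tagged_division_ofD(2,3) subsetD)
        then show "norm (measure lborel K *\<^sub>R (g x - h x)) \<le> measure lborel K *\<^sub>R k x"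
          using k(3) by (simp add: mult_left_mono)
      qed
      also have "\<dots> < e / 6 + e / 6"
        using d2(2)[OF D(1) f(2)] k(2) unfolding real_norm_def by linarith
      finally show ?thesis
        using d1(2)[OF D(1) f(1)] norm_triangle_ineq[of "?S g D - ?S h D" "?S h D - integral {a..b} h"]
        by simp
    qed
    have "norm (?S g D - ?S g D') < e"
      if "D tagged_division_of {a..b}" "(\<lambda>x. d1 x \<inter> d2 x) fine D"
        "D' tagged_division_of {a..b}" "(\<lambda>x. d1 x \<inter> d2 x) fine D'" for D D'
      using close[OF that(1,2)] close[OF that(3,4)]
        norm_triangle_ineq4[of "?S g D - integral {a..b} h" "?S g D' - integral {a..b} h"] by simp
    then show ?thesis
      using gauge_Int[OF d1(1) d2(1)] by (intro exI[of _ "\<lambda>x. d1 x \<inter> d2 x"]) simp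
  qed
  then show ?thesis unfolding integrable_Cauchy[of g a b, unfolded box_real] by simp
qed

lemmas integral_split = Henstock_Kurzweil_Integration.integral_combine

text \<open>
  On an interval on which \<open>h\<close> is nearly constant, the norm of its integral nearly equals the
  integral of its norm; a fine division adds up these local comparisons.
\<close>

lemma integral_norm_le_of_increments:
  fixes h :: "real \<Rightarrow> 'a::banach"
  assumes h: "continuous_on {a..b} h" and k: "k integrable_on {a..b}" and "a \<le> b"
    and le: "\<And>c d. a \<le> c \<Longrightarrow> c \<le> d \<Longrightarrow> d \<le> b \<Longrightarrow> norm (integral {c..d} h) \<le> integral {c..d} k"
  shows "integral {a..b} (\<lambda>t. norm (h t)) \<le> integral {a..b} k"
proof (rule field_le_epsilon)
  fix e' :: real assume "e' > 0"
  define e where "e = e' / (2 * (1 + (b - a)))"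
  have e: "e > 0" using \<open>e' > 0\<close> \<open>a \<le> b\<close> by (simp add: e_def)
  have nh: "continuous_on {a..b} (\<lambda>t. norm (h t))" using h by (intro continuous_intros)
  obtain \<delta> where \<delta>: "\<delta> > 0" "\<And>x y. x \<in> {a..b} \<Longrightarrow> y \<in> {a..b} \<Longrightarrow> dist y x < \<delta> \<Longrightarrow> dist (h y) (h x) < e"
    using compact_uniformly_continuous[OF h] e unfolding uniformly_continuous_on_def by auto
  obtain p where p: "p tagged_division_of {a..b}" "(\<lambda>x. ball x \<delta>) fine p"
    using fine_division_exists_real[OF gauge_ball[OF \<delta>(1)]] .
  define F where "F t = integral {a..t} (\<lambda>t. norm (h t)) - integral {a..t} k" for t
  have "F b - F a = (\<Sum>(x,K)\<in>p. F (Sup K) - F (Inf K))"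
    using additive_tagged_division_1[OF \<open>a \<le> b\<close> p(1), of F] by simp
  also have "\<dots> \<le> (\<Sum>(x,K)\<in>p. 2 * e * (Sup K - Inf K))"
  proof (rule sum_mono, clarify)
    fix x K assume xK: "(x, K) \<in> p"
    obtain c d where K: "K = {c..d}" using tagged_division_ofD(4)[OF p(1) xK] by (auto simp: box_real)
    have x: "x \<in> K" and sub: "K \<subseteq> {a..b}" using tagged_division_ofD(2,3)[OF p(1) xK] by auto
    then have cd: "a \<le> c" "c \<le> d" "d \<le> b" "x \<in> {a..b}" using K by auto
    have near: "norm (h t - h x) \<le> e" if "t \<in> {c..d}" for t
    proof -
      have "t \<in> ball x \<delta>" using fineD[OF p(2) xK] that K by blast
      then have "dist t x < \<delta>" by (simp add: dist_commute)
      moreover have "t \<in> {a..b}" using that cd by auto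
      ultimately show ?thesis
        using \<delta>(2)[OF cd(4), of t] by (simp add: dist_norm[of "h t"] less_imp_le)
    qed
    have int: "f integrable_on {c..d}" if "continuous_on {a..b} f" for f :: "real \<Rightarrow> 'c::banach"
      using integrable_subinterval_real[OF integrable_continuous_real[OF that]] cd by auto
    have diff: "integral {a..d} f - integral {a..c} f = integral {c..d} f"
      if "f integrable_on {a..b}" for f :: "real \<Rightarrow> real"
      using integral_split[of a c d f]
        integrable_subinterval_real[OF that, of a d] cd by auto
    have hx: "norm (integral {c..d} (\<lambda>t. h x)) = (d - c) * norm (h x)" using cd by simp
    have "norm (integral {c..d} (\<lambda>t. h t - h x)) \<le> integral {c..d} (\<lambda>t. e)"
      by (rule integral_norm_bound_integral) (auto intro!: near int continuous_on_diff h)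
    then have 1: "norm (integral {c..d} h - integral {c..d} (\<lambda>t. h x)) \<le> e * (d - c)"
      using cd by (subst integral_diff[symmetric]) (auto intro: int h simp: mult.commute)
    have "(d - c) * norm (h x) \<le> integral {c..d} k + e * (d - c)"
      using 1 hx le[of c d] cd norm_triangle_ineq2[of "integral {c..d} (\<lambda>t. h x)" "integral {c..d} h"]
      by (simp add: norm_minus_commute)
    moreover have "integral {c..d} (\<lambda>t. norm (h t)) \<le> integral {c..d} (\<lambda>t. norm (h x) + e)"
    proof (rule integral_le)
      show "norm (h t) \<le> norm (h x) + e" if "t \<in> {c..d}" for t
        using near[OF that] norm_triangle_ineq2[of "h t" "h x"] by linarith
    qed (auto intro: int nh)
    moreover have "integral {c..d} (\<lambda>t. norm (h x) + e) = (d - c) * norm (h x) + e * (d - c)"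
      using cd by (simp add: algebra_simps)
    moreover have "F d - F c = integral {c..d} (\<lambda>t. norm (h t)) - integral {c..d} k"
      using diff[OF k] diff[OF integrable_continuous_real[OF nh]] by (simp add: F_def)
    ultimately show "F (Sup K) - F (Inf K) \<le> 2 * e * (Sup K - Inf K)"
      using cd K by simp
  qed
  also have "\<dots> = 2 * e * (b - a)"
    using additive_tagged_division_1[OF \<open>a \<le> b\<close> p(1), of "\<lambda>x. 2 * e * x"]
    by (simp add: right_diff_distrib case_prod_beta)
  also have "\<dots> \<le> e'" using \<open>e' > 0\<close> \<open>a \<le> b\<close> by (simp add: e_def field_simps)
  finally show "integral {a..b} (\<lambda>t. norm (h t)) \<le> integral {a..b} k + e'"
    by (simp add: F_def)
qed

text \<open>
  A continuous function close to \<open>g\<close> in mean has small integrals over all subintervals, hence,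
  being continuous, a small \<open>L\<^sup>1\<close> norm.  So \<open>g\<close> itself has \<open>L\<^sup>1\<close> norm zero.
\<close>

lemma AE_zero_of_indefinite_integral_zero:
  fixes g :: "real \<Rightarrow> 'a::complex_banach"
  assumes g: "strongly_measurable g" "(\<lambda>t. norm (g t)) integrable_on {a..b}" and "a \<le> b"
    and zero: "\<And>t. t \<in> {a..b} \<Longrightarrow> (g has_integral 0) {a..t}"
  shows "AE t in lebesgue. t \<in> {a..b} \<longrightarrow> g t = 0"
proof -
  have gi: "g integrable_on {a..b}" using zero[of b] \<open>a \<le> b\<close> by auto
  have int0: "integral {c..d} g = 0" if "a \<le> c" "c \<le> d" "d \<le> b" for c d
    using integral_split[of a c d g]
      integrable_subinterval_real[OF gi, of a d] integral_unique[OF zero, of c]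
      integral_unique[OF zero, of d] that by auto
  have "integral {a..b} (\<lambda>t. norm (g t)) \<le> 0"
  proof (rule field_le_epsilon)
    fix e :: real assume "e > 0"
    then have "e / 2 > 0" by simp
    from L1_approximableE[OF L1_approximable_strongly_measurable[OF g] this]
    obtain h k where h: "continuous_on {a..b} h" and k: "k integrable_on {a..b}"
      "integral {a..b} k < e / 2" "\<And>t. t \<in> {a..b} \<Longrightarrow> norm (g t - h t) \<le> k t" by blast
    have "integral {a..b} (\<lambda>t. norm (h t)) \<le> integral {a..b} k"
    proof (rule integral_norm_le_of_increments[OF h k(1) \<open>a \<le> b\<close>])
      fix c d assume cd: "a \<le> c" "c \<le> d" "d \<le> b"
      then have sub: "{c..d} \<subseteq> {a..b}" by auto
      note i = integrable_subinterval_real[OF _ sub]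
      have "norm (integral {c..d} (\<lambda>t. h t - g t)) \<le> integral {c..d} k"
      proof (rule integral_norm_bound_integral)
        show "norm (h t - g t) \<le> k t" if "t \<in> {c..d}" for t
          using k(3)[of t] that sub by (auto simp: norm_minus_commute)
      qed (intro integrable_diff i gi integrable_continuous_real[OF h] k)+
      then show "norm (integral {c..d} h) \<le> integral {c..d} k"
        using int0[OF cd] i[OF gi] i[OF integrable_continuous_real[OF h]]
        by (simp add: integral_diff)
    qed
    moreover have "integral {a..b} (\<lambda>t. norm (g t)) \<le> integral {a..b} (\<lambda>t. norm (h t) + k t)"
    proof (rule integral_le)
      show "norm (g t) \<le> norm (h t) + k t" if "t \<in> {a..b}" for t
        using k(3)[OF that] norm_triangle_ineq2[of "g t" "h t"] by linarith
    qed (intro g integrable_add k integrable_continuous_real continuous_intros h)+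
    moreover have "\<dots> = integral {a..b} (\<lambda>t. norm (h t)) + integral {a..b} k"
      by (intro integral_add k integrable_continuous_real continuous_intros h)
    ultimately show "integral {a..b} (\<lambda>t. norm (g t)) \<le> 0 + e" using k(2) by simp
  qed
  moreover have "0 \<le> integral {a..b} (\<lambda>t. norm (g t))" by (intro integral_nonneg g) auto
  ultimately have "((\<lambda>t. norm (g t)) has_integral 0) {a..b}"
    using g(2) by (simp add: has_integral_integrable_integral)
  then have "(\<integral>\<^sup>+ t. ennreal (indicator {a..b} t * norm (g t)) \<partial>lebesgue) = 0"
    using integrable_on_interval_iff_nn_integral[OF borel_measurable_norm_strongly[OF g(1)] norm_ge_zero]
    by simp
  moreover have "(\<lambda>t. ennreal (indicator {a..b} t * norm (g t))) \<in> borel_measurable lebesgue"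
    using borel_measurable_norm_strongly[OF g(1)]
    by (intro measurable_compose[OF _ measurable_ennreal] borel_measurable_times
        borel_measurable_indicator) auto
  ultimately have "AE t in lebesgue. ennreal (indicator {a..b} t * norm (g t)) = 0"
    by (simp add: nn_integral_0_iff_AE)
  then show ?thesis
    by eventually_elim (auto simp: indicator_def)
qed

lemma has_integral_cong_AE_lebesgue:
  fixes f :: "real \<Rightarrow> 'a::real_normed_vector"
  assumes "AE t in lebesgue. t \<in> S \<longrightarrow> f t = g t"
  shows "(f has_integral I) S \<longleftrightarrow> (g has_integral I) S"
proof -
  obtain N where "N \<in> null_sets lebesgue" "\<And>t. t \<in> space lebesgue - N \<Longrightarrow> t \<in> S \<longrightarrow> f t = g t"
    using AE_E3[OF assms] by blast
  then show ?thesis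
    by (intro has_integral_spike_eq[of N]) (auto simp: negligible_iff_null_sets)
qed

section \<open>Lebesgue spaces\<close>

lemma Lp_measurable: "u \<in> Lp p S \<Longrightarrow> strongly_measurable (rep_ae u)"
  by (simp add: Lp_def)

lemma Lp_restrict: "u \<in> Lp p S \<Longrightarrow> ae_restrict S u = u"
  by (simp add: Lp_def)

lemma Lp_norm_nonneg [simp]: "0 \<le> Lp_norm p u"
  by (simp add: Lp_norm_def)

lemma Lp_has_integral:
  assumes u: "u \<in> Lp p S" and p: "p > 0"
  shows "((\<lambda>t. norm (rep_ae u t) powr p) has_integral (Lp_norm p u powr p)) UNIV"
proof -
  have "(\<lambda>t. norm (rep_ae u t) powr p) \<in> borel_measurable lebesgue"
    by (intro powr_real_measurable borel_measurable_norm_strongly Lp_measurable[OF u]) auto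
  moreover have "Lp_norm p u powr p = enn2real (Lp_integral p u)"
    using p by (simp add: Lp_norm_def powr_powr)
  moreover have "Lp_integral p u < \<infinity>" using u by (simp add: Lp_def)
  ultimately show ?thesis
    by (subst has_integral_iff_nn_integral_lebesgue) (auto simp: Lp_integral_def less_top)
qed

lemma Lp_class_bound:
  fixes f :: "real \<Rightarrow> 'a::complex_banach"
  assumes p: "p > 0" and f: "strongly_measurable f" and supp: "ae_restrict S (ae_class f) = ae_class f"
    and le: "AE t in lebesgue. norm (f t) powr p \<le> m t"
    and m: "(m has_integral J) UNIV" "\<And>t. 0 \<le> m t"
  shows "ae_class f \<in> Lp p S" "Lp_norm p (ae_class f) \<le> J powr (1 / p)"
proof -
  have J: "(\<integral>\<^sup>+ t. ennreal (m t) \<partial>lebesgue) = ennreal J" "J \<ge> 0"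
    using m by (auto simp: has_integral_iff_nn_integral_lebesgue)
  have "AE t in lebesgue. norm (rep_ae (ae_class f) t) powr p \<le> m t"
    using le rep_ae_class[of f] by eventually_elim simp
  then have "Lp_integral p (ae_class f) \<le> ennreal J"
    unfolding Lp_integral_def J(1)[symmetric]
    by (intro nn_integral_mono_AE) (auto elim!: eventually_mono intro!: ennreal_leI)
  moreover have "strongly_measurable (rep_ae (ae_class f))"
    by (rule strongly_measurable_cong_AE[OF f]) (use rep_ae_class[of f] in \<open>auto elim!: eventually_mono\<close>)
  ultimately show "ae_class f \<in> Lp p S" using supp by (auto simp: Lp_def intro: le_less_trans)
  have "enn2real (Lp_integral p (ae_class f)) \<le> J"
    using \<open>Lp_integral p (ae_class f) \<le> ennreal J\<close> J(2) by (intro enn2real_leI)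
  then show "Lp_norm p (ae_class f) \<le> J powr (1 / p)"
    unfolding Lp_norm_def using p by (intro powr_mono2) auto
qed

lemma ae_restrict_class_eq:
  "(\<And>t. t \<notin> S \<Longrightarrow> f t = 0) \<Longrightarrow> ae_restrict S (ae_class f) = ae_class f"
  unfolding ae_restrict_class by (rule arg_cong[where f = ae_class]) auto

lemma ae_restrict_add: "ae_restrict S (u + v) = ae_restrict S u + ae_restrict S v"
  by transfer (auto elim!: eventually_mono)

lemma ae_restrict_scaleC: "ae_restrict S (c *\<^sub>C u) = c *\<^sub>C ae_restrict S u"
  by transfer auto

lemma powr_add_le: 
  fixes x y p :: real
  assumes "x \<ge> 0" "y \<ge> 0" "p \<ge> 1"
  shows "x powr p + y powr p \<le> (x + y) powr p"
proof -
  have split: "z powr p = z * z powr (p - 1)" if "z \<ge> 0" for z :: real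
    using that powr_mult_base[of z "p - 1"] by simp
  have "x * x powr (p - 1) \<le> x * (x + y) powr (p - 1)"
    "y * y powr (p - 1) \<le> y * (x + y) powr (p - 1)"
    using assms by (auto intro!: mult_left_mono powr_mono2)
  then show ?thesis
    using assms by (simp add: split distrib_right)
qed

text \<open>
  The constant \<open>2\<close> comes from the crude pointwise bound \<open>(x + y)\<^sup>p \<le> 2\<^sup>p (x\<^sup>p + y\<^sup>p)\<close>; boundedness
  of operators is insensitive to it.
\<close>

lemma Lp_add:
  assumes p: "p \<ge> 1" and u: "u \<in> Lp p S" and v: "v \<in> Lp p S"
  shows "u + v \<in> Lp p S" "Lp_norm p (u + v) \<le> 2 * (Lp_norm p u + Lp_norm p v)"
proof -
  let ?f = "\<lambda>t. rep_ae u t + rep_ae v t"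
  let ?m = "\<lambda>t. 2 powr p * (norm (rep_ae u t) powr p + norm (rep_ae v t) powr p)"
  let ?J = "2 powr p * (Lp_norm p u powr p + Lp_norm p v powr p)"
  have uv: "ae_class ?f = u + v" by (simp flip: ae_class_add)
  have "norm (?f t) powr p \<le> ?m t" for t
  proof -
    let ?x = "norm (rep_ae u t)" and ?y = "norm (rep_ae v t)"
    have "norm (?f t) \<le> 2 * max ?x ?y" using norm_triangle_ineq[of "rep_ae u t" "rep_ae v t"] by linarith
    then have "norm (?f t) powr p \<le> (2 * max ?x ?y) powr p" using p by (intro powr_mono2) auto
    also have "\<dots> = 2 powr p * max ?x ?y powr p" by (simp add: powr_mult)
    also have "max ?x ?y powr p \<le> ?x powr p + ?y powr p" by (simp add: max_def)
    finally show ?thesis by (simp add: mult_left_mono)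
  qed
  moreover have "(?m has_integral ?J) UNIV"
    using p by (intro has_integral_mult_right has_integral_add Lp_has_integral[OF u] Lp_has_integral[OF v]) auto
  moreover have "ae_restrict S (ae_class ?f) = ae_class ?f"
    unfolding uv by (simp add: ae_restrict_add Lp_restrict[OF u] Lp_restrict[OF v])
  moreover have "strongly_measurable ?f"
    by (intro strongly_measurable_add Lp_measurable[OF u] Lp_measurable[OF v])
  ultimately have *: "ae_class ?f \<in> Lp p S" "Lp_norm p (ae_class ?f) \<le> ?J powr (1 / p)"
    using p by (intro Lp_class_bound[where m = ?m]; simp)+
  show "u + v \<in> Lp p S" using * uv by simp
  have "?J powr (1 / p) \<le> (2 powr p * (Lp_norm p u + Lp_norm p v) powr p) powr (1 / p)"
    using p by (intro powr_mono2 mult_left_mono powr_add_le) auto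
  also have "\<dots> = 2 * (Lp_norm p u + Lp_norm p v)"
    using p by (simp add: powr_mult powr_powr)
  finally show "Lp_norm p (u + v) \<le> 2 * (Lp_norm p u + Lp_norm p v)" using * uv by simp
qed

lemma Lp_scaleC:
  assumes p: "p \<ge> 1" and u: "u \<in> Lp p S"
  shows "c *\<^sub>C u \<in> Lp p S" "Lp_norm p (c *\<^sub>C u) \<le> cmod c * Lp_norm p u"
proof -
  let ?f = "\<lambda>t. c *\<^sub>C rep_ae u t" and ?m = "\<lambda>t. cmod c powr p * norm (rep_ae u t) powr p"
  have cu: "ae_class ?f = c *\<^sub>C u" by (simp flip: ae_class_scaleC)
  have "(?m has_integral (cmod c powr p * Lp_norm p u powr p)) UNIV"
    using p by (intro has_integral_mult_right Lp_has_integral[OF u]) auto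
  moreover have "ae_restrict S (ae_class ?f) = ae_class ?f"
    unfolding cu by (simp add: ae_restrict_scaleC Lp_restrict[OF u])
  moreover have "strongly_measurable ?f"
    by (intro strongly_measurable_scaleC Lp_measurable[OF u] strongly_measurable_simple) simp
  ultimately have *: "ae_class ?f \<in> Lp p S"
    "Lp_norm p (ae_class ?f) \<le> (cmod c powr p * Lp_norm p u powr p) powr (1 / p)"
    using p by (intro Lp_class_bound[where m = ?m]; simp add: norm_scaleC powr_mult)+
  show "c *\<^sub>C u \<in> Lp p S" using * cu by simp
  show "Lp_norm p (c *\<^sub>C u) \<le> cmod c * Lp_norm p u" using * cu p by (simp add: powr_mult powr_powr)
qed

lemma Lp_continuous:
  fixes f :: "real \<Rightarrow> 'a::complex_banach"
  assumes p: "p \<ge> 1" and "a \<le> b" and f: "continuous_on {a..b} f" "\<And>t. t \<notin> {a..b} \<Longrightarrow> f t = 0"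
    and C: "\<And>t. t \<in> {a..b} \<Longrightarrow> norm (f t) \<le> C"
  shows "ae_class f \<in> Lp p {a..b}" "Lp_norm p (ae_class f) \<le> (1 + (b - a)) * C"
proof -
  have "C \<ge> 0" using C[of a] \<open>a \<le> b\<close> norm_ge_zero[of "f a"] by (auto simp del: norm_ge_zero)
  let ?m = "\<lambda>t. if t \<in> {a..b} then C powr p else 0"
  have "(?m has_integral ((b - a) * C powr p)) UNIV"
    unfolding has_integral_restrict_UNIV using has_integral_const_real[of "C powr p" a b] \<open>a \<le> b\<close>
    by simp
  moreover have "ae_restrict {a..b} (ae_class f) = ae_class f"
    by (rule ae_restrict_class_eq) (rule f)
  moreover have "(\<lambda>t. if t \<in> {a..b} then f t else 0) = f" using f(2) by auto
  then have "strongly_measurable f" using strongly_measurable_continuous_on[OF f(1)] by simp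
  moreover have "norm (f t) powr p \<le> ?m t" for t
    using C[of t] p f(2)[of t] by (auto intro!: powr_mono2)
  ultimately have *: "ae_class f \<in> Lp p {a..b}"
    "Lp_norm p (ae_class f) \<le> ((b - a) * C powr p) powr (1 / p)"
    using p by (intro Lp_class_bound[where m = ?m]; simp)+
  show "ae_class f \<in> Lp p {a..b}" by fact
  have "(b - a) powr (1 / p) \<le> (1 + (b - a)) powr (1 / p)"
    using p \<open>a \<le> b\<close> by (intro powr_mono2) auto
  also have "\<dots> \<le> (1 + (b - a)) powr 1"
    using p \<open>a \<le> b\<close> by (intro powr_mono) auto
  finally have "(b - a) powr (1 / p) \<le> 1 + (b - a)" using \<open>a \<le> b\<close> by simp
  then have "(b - a) powr (1 / p) * C \<le> (1 + (b - a)) * C"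
    using \<open>C \<ge> 0\<close> by (rule mult_right_mono)
  then show "Lp_norm p (ae_class f) \<le> (1 + (b - a)) * C"
    using * p \<open>a \<le> b\<close> \<open>C \<ge> 0\<close> by (simp add: powr_mult powr_powr)
qed

text \<open>
  A form of Hoelder's inequality: for every \<open>s > 0\<close> a real \<open>x \<ge> 0\<close> is at most
  \<open>s + s powr (1 - p) * x powr p\<close>; integrate and take \<open>s\<close> to be the \<open>L\<^sup>p\<close> norm.
\<close>

lemma Lp_imp_L1:
  assumes p: "p \<ge> 1" and "a \<le> b" and u: "u \<in> Lp p {a..b}"
  shows "(\<lambda>t. norm (rep_ae u t)) integrable_on {a..b}"
    and "integral {a..b} (\<lambda>t. norm (rep_ae u t)) \<le> (1 + (b - a)) * Lp_norm p u"
proof -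
  let ?n = "\<lambda>t. norm (rep_ae u t)" and ?N = "Lp_norm p u"
  have np: "(\<lambda>t. ?n t powr p) integrable_on UNIV" "integral UNIV (\<lambda>t. ?n t powr p) = ?N powr p"
    using Lp_has_integral[OF u] p by (auto simp: integral_unique)
  then have np_ab: "(\<lambda>t. ?n t powr p) integrable_on {a..b}"
    using integrable_on_subinterval[of _ UNIV a b] by auto
  have np_le: "integral {a..b} (\<lambda>t. ?n t powr p) \<le> ?N powr p"
    using np np_ab by (subst np(2)[symmetric], intro integral_subset_le) auto
  have young: "x \<le> s + s powr (1 - p) * x powr p" if "x \<ge> 0" "s > 0" for x s :: real
  proof (cases "x \<le> s")
    case True
    then show ?thesis by (simp add: add_increasing2)
  next
    case False
    then have "x powr (1 - p) \<le> s powr (1 - p)" using that p by (intro powr_mono2') auto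
    then have "x powr (1 - p) * x powr p \<le> s powr (1 - p) * x powr p" by (intro mult_right_mono) auto
    moreover have "x powr (1 - p) * x powr p = x" using False that by (simp flip: powr_add)
    ultimately show ?thesis using that by simp
  qed
  have int: "(\<lambda>t. s + s powr (1 - p) * ?n t powr p) integrable_on {a..b}" for s
    using np_ab by (intro integrable_add integrable_on_mult_right) auto
  show ni: "?n integrable_on {a..b}"
    using measurable_bounded_lemma[OF borel_measurable_norm_strongly[OF Lp_measurable[OF u]], of _ a b]
      int[of 1] young[of _ 1] by (auto simp: box_real)
  have bound: "integral {a..b} ?n \<le> s * (b - a) + s powr (1 - p) * ?N powr p" if "s > 0" for s
  proof -
    have "integral {a..b} ?n \<le> integral {a..b} (\<lambda>t. s + s powr (1 - p) * ?n t powr p)"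
      by (rule integral_le[OF ni int]) (use young that in auto)
    also have "\<dots> = s * (b - a) + s powr (1 - p) * integral {a..b} (\<lambda>t. ?n t powr p)"
      using np_ab \<open>a \<le> b\<close> by (subst integral_add) (auto intro: integrable_on_mult_right simp: mult.commute)
    also have "\<dots> \<le> s * (b - a) + s powr (1 - p) * ?N powr p"
      using np_le by (simp add: mult_left_mono)
    finally show ?thesis .
  qed
  show "integral {a..b} ?n \<le> (1 + (b - a)) * ?N"
  proof (cases "?N = 0")
    case False
    then have "?N > 0" using Lp_norm_nonneg[of p u] by linarith
    moreover have "?N powr (1 - p) * ?N powr p = ?N" using \<open>?N > 0\<close> by (simp flip: powr_add)
    ultimately show ?thesis using bound[of ?N] by (simp add: algebra_simps)
  next
    case True
    have "integral {a..b} ?n \<le> 0"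
    proof (rule field_le_epsilon)
      fix e :: real assume "e > 0"
      define s where "s = e / (1 + (b - a))"
      have s: "s > 0" "s * (b - a) \<le> e" using \<open>e > 0\<close> \<open>a \<le> b\<close> by (auto simp: s_def field_simps)
      then show "integral {a..b} ?n \<le> 0 + e" using bound[OF s(1)] True by simp
    qed
    then show ?thesis using True by simp
  qed
qed

section \<open>Sobolev spaces on a compact interval\<close>

lemma continuous_on_AE_zero:
  fixes d :: "real \<Rightarrow> 'a::real_normed_vector"
  assumes "a < b" and d: "continuous_on {a..b} d"
    and zero: "AE t in lebesgue. t \<in> {a..b} \<longrightarrow> d t = 0" and t: "t \<in> {a..b}"
  shows "d t = 0"
proof -
  have "((\<lambda>t. norm (d t)) has_integral 0) {a..b}"
    using zero has_integral_cong_AE_lebesgue[of "{a..b}" "\<lambda>t. norm (d t)" "\<lambda>t. 0" 0]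
    by (auto elim: eventually_mono)
  moreover have "continuous_on {a..b} (\<lambda>t. norm (d t))" using d by (intro continuous_intros)
  ultimately have "norm (d t) = 0"
    using has_integral_0_cbox_imp_0[of a b "\<lambda>t. norm (d t)" t] \<open>a < b\<close> t by (simp add: box_real)
  then show ?thesis by simp
qed

locale sobolev_interval =
  fixes p a b :: real
  assumes p: "1 \<le> p" and ab: "a < b"
begin

abbreviation W1 :: "'a::complex_banach aefun set" where "W1 \<equiv> W1p p a b"
abbreviation W1_norm :: "'a::complex_banach aefun \<Rightarrow> real" where "W1_norm \<equiv> W1p_norm p a b"
abbreviation crep :: "'a::complex_banach aefun \<Rightarrow> real \<Rightarrow> 'a" where "crep \<equiv> cont_rep p a b"
abbreviation wderiv :: "'a::complex_banach aefun \<Rightarrow> 'a aefun" where "wderiv \<equiv> weak_deriv p a b"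
abbreviation "triple \<equiv> sobolev_triple p a b"

lemma tripleD:
  assumes "triple u f g"
  shows "u = ae_class f" "\<And>t. t \<notin> {a..b} \<Longrightarrow> f t = 0" "g \<in> Lp p {a..b}"
    "\<And>t. t \<in> {a..b} \<Longrightarrow> (rep_ae g has_integral (f t - f a)) {a..t}"
  using assms by (auto simp: sobolev_triple_def)

lemma triple_increment:
  assumes "triple u f g" "a \<le> s" "s \<le> t" "t \<le> b"
  shows "(rep_ae g has_integral (f t - f s)) {s..t}"
proof -
  have t: "(rep_ae g has_integral (f t - f a)) {a..t}" and s: "(rep_ae g has_integral (f s - f a)) {a..s}"
    using tripleD(4)[OF assms(1)] assms by auto
  have i: "rep_ae g integrable_on {s..t}"
    using integrable_subinterval_real[OF has_integral_integrable[OF t], of s t] assms by auto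
  have "(f s - f a) + integral {s..t} (rep_ae g) = f t - f a"
    using integral_split[OF assms(2,3) has_integral_integrable[OF t]]
      integral_unique[OF t] integral_unique[OF s] by simp
  then have "integral {s..t} (rep_ae g) = (f t - f a) - (f s - f a)"
    by (metis add_diff_cancel_left')
  then show ?thesis using i by (simp add: has_integral_integrable_integral)
qed

lemma triple_continuous:
  assumes "triple u f g"
  shows "continuous_on {a..b} f"
proof -
  have "rep_ae g integrable_on {a..b}" using tripleD(4)[OF assms, of b] ab by auto
  then have "continuous_on {a..b} (\<lambda>t. f a + integral {a..t} (rep_ae g))"
    by (intro continuous_intros indefinite_integral_continuous_1)
  moreover have "f a + integral {a..t} (rep_ae g) = f t" if "t \<in> {a..b}" for t
    using integral_unique[OF tripleD(4)[OF assms that]] by simp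
  ultimately show ?thesis by (rule continuous_on_eq)
qed

lemma Lp_AE_zeroI:
  assumes w: "w \<in> Lp p {a..b}" and zero: "\<And>t. t \<in> {a..b} \<Longrightarrow> (rep_ae w has_integral 0) {a..t}"
  shows "w = 0"
proof -
  have "AE t in lebesgue. t \<in> {a..b} \<longrightarrow> rep_ae w t = 0"
    using Lp_imp_L1(1)[OF p _ w] ab
    by (intro AE_zero_of_indefinite_integral_zero Lp_measurable[OF w] zero) auto
  then have "ae_class (\<lambda>t. if t \<in> {a..b} then rep_ae w t else 0) = ae_class (\<lambda>_. 0)"
    unfolding ae_class_eq_iff by eventually_elim auto
  then show "w = 0"
    using Lp_restrict[OF w] ae_restrict_class[of "{a..b}" "rep_ae w"] by (simp add: ae_class_zero)
qed

lemma triple_add: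
  assumes "triple u f g" "triple u' f' g'"
  shows "triple (u + u') (\<lambda>t. f t + f' t) (g + g')"
  unfolding sobolev_triple_def
proof (intro conjI ballI allI impI)
  show "u + u' = ae_class (\<lambda>t. f t + f' t)"
    using tripleD(1)[OF assms(1)] tripleD(1)[OF assms(2)] by (simp add: ae_class_add)
  show "g + g' \<in> Lp p {a..b}"
    by (intro Lp_add p tripleD(3)[OF assms(1)] tripleD(3)[OF assms(2)])
  fix t assume "t \<in> {a..b}"
  then have "((\<lambda>s. rep_ae g s + rep_ae g' s) has_integral ((f t - f a) + (f' t - f' a))) {a..t}"
    by (intro has_integral_add tripleD(4)[OF assms(1)] tripleD(4)[OF assms(2)])
  moreover have "AE s in lebesgue. s \<in> {a..t} \<longrightarrow> rep_ae (g + g') s = rep_ae g s + rep_ae g' s"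
    using rep_ae_add[of g g'] by eventually_elim simp
  ultimately show "(rep_ae (g + g') has_integral (f t + f' t - (f a + f' a))) {a..t}"
    using has_integral_cong_AE_lebesgue[of "{a..t}" "rep_ae (g + g')" "\<lambda>s. rep_ae g s + rep_ae g' s"]
    by (simp add: algebra_simps)
qed (use tripleD(2)[OF assms(1)] tripleD(2)[OF assms(2)] in auto)

lemma triple_scaleC:
  assumes "triple u f g"
  shows "triple (c *\<^sub>C u) (\<lambda>t. c *\<^sub>C f t) (c *\<^sub>C g)"
  unfolding sobolev_triple_def
proof (intro conjI ballI allI impI)
  show "c *\<^sub>C u = ae_class (\<lambda>t. c *\<^sub>C f t)"
    using tripleD(1)[OF assms] by (simp add: ae_class_scaleC)
  show "c *\<^sub>C g \<in> Lp p {a..b}" by (intro Lp_scaleC p tripleD(3)[OF assms])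
  fix t assume "t \<in> {a..b}"
  then have "((\<lambda>s. c *\<^sub>C rep_ae g s) has_integral (c *\<^sub>C (f t - f a))) {a..t}"
    using has_integral_linear[OF tripleD(4)[OF assms] bounded_linear_scaleC] by (simp add: comp_def)
  moreover have "AE s in lebesgue. s \<in> {a..t} \<longrightarrow> rep_ae (c *\<^sub>C g) s = c *\<^sub>C rep_ae g s"
    using rep_ae_scaleC[of c g] by eventually_elim simp
  ultimately show "(rep_ae (c *\<^sub>C g) has_integral (c *\<^sub>C f t - c *\<^sub>C f a)) {a..t}"
    using has_integral_cong_AE_lebesgue[of "{a..t}" "rep_ae (c *\<^sub>C g)" "\<lambda>s. c *\<^sub>C rep_ae g s"]
    by (simp add: scaleC_diff_right)
qed (use tripleD(2)[OF assms] in auto)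

lemma triple_zero:
  assumes "triple 0 f g"
  shows "f = (\<lambda>_. 0)" "g = 0"
proof -
  have "AE t in lebesgue. t \<in> {a..b} \<longrightarrow> f t = 0"
    using tripleD(1)[OF assms] by (simp add: ae_class_zero ae_class_eq_iff) (auto elim: eventually_mono)
  from continuous_on_AE_zero[OF ab triple_continuous[OF assms] this] tripleD(2)[OF assms]
  have *: "f t = 0" for t by blast
  then show "f = (\<lambda>_. 0)" by auto
  show "g = 0"
    using tripleD(4)[OF assms] by (intro Lp_AE_zeroI tripleD(3)[OF assms]) (simp add: *)
qed

text \<open>
  Continuous functions that agree almost everywhere are equal, and a derivative is determined almost
  everywhere by its indefinite integral.  So \<open>cont_rep\<close> and \<open>weak_deriv\<close> are well defined, and they
  inherit linearity from \<open>sobolev_triple\<close>.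
\<close>

lemma triple_unique:
  assumes "triple u f g" "triple u f' g'"
  shows "f = f'" "g = g'"
proof -
  have "triple (u + (- 1) *\<^sub>C u) (\<lambda>t. f t + (- 1) *\<^sub>C f' t) (g + (- 1) *\<^sub>C g')"
    by (intro triple_add triple_scaleC assms)
  then have "triple 0 (\<lambda>t. f t + (- 1) *\<^sub>C f' t) (g + (- 1) *\<^sub>C g')"
    by (simp add: scaleC_minus_one)
  from triple_zero[OF this] show "f = f'" "g = g'"
    by (auto simp: scaleC_minus_one fun_eq_iff)
qed

lemma cont_rep_eq: "triple u f g \<Longrightarrow> crep u = f"
  unfolding cont_rep_def by (rule the_equality) (use triple_unique in blast)+

lemma weak_deriv_eq: "triple u f g \<Longrightarrow> wderiv u = g"
  unfolding weak_deriv_def by (rule the_equality) (use triple_unique in blast)+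

lemma W1p_triple: "u \<in> W1 \<Longrightarrow> triple u (crep u) (wderiv u)"
  unfolding W1p_def using cont_rep_eq weak_deriv_eq by fastforce

lemma triple_W1p: "triple u f g \<Longrightarrow> u \<in> W1"
  unfolding W1p_def by blast

lemma csubspace_W1p: "csubspace (W1 :: 'a::complex_banach aefun set)"
  and W1p_cont_rep_add: "u \<in> W1 \<Longrightarrow> v \<in> W1 \<Longrightarrow>
    crep (u + v) = (\<lambda>t. crep u t + crep v t)"
  and W1p_cont_rep_scaleC: "u \<in> W1 \<Longrightarrow>
    crep (c *\<^sub>C u) = (\<lambda>t. c *\<^sub>C crep u t)"
  and W1p_weak_deriv_add: "u \<in> W1 \<Longrightarrow> v \<in> W1 \<Longrightarrow>
    wderiv (u + v) = wderiv u + wderiv v"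
  and W1p_weak_deriv_scaleC: "u \<in> W1 \<Longrightarrow>
    wderiv (c *\<^sub>C u) = c *\<^sub>C wderiv u"
  for u v :: "'a::complex_banach aefun"
proof -
  note add = triple_add[OF W1p_triple W1p_triple] and scale = triple_scaleC[OF W1p_triple]
  have "triple (0 :: 'a aefun) (\<lambda>_. 0) 0"
    unfolding sobolev_triple_def
  proof (intro conjI ballI allI impI)
    show "(0 :: 'a aefun) = ae_class (\<lambda>_. 0)" by (rule ae_class_zero)
    show "(0 :: 'a aefun) \<in> Lp p {a..b}"
      unfolding ae_class_zero by (rule Lp_continuous[where C = 0]) (use p ab in auto)
    fix t assume "t \<in> {a..b}"
    have "AE s in lebesgue. s \<in> {a..t} \<longrightarrow> rep_ae (0 :: 'a aefun) s = 0"
      unfolding ae_class_zero using rep_ae_class[of "\<lambda>_. 0 :: 'a"] by (auto elim: eventually_mono)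
    from has_integral_cong_AE_lebesgue[OF this]
    show "(rep_ae (0 :: 'a aefun) has_integral 0 - 0) {a..t}" by simp
  qed auto
  then show "csubspace (W1 :: 'a aefun set)"
    unfolding csubspace_def using add scale triple_W1p by blast
  show "u \<in> W1 \<Longrightarrow> v \<in> W1 \<Longrightarrow>
    crep (u + v) = (\<lambda>t. crep u t + crep v t)"
    by (rule cont_rep_eq[OF add])
  show "u \<in> W1 \<Longrightarrow> crep (c *\<^sub>C u) = (\<lambda>t. c *\<^sub>C crep u t)"
    by (rule cont_rep_eq[OF scale])
  show "u \<in> W1 \<Longrightarrow> v \<in> W1 \<Longrightarrow>
    wderiv (u + v) = wderiv u + wderiv v"
    by (rule weak_deriv_eq[OF add])
  show "u \<in> W1 \<Longrightarrow> wderiv (c *\<^sub>C u) = c *\<^sub>C wderiv u"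
    by (rule weak_deriv_eq[OF scale])
qed

lemma W1p_Lp: "u \<in> W1 \<Longrightarrow> u \<in> Lp p {a..b}"
  and W1p_weak_deriv_Lp: "u \<in> W1 \<Longrightarrow> wderiv u \<in> Lp p {a..b}"
proof -
  assume u: "u \<in> W1"
  note t = W1p_triple[OF u]
  show "wderiv u \<in> Lp p {a..b}" by (rule tripleD(3)[OF t])
  have "bounded (crep u ` {a..b})"
    using compact_continuous_image[OF triple_continuous[OF t]] compact_imp_bounded by blast
  then obtain C where "\<And>s. s \<in> {a..b} \<Longrightarrow> norm (crep u s) \<le> C"
    by (metis bounded_iff imageI)
  then have "ae_class (crep u) \<in> Lp p {a..b}"
    using Lp_continuous(1)[OF p _ triple_continuous[OF t] tripleD(2)[OF t]] ab by auto
  then show "u \<in> Lp p {a..b}" using tripleD(1)[OF t] by simp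
qed

text \<open>
  The Sobolev embedding: the increments of the continuous representative are controlled by the
  \<open>L\<^sup>1\<close> norm of the derivative, and averaging over the interval controls its size.
\<close>

definition "sup_const = (1 + (b - a)) * (1 + 1 / (b - a))"

lemma cont_rep_bound:
  assumes u: "u \<in> W1" and t: "t \<in> {a..b}"
  shows "norm (crep u t) \<le> sup_const * W1_norm u"
proof -
  let ?f = "crep u" and ?g = "wderiv u"
  note tr = W1p_triple[OF u]
  let ?G = "integral {a..b} (\<lambda>s. norm (rep_ae ?g s))"
  let ?F = "integral {a..b} (\<lambda>s. norm (rep_ae u s))"
  have nu: "(\<lambda>s. norm (rep_ae u s)) integrable_on {a..b}" and F: "?F \<le> (1 + (b - a)) * Lp_norm p u"
    using Lp_imp_L1[OF p _ W1p_Lp[OF u]] ab by auto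
  have ng: "(\<lambda>s. norm (rep_ae ?g s)) integrable_on {a..b}" and G: "?G \<le> (1 + (b - a)) * Lp_norm p ?g"
    using Lp_imp_L1[OF p _ tripleD(3)[OF tr]] ab by auto
  have incr: "norm (?f d - ?f c) \<le> ?G" if "a \<le> c" "c \<le> d" "d \<le> b" for c d
  proof -
    have sub: "{c..d} \<subseteq> {a..b}" using that by auto
    have "norm (integral {c..d} (rep_ae ?g)) \<le> integral {c..d} (\<lambda>s. norm (rep_ae ?g s))"
      using triple_increment[OF tr that] integrable_subinterval_real[OF ng sub]
      by (intro integral_norm_bound_integral) auto
    also have "\<dots> \<le> ?G"
      using integrable_subinterval_real[OF ng sub] ng sub by (intro integral_subset_le) auto
    finally show ?thesis using integral_unique[OF triple_increment[OF tr that]] by simp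
  qed
  have le: "norm (?f t) - ?G \<le> norm (?f s)" if "s \<in> {a..b}" for s
    using incr[of s t] incr[of t s] that t norm_triangle_ineq2[of "?f t" "?f s"]
    by (cases "s \<le> t") (auto simp: norm_minus_commute)
  have nf: "(\<lambda>s. norm (?f s)) integrable_on {a..b}"
    by (intro integrable_continuous_real continuous_intros triple_continuous[OF tr])
  have "integral {a..b} (\<lambda>s. norm (?f t) - ?G) \<le> integral {a..b} (\<lambda>s. norm (?f s))"
    by (rule integral_le[OF integrable_const_ivl nf le])
  also have "\<dots> = ?F"
  proof -
    have "AE s in lebesgue. s \<in> {a..b} \<longrightarrow> norm (?f s) = norm (rep_ae u s)"
      using rep_ae_class[of ?f] tripleD(1)[OF tr] by (auto elim: eventually_mono)
    from has_integral_cong_AE_lebesgue[OF this] show ?thesis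
      using nf nu by (metis has_integral_integrable_integral)
  qed
  finally have "(b - a) * (norm (?f t) - ?G) \<le> ?F" using ab by simp
  then have "norm (?f t) \<le> ?F * (1 / (b - a)) + ?G" using ab by (simp add: field_simps)
  also have "\<dots> \<le> ((1 + (b - a)) * Lp_norm p u) * (1 / (b - a)) + (1 + (b - a)) * Lp_norm p ?g"
    using F G ab by (intro add_mono mult_right_mono) auto
  also have "\<dots> \<le> sup_const * W1_norm u"
  proof -
    have "(1 + (b - a)) * (1 / (b - a)) \<le> sup_const" "1 + (b - a) \<le> sup_const"
      using ab by (auto simp: sup_const_def distrib_left)
    from add_mono[OF mult_right_mono[OF this(1) Lp_norm_nonneg[of p u]]
        mult_right_mono[OF this(2) Lp_norm_nonneg[of p ?g]]]
    show ?thesis unfolding W1p_norm_def distrib_left[of sup_const] by (simp only: mult_ac)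
  qed
  finally show ?thesis .
qed

lemma W1p_norm_add:
  assumes "u \<in> W1" "v \<in> W1"
  shows "W1_norm (u + v) \<le> 2 * (W1_norm u + W1_norm v)"
  using Lp_add(2)[OF p W1p_Lp[OF assms(1)] W1p_Lp[OF assms(2)]]
    Lp_add(2)[OF p W1p_weak_deriv_Lp[OF assms(1)] W1p_weak_deriv_Lp[OF assms(2)]]
  by (simp add: W1p_norm_def W1p_weak_deriv_add[OF assms])

lemma W1p_norm_nonneg [simp]: "0 \<le> W1_norm u"
  by (simp add: W1p_norm_def)

section \<open>The first-order equation \<open>\<mu> f - f' = g\<close>\<close>

text \<open>The equation expresses the derivative of a solution in terms of its size and of the data.\<close>

lemma W1p_norm_bound_of_sup:
  assumes u: "u \<in> W1" and g: "g \<in> Lp p {a..b}" "\<mu> *\<^sub>C u - wderiv u = g"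
    and C: "\<And>t. t \<in> {a..b} \<Longrightarrow> norm (crep u t) \<le> C"
  shows "W1_norm u \<le> (1 + 2 * cmod \<mu>) * (1 + (b - a)) * C + 2 * Lp_norm p g"
proof -
  note tr = W1p_triple[OF u]
  have Nu: "Lp_norm p u \<le> (1 + (b - a)) * C"
    using Lp_continuous(2)[OF p _ triple_continuous[OF tr] tripleD(2)[OF tr] C] tripleD(1)[OF tr] ab
    by simp
  have eq: "wderiv u = \<mu> *\<^sub>C u + (- 1) *\<^sub>C g"
    using g(2) by (auto simp: scaleC_minus_one algebra_simps)
  have "Lp_norm p (wderiv u) \<le> 2 * (cmod \<mu> * Lp_norm p u + 1 * Lp_norm p g)"
    unfolding eq
    using Lp_add(2)[OF p Lp_scaleC(1)[OF p W1p_Lp[OF u], of \<mu>] Lp_scaleC(1)[OF p g(1), of "- 1"]]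
      Lp_scaleC(2)[OF p W1p_Lp[OF u], of \<mu>] Lp_scaleC(2)[OF p g(1), of "- 1"]
    by simp
  also have "cmod \<mu> * Lp_norm p u \<le> cmod \<mu> * ((1 + (b - a)) * C)"
    by (intro mult_left_mono Nu) auto
  finally show ?thesis using Nu by (simp add: W1p_norm_def algebra_simps)
qed

lemma exp_has_vector_derivative:
  "((\<lambda>t. exp (\<mu> * complex_of_real t)) has_vector_derivative \<mu> * exp (\<mu> * of_real t)) (at t within S)"
  by (rule has_vector_derivative_real_field) (auto intro!: derivative_eq_intros)

lemma exp_scaleC_has_vector_derivative:
  fixes h :: "real \<Rightarrow> 'a::complex_banach"
  assumes "(h has_vector_derivative h') (at t within S)"
  shows "((\<lambda>t. exp (\<mu> * of_real t) *\<^sub>C h t) has_vector_derivative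
    exp (\<mu> * of_real t) *\<^sub>C h' + (\<mu> * exp (\<mu> * of_real t)) *\<^sub>C h t) (at t within S)"
  by (rule bounded_bilinear.has_vector_derivative[OF bounded_bilinear_scaleC])
    (rule exp_has_vector_derivative assms)+

definition exp_fun :: "complex \<Rightarrow> 'a::complex_banach \<Rightarrow> real \<Rightarrow> 'a" where
  "exp_fun \<mu> z t = (if t \<in> {a..b} then exp (\<mu> * of_real t) *\<^sub>C z else 0)"

lemma triple_class_deriv:
  fixes f f' :: "real \<Rightarrow> 'a::complex_banach"
  assumes supp: "\<And>t. t \<notin> {a..b} \<Longrightarrow> f t = 0" and g: "ae_class f' \<in> Lp p {a..b}"
    and int: "\<And>t. t \<in> {a..b} \<Longrightarrow> (f' has_integral (f t - f a)) {a..t}"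
  shows "triple (ae_class f) f (ae_class f')"
  unfolding sobolev_triple_def
proof (intro conjI allI impI ballI)
  fix t assume "t \<in> {a..b}"
  moreover have "AE s in lebesgue. s \<in> {a..t} \<longrightarrow> rep_ae (ae_class f') s = f' s"
    using rep_ae_class[of f'] by (auto elim: eventually_mono)
  ultimately show "(rep_ae (ae_class f') has_integral (f t - f a)) {a..t}"
    using has_integral_cong_AE_lebesgue int by blast
qed (use supp g in auto)

lemma triple_exp_fun:
  fixes z :: "'a::complex_banach"
  shows "triple (ae_class (exp_fun \<mu> z)) (exp_fun \<mu> z) (\<mu> *\<^sub>C ae_class (exp_fun \<mu> z))"
proof -
  have d: "((\<lambda>t. exp (\<mu> * of_real t) *\<^sub>C z) has_vector_derivative
      \<mu> *\<^sub>C (exp (\<mu> * of_real t) *\<^sub>C z)) (at t within S)" for t S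
    using exp_scaleC_has_vector_derivative[OF has_vector_derivative_const[of z], of \<mu> t S]
    by (simp add: scaleC_scaleC)
  have c: "continuous_on {a..b} (\<lambda>t. exp (\<mu> * of_real t) *\<^sub>C z)"
    unfolding continuous_on_eq_continuous_within using has_vector_derivative_continuous[OF d] by blast
  have c': "continuous_on {a..b} (exp_fun \<mu> z)"
    by (rule continuous_on_eq[OF c]) (simp add: exp_fun_def)
  have "bounded (exp_fun \<mu> z ` {a..b})"
    using compact_continuous_image[OF c'] compact_imp_bounded by blast
  then obtain C where "\<And>s. s \<in> {a..b} \<Longrightarrow> norm (exp_fun \<mu> z s) \<le> C"
    by (metis bounded_iff imageI)
  then have "ae_class (exp_fun \<mu> z) \<in> Lp p {a..b}"
    using ab by (intro Lp_continuous(1)[OF p _ c']) (auto simp: exp_fun_def)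
  then have "ae_class (\<lambda>t. \<mu> *\<^sub>C exp_fun \<mu> z t) \<in> Lp p {a..b}"
    unfolding ae_class_scaleC[symmetric] by (rule Lp_scaleC(1)[OF p])
  moreover have "((\<lambda>s. \<mu> *\<^sub>C exp_fun \<mu> z s) has_integral (exp_fun \<mu> z t - exp_fun \<mu> z a)) {a..t}"
    if t: "t \<in> {a..b}" for t
  proof -
    have "((\<lambda>s. \<mu> *\<^sub>C (exp (\<mu> * of_real s) *\<^sub>C z)) has_integral
        (exp (\<mu> * of_real t) *\<^sub>C z - exp (\<mu> * of_real a) *\<^sub>C z)) {a..t}"
      using t by (intro fundamental_theorem_of_calculus d) auto
    then have "((\<lambda>s. \<mu> *\<^sub>C (exp (\<mu> * of_real s) *\<^sub>C z)) has_integral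
        (exp_fun \<mu> z t - exp_fun \<mu> z a)) {a..t}"
      using t by (simp add: exp_fun_def)
    then show ?thesis
      by (rule has_integral_eq[rotated]) (use t in \<open>auto simp: exp_fun_def\<close>)
  qed
  ultimately show ?thesis
    unfolding ae_class_scaleC by (intro triple_class_deriv) (auto simp: exp_fun_def)
qed

definition "exp_const \<mu> = exp (cmod \<mu> * max \<bar>a\<bar> \<bar>b\<bar>)"

lemma exp_const_bound:
  assumes "t \<in> {a..b}"
  shows "cmod (exp (\<mu> * of_real t)) \<le> exp_const \<mu>" "cmod (exp (- (\<mu> * of_real t))) \<le> exp_const \<mu>"
proof -
  have "cmod (\<mu> * of_real t) \<le> cmod \<mu> * max \<bar>a\<bar> \<bar>b\<bar>"
    using assms by (auto simp: norm_mult intro!: mult_left_mono)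
  then show "cmod (exp (\<mu> * of_real t)) \<le> exp_const \<mu>"
    "cmod (exp (- (\<mu> * of_real t))) \<le> exp_const \<mu>"
    unfolding exp_const_def
    using norm_exp[of "\<mu> * of_real t"] norm_exp[of "- (\<mu> * of_real t)"]
    by (auto intro: order_trans)
qed

lemma exp_const_pos: "exp_const \<mu> > 0" by (simp add: exp_const_def)

text \<open>
  The variation of constants formula.  For continuous \<open>g\<close> it is differentiable in the classical sense;
  the general case follows because each term depends continuously on \<open>g\<close> in the \<open>L\<^sup>1\<close> norm.
\<close>

definition shift_fun :: "complex \<Rightarrow> (real \<Rightarrow> 'a::complex_banach) \<Rightarrow> real \<Rightarrow> 'a" where
  "shift_fun \<mu> g t = exp (\<mu> * of_real t) *\<^sub>C
     integral {t..b} (\<lambda>s. exp (- (\<mu> * of_real s)) *\<^sub>C g s)"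

lemma continuous_on_exp: "continuous_on S (\<lambda>s. exp (\<mu> * complex_of_real s))"
  "continuous_on S (\<lambda>s. exp (- (\<mu> * complex_of_real s)))"
  by (intro continuous_intros)+

lemma continuous_on_scaleC:
  fixes h :: "real \<Rightarrow> 'a::complex_banach"
  shows "continuous_on S c \<Longrightarrow> continuous_on S h \<Longrightarrow> continuous_on S (\<lambda>t. c t *\<^sub>C h t)"
  by (rule bounded_bilinear.continuous_on[OF bounded_bilinear_scaleC])

lemma shift_fun_continuous_solution:
  assumes h: "continuous_on {a..b} h" and t: "t \<in> {a..b}"
  shows "((\<lambda>s. \<mu> *\<^sub>C shift_fun \<mu> h s - h s) has_integral (shift_fun \<mu> h t - shift_fun \<mu> h a)) {a..t}"
proof -
  define H where "H s = exp (- (\<mu> * of_real s)) *\<^sub>C h s" for s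
  have H: "continuous_on {a..b} H"
    unfolding H_def by (intro continuous_on_scaleC continuous_on_exp h)
  have "((\<lambda>t. integral {t..b} H) has_vector_derivative - H s) (at s within {a..b})"
    if s: "s \<in> {a..b}" for s
  proof -
    have d0: "((\<lambda>t. integral {a..b} H - integral {a..t} H) has_vector_derivative 0 - H s) (at s within {a..b})"
      by (intro has_vector_derivative_diff has_vector_derivative_const integral_has_vector_derivative H s)
    have int: "integral {a..b} H - integral {a..t} H = integral {t..b} H" if "t \<in> {a..b}" for t
    proof -
      have "integral {a..t} H + integral {t..b} H = integral {a..b} H"
        using that by (intro integral_split integrable_continuous_real H) auto
      then show ?thesis by (metis add_diff_cancel_left')
    qed
    have "((\<lambda>t. integral {t..b} H) has_vector_derivative 0 - H s) (at s within {a..b})"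
      by (rule has_vector_derivative_transform[OF s _ d0]) (simp add: int)
    then show ?thesis by simp
  qed
  moreover have shift: "shift_fun \<mu> h = (\<lambda>t. exp (\<mu> * of_real t) *\<^sub>C integral {t..b} H)"
    by (simp add: shift_fun_def[abs_def] H_def[abs_def])
  ultimately
  have d: "(shift_fun \<mu> h has_vector_derivative \<mu> *\<^sub>C shift_fun \<mu> h s - h s) (at s within {a..b})"
    if "s \<in> {a..b}" for s
    using exp_scaleC_has_vector_derivative[of "\<lambda>t. integral {t..b} H" "- H s" s "{a..b}" \<mu>] that
    by (simp add: shift) (simp add: H_def scaleC_scaleC flip: exp_add)
  show ?thesis
  proof (rule fundamental_theorem_of_calculus)
    show "(shift_fun \<mu> h has_vector_derivative \<mu> *\<^sub>C shift_fun \<mu> h s - h s) (at s within {a..t})"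
      if "s \<in> {a..t}" for s
      using d[of s] that t by (auto intro: has_vector_derivative_within_subset)
  qed (use t in auto)
qed

lemma exp_scaleC_integrable:
  fixes g :: "real \<Rightarrow> 'a::complex_banach"
  assumes g: "strongly_measurable g" "(\<lambda>t. norm (g t)) integrable_on {a..b}"
  shows "(\<lambda>s. exp (- (\<mu> * of_real s)) *\<^sub>C g s) integrable_on {a..b}"
proof -
  let ?c = "\<lambda>s. if s \<in> {a..b} then exp (- (\<mu> * of_real s)) else 0"
  have sm: "strongly_measurable (\<lambda>s. ?c s *\<^sub>C g s)"
    by (intro strongly_measurable_scaleC strongly_measurable_continuous_on continuous_on_exp g)
  have "(\<lambda>s. norm (?c s *\<^sub>C g s)) integrable_on cbox a b"
  proof (rule measurable_bounded_lemma)
    show "(\<lambda>s. exp_const \<mu> * norm (g s)) integrable_on cbox a b"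
      using g(2) by (intro integrable_on_mult_right) (simp add: box_real)
    show "norm (norm (?c s *\<^sub>C g s)) \<le> exp_const \<mu> * norm (g s)" if "s \<in> cbox a b" for s
      using that exp_const_bound(2)[of s \<mu>] by (auto simp: box_real norm_scaleC intro!: mult_right_mono)
  qed (rule borel_measurable_norm_strongly[OF sm])
  then have "(\<lambda>s. ?c s *\<^sub>C g s) integrable_on {a..b}"
    by (intro L1_approximable_integrable[OF L1_approximable_strongly_measurable[OF sm]]) (simp add: box_real)
  then show ?thesis by (rule integrable_eq) auto
qed

lemma shift_fun_diff_bound:
  fixes g h :: "real \<Rightarrow> 'a::complex_banach"
  assumes g: "strongly_measurable g" "(\<lambda>t. norm (g t)) integrable_on {a..b}"
    and h: "continuous_on {a..b} h"
    and k: "k integrable_on {a..b}" "\<And>t. t \<in> {a..b} \<Longrightarrow> norm (g t - h t) \<le> k t"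
    and t: "t \<in> {a..b}"
  shows "norm (shift_fun \<mu> g t - shift_fun \<mu> h t) \<le> exp_const \<mu> * (exp_const \<mu> * integral {a..b} k)"
proof -
  let ?e = "\<lambda>s. exp (- (\<mu> * of_real s))"
  have sub: "{t..b} \<subseteq> {a..b}" using t by auto
  have ig: "(\<lambda>s. ?e s *\<^sub>C g s) integrable_on {t..b}"
    by (rule integrable_subinterval_real[OF exp_scaleC_integrable[OF g] sub])
  have ih: "(\<lambda>s. ?e s *\<^sub>C h s) integrable_on {t..b}"
    by (rule integrable_subinterval_real[OF _ sub], rule integrable_continuous_real)
      (intro continuous_on_scaleC continuous_on_exp h)
  have k0: "0 \<le> k s" if "s \<in> {a..b}" for s
    using k(2)[OF that] norm_ge_zero order_trans by blast
  have ik: "k integrable_on {t..b}" by (rule integrable_subinterval_real[OF k(1) sub])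
  have "shift_fun \<mu> g t - shift_fun \<mu> h t =
      exp (\<mu> * of_real t) *\<^sub>C integral {t..b} (\<lambda>s. ?e s *\<^sub>C g s - ?e s *\<^sub>C h s)"
    using integral_diff[OF ig ih] by (simp add: shift_fun_def scaleC_diff_right)
  also have "norm \<dots> \<le> exp_const \<mu> * norm (integral {t..b} (\<lambda>s. ?e s *\<^sub>C g s - ?e s *\<^sub>C h s))"
    unfolding norm_scaleC by (intro mult_right_mono exp_const_bound t) auto
  also have "\<dots> \<le> exp_const \<mu> * integral {t..b} (\<lambda>s. exp_const \<mu> * k s)"
  proof (intro mult_left_mono integral_norm_bound_integral integrable_diff ig ih integrable_on_mult_right ik)
    fix s assume "s \<in> {t..b}"
    then have s: "s \<in> {a..b}" using sub by auto
    have "norm (?e s *\<^sub>C g s - ?e s *\<^sub>C h s) = cmod (?e s) * norm (g s - h s)"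
      by (simp add: norm_scaleC flip: scaleC_diff_right)
    also have "\<dots> \<le> exp_const \<mu> * k s"
      by (intro mult_mono exp_const_bound k s less_imp_le[OF exp_const_pos]) auto
    finally show "norm (?e s *\<^sub>C g s - ?e s *\<^sub>C h s) \<le> exp_const \<mu> * k s" .
  qed (use exp_const_pos less_imp_le in auto)
  also have "\<dots> \<le> exp_const \<mu> * (exp_const \<mu> * integral {a..b} k)"
    using integral_subset_le[OF sub ik k(1)] k0 exp_const_pos[of \<mu>] by (simp add: mult_left_mono)
  finally show ?thesis .
qed

lemma shift_fun_continuous:
  fixes g :: "real \<Rightarrow> 'a::complex_banach"
  assumes g: "strongly_measurable g" "(\<lambda>t. norm (g t)) integrable_on {a..b}"
  shows "continuous_on {a..b} (shift_fun \<mu> g)"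
proof -
  define H where "H s = exp (- (\<mu> * of_real s)) *\<^sub>C g s" for s
  have H: "H integrable_on {a..b}" unfolding H_def by (rule exp_scaleC_integrable[OF g])
  have "continuous_on {a..b} (\<lambda>t. exp (\<mu> * of_real t) *\<^sub>C (integral {a..b} H - integral {a..t} H))"
    by (intro continuous_on_scaleC continuous_on_exp continuous_intros indefinite_integral_continuous_1 H)
  moreover have "exp (\<mu> * of_real t) *\<^sub>C (integral {a..b} H - integral {a..t} H) = shift_fun \<mu> g t"
    if "t \<in> {a..b}" for t
  proof -
    have "integral {a..t} H + integral {t..b} H = integral {a..b} H"
      using that by (intro integral_split H) auto
    then have "integral {a..b} H - integral {a..t} H = integral {t..b} H"
      by (metis add_diff_cancel_left')
    then show ?thesis by (simp add: shift_fun_def flip: H_def)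
  qed
  ultimately show ?thesis by (rule continuous_on_eq)
qed

lemma shift_fun_solution:
  fixes g :: "real \<Rightarrow> 'a::complex_banach"
  assumes g: "strongly_measurable g" "(\<lambda>t. norm (g t)) integrable_on {a..b}" and t: "t \<in> {a..b}"
  shows "((\<lambda>s. \<mu> *\<^sub>C shift_fun \<mu> g s - g s) has_integral (shift_fun \<mu> g t - shift_fun \<mu> g a)) {a..t}"
proof -
  let ?F = "shift_fun \<mu>" and ?M = "exp_const \<mu>"
  have sub: "{a..t} \<subseteq> {a..b}" using t by auto
  have gi: "g integrable_on {a..b}"
    by (rule L1_approximable_integrable[OF L1_approximable_strongly_measurable[OF g]])
  have Fg: "(\<lambda>s. \<mu> *\<^sub>C ?F g s - g s) integrable_on {a..t}"
    by (rule integrable_subinterval_real[OF _ sub],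
        intro integrable_diff gi integrable_continuous_real continuous_on_scaleC
          shift_fun_continuous g continuous_on_const)
  let ?d = "integral {a..t} (\<lambda>s. \<mu> *\<^sub>C ?F g s - g s) - (?F g t - ?F g a)"
  define C where "C = cmod \<mu> * (?M * ?M) * (b - a) + 1 + 2 * (?M * ?M)"
  have C: "C > 0"
    unfolding C_def using ab exp_const_pos[of \<mu>] by (intro add_nonneg_pos add_pos_pos) (auto intro!: add_nonneg_pos)
  have "norm ?d \<le> 0"
  proof (rule field_le_epsilon)
    fix e' :: real assume "e' > 0"
    then have "e' / C > 0" using C by simp
    from L1_approximableE[OF L1_approximable_strongly_measurable[OF g] this]
    obtain h k where h: "continuous_on {a..b} h" and k: "k integrable_on {a..b}"
      "integral {a..b} k < e' / C" "\<And>t. t \<in> {a..b} \<Longrightarrow> norm (g t - h t) \<le> k t" by blast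
    let ?I = "integral {a..b} k"
    have k0: "0 \<le> k s" if "s \<in> {a..b}" for s
      using k(3)[OF that] norm_ge_zero order_trans by blast
    have I0: "?I \<ge> 0" by (intro integral_nonneg k k0)
    have diff: "norm (?F g t - ?F h t) \<le> ?M * (?M * ?I)" if "t \<in> {a..b}" for t
      by (rule shift_fun_diff_bound[OF g h k(1) _ that]) (rule k(3))
    note sol = shift_fun_continuous_solution[OF h t, of \<mu>]
    have "norm (integral {a..t} (\<lambda>s. (\<mu> *\<^sub>C ?F g s - g s) - (\<mu> *\<^sub>C ?F h s - h s)))
        \<le> integral {a..t} (\<lambda>s. cmod \<mu> * (?M * (?M * ?I)) + k s)"
    proof (intro integral_norm_bound_integral)
      show "(\<lambda>s. (\<mu> *\<^sub>C ?F g s - g s) - (\<mu> *\<^sub>C ?F h s - h s)) integrable_on {a..t}"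
        by (rule integrable_diff[OF Fg has_integral_integrable[OF sol]])
      show "(\<lambda>s. cmod \<mu> * (?M * (?M * ?I)) + k s) integrable_on {a..t}"
        using integrable_subinterval_real[OF k(1) sub] by (intro integrable_add integrable_const_ivl)
      fix s assume "s \<in> {a..t}"
      then have s: "s \<in> {a..b}" using sub by auto
      have "norm ((\<mu> *\<^sub>C ?F g s - g s) - (\<mu> *\<^sub>C ?F h s - h s))
          = norm (\<mu> *\<^sub>C (?F g s - ?F h s) - (g s - h s))" by (simp add: scaleC_diff_right algebra_simps)
      also have "\<dots> \<le> cmod \<mu> * norm (?F g s - ?F h s) + norm (g s - h s)"
        using norm_triangle_ineq4 by (metis norm_scaleC)
      also have "\<dots> \<le> cmod \<mu> * (?M * (?M * ?I)) + k s"
        by (intro add_mono mult_left_mono diff s k) auto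
      finally show "norm ((\<mu> *\<^sub>C ?F g s - g s) - (\<mu> *\<^sub>C ?F h s - h s)) \<le> cmod \<mu> * (?M * (?M * ?I)) + k s" .
    qed
    also have "\<dots> = (t - a) * (cmod \<mu> * (?M * (?M * ?I))) + integral {a..t} k"
      using t integrable_subinterval_real[OF k(1) sub] by (subst integral_add) auto
    also have "\<dots> \<le> (b - a) * (cmod \<mu> * (?M * (?M * ?I))) + ?I"
      using t I0 exp_const_pos[of \<mu>] integrable_subinterval_real[OF k(1) sub] k0
      by (intro add_mono mult_right_mono integral_subset_le k sub mult_nonneg_nonneg) auto
    finally have 1: "norm (integral {a..t} (\<lambda>s. \<mu> *\<^sub>C ?F g s - g s) - (?F h t - ?F h a))
        \<le> (b - a) * (cmod \<mu> * (?M * (?M * ?I))) + ?I"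
      using integral_diff[OF Fg has_integral_integrable[OF sol]] integral_unique[OF sol] by simp
    have 2: "norm ((?F h t - ?F g t) - (?F h a - ?F g a)) \<le> 2 * (?M * (?M * ?I))"
      using norm_triangle_ineq4[of "?F h t - ?F g t" "?F h a - ?F g a"] diff[OF t] diff[of a] ab
      by (simp add: norm_minus_commute)
    have "norm ?d \<le> C * ?I"
      using 1 2 norm_triangle_ineq[of "integral {a..t} (\<lambda>s. \<mu> *\<^sub>C ?F g s - g s) - (?F h t - ?F h a)"
          "(?F h t - ?F g t) - (?F h a - ?F g a)"]
      by (simp add: C_def algebra_simps)
    also have "\<dots> \<le> e'" using k(2) C by (simp add: field_simps)
    finally show "norm ?d \<le> 0 + e'" by simp
  qed
  then show ?thesis using Fg by (simp add: has_integral_integrable_integral)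
qed

lemma shift_equation_exists:
  fixes g :: "'a::complex_banach aefun"
  assumes g: "g \<in> Lp p {a..b}"
  shows "\<exists>u\<in>W1. \<mu> *\<^sub>C u - wderiv u = g \<and> crep u b = 0 \<and>
    (\<forall>t\<in>{a..b}. norm (crep u t) \<le> exp_const \<mu> * (exp_const \<mu> * ((1 + (b - a)) * Lp_norm p g)))"
proof -
  have ng: "(\<lambda>t. norm (rep_ae g t)) integrable_on {a..b}"
    and ng': "integral {a..b} (\<lambda>t. norm (rep_ae g t)) \<le> (1 + (b - a)) * Lp_norm p g"
    using Lp_imp_L1[OF p _ g] ab by auto
  note m = Lp_measurable[OF g]
  define f where "f t = (if t \<in> {a..b} then shift_fun \<mu> (rep_ae g) t else 0)" for t
  have bound: "norm (f t) \<le> exp_const \<mu> * (exp_const \<mu> * ((1 + (b - a)) * Lp_norm p g))"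
    if t: "t \<in> {a..b}" for t
  proof -
    have "norm (shift_fun \<mu> (rep_ae g) t - shift_fun \<mu> (\<lambda>_. 0) t)
        \<le> exp_const \<mu> * (exp_const \<mu> * integral {a..b} (\<lambda>t. norm (rep_ae g t)))"
      by (rule shift_fun_diff_bound[OF m ng _ ng _ t]) auto
    also have "\<dots> \<le> exp_const \<mu> * (exp_const \<mu> * ((1 + (b - a)) * Lp_norm p g))"
      by (intro mult_left_mono ng' less_imp_le[OF exp_const_pos])
    finally show ?thesis using t by (simp add: f_def shift_fun_def)
  qed
  have cf: "continuous_on {a..b} f"
    by (rule continuous_on_eq[OF shift_fun_continuous[OF m ng, of \<mu>]]) (simp add: f_def)
  have "ae_class f \<in> Lp p {a..b}"
    using ab by (intro Lp_continuous(1)[OF p _ cf _ bound]) (auto simp: f_def)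
  then have "\<mu> *\<^sub>C ae_class f + (- 1) *\<^sub>C g \<in> Lp p {a..b}"
    by (intro Lp_add Lp_scaleC p g)
  moreover have "\<mu> *\<^sub>C ae_class f + (- 1) *\<^sub>C g = ae_class (\<lambda>t. \<mu> *\<^sub>C f t - rep_ae g t)"
    by (simp add: scaleC_minus_one ae_class_scaleC flip: ae_class_diff)
  ultimately have L: "ae_class (\<lambda>t. \<mu> *\<^sub>C f t - rep_ae g t) \<in> Lp p {a..b}" by simp
  have tr: "triple (ae_class f) f (ae_class (\<lambda>t. \<mu> *\<^sub>C f t - rep_ae g t))"
  proof (rule triple_class_deriv[OF _ L])
    show "((\<lambda>t. \<mu> *\<^sub>C f t - rep_ae g t) has_integral f t - f a) {a..t}" if "t \<in> {a..b}" for t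
    proof -
      have "((\<lambda>t. \<mu> *\<^sub>C shift_fun \<mu> (rep_ae g) t - rep_ae g t) has_integral f t - f a) {a..t}"
        using shift_fun_solution[OF m ng that, of \<mu>] that by (simp add: f_def)
      then show ?thesis
        by (rule has_integral_eq[rotated]) (use that in \<open>auto simp: f_def\<close>)
    qed
  qed (auto simp: f_def)
  show ?thesis
  proof (intro bexI[OF _ triple_W1p[OF tr]] conjI ballI)
    show "\<mu> *\<^sub>C ae_class f - wderiv (ae_class f) = g"
      unfolding weak_deriv_eq[OF tr] by (simp add: ae_class_scaleC flip: ae_class_diff)
    show "crep (ae_class f) b = 0"
      using ab by (simp add: cont_rep_eq[OF tr] f_def shift_fun_def)
  qed (use bound in \<open>simp add: cont_rep_eq[OF tr]\<close>)
qed

text \<open>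
  The continuous representative is, up to a constant, the integral of \<open>\<mu>\<close> times itself, hence
  continuously differentiable, and the product rule shows that \<open>exp (- \<mu> t) f(t)\<close> is constant.
\<close>

lemma homogeneous_equation_unique:
  fixes u :: "'a::complex_banach aefun"
  assumes u: "u \<in> W1" and eq: "\<mu> *\<^sub>C u - wderiv u = 0"
  shows "u = ae_class (exp_fun \<mu> (exp (- (\<mu> * of_real b)) *\<^sub>C crep u b))"
proof -
  let ?f = "crep u"
  note tr = W1p_triple[OF u]
  have c: "continuous_on {a..b} ?f" by (rule triple_continuous[OF tr])
  have "wderiv u = ae_class (\<lambda>t. \<mu> *\<^sub>C ?f t)"
    using eq tripleD(1)[OF tr] by (metis ae_class_scaleC eq_iff_diff_eq_0)
  then have "AE t in lebesgue. rep_ae (wderiv u) t = \<mu> *\<^sub>C ?f t"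
    using rep_ae_class[of "\<lambda>t. \<mu> *\<^sub>C ?f t"] by simp
  then have ae: "AE s in lebesgue. s \<in> {a..t} \<longrightarrow> rep_ae (wderiv u) s = \<mu> *\<^sub>C ?f s" for t
    by eventually_elim simp
  have int: "((\<lambda>s. \<mu> *\<^sub>C ?f s) has_integral (?f t - ?f a)) {a..t}" if "t \<in> {a..b}" for t
    using iffD1[OF has_integral_cong_AE_lebesgue[OF ae] tripleD(4)[OF tr that]] .
  have d: "(?f has_vector_derivative \<mu> *\<^sub>C ?f s) (at s within {a..b})" if s: "s \<in> {a..b}" for s
  proof -
    have d0: "((\<lambda>t. ?f a + integral {a..t} (\<lambda>s. \<mu> *\<^sub>C ?f s)) has_vector_derivative 0 + \<mu> *\<^sub>C ?f s) (at s within {a..b})"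
      by (intro has_vector_derivative_add has_vector_derivative_const integral_has_vector_derivative s
          continuous_on_scaleC continuous_on_const c)
    have "?f t = ?f a + integral {a..t} (\<lambda>s. \<mu> *\<^sub>C ?f s)" if "t \<in> {a..b}" for t
      using integral_unique[OF int[OF that]] by simp
    from has_vector_derivative_transform[OF s this d0] show ?thesis by simp
  qed
  have "((\<lambda>t. exp (- \<mu> * of_real t) *\<^sub>C ?f t) has_vector_derivative 0) (at s within {a..b})"
    if "s \<in> {a..b}" for s
    using exp_scaleC_has_vector_derivative[OF d[OF that], of "- \<mu>"]
    by (simp add: scaleC_scaleC mult.commute flip: scaleC_add_left)
  then obtain z where z: "\<And>t. t \<in> {a..b} \<Longrightarrow> exp (- \<mu> * of_real t) *\<^sub>C ?f t = z"
    using has_vector_derivative_zero_constant[of "{a..b}" "\<lambda>t. exp (- \<mu> * of_real t) *\<^sub>C ?f t"]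
    by auto
  have "?f t = exp_fun \<mu> z t" for t
  proof (cases "t \<in> {a..b}")
    case True
    have "exp (\<mu> * of_real t) *\<^sub>C z = ?f t"
      unfolding z[OF True, symmetric] by (simp add: scaleC_scaleC flip: exp_add)
    then show ?thesis using True by (simp add: exp_fun_def)
  next
    case False
    then show ?thesis using tripleD(2)[OF tr, of t] by (auto simp: exp_fun_def)
  qed
  then have "?f = exp_fun \<mu> z" by (rule ext)
  moreover have "z = exp (- (\<mu> * of_real b)) *\<^sub>C ?f b" using z[of b] ab by simp
  ultimately show ?thesis using tripleD(1)[OF tr] by simp
qed

end

section \<open>Riemann-Stieltjes integrals\<close>

text \<open>
  Clamping \<open>\<eta>\<close> to \<open>[c, d]\<close> turns the increments over the intersections with \<open>[c, d]\<close> into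
  increments over the whole intervals, which telescope.
\<close>

lemma sum_increments_Int:
  fixes \<eta> :: "real \<Rightarrow> 'a::real_normed_vector"
  assumes p: "p tagged_division_of {a..b}" and K: "K = {c..d}" "K \<subseteq> {a..b}" "c \<le> d"
  shows "(\<Sum>(x,L)\<in>p. if K \<inter> L = {} then 0 else \<eta> (Sup (K \<inter> L)) - \<eta> (Inf (K \<inter> L))) = \<eta> d - \<eta> c"
proof -
  define \<zeta> where "\<zeta> t = \<eta> (min d (max c t))" for t
  have ab: "a \<le> b" using K by auto
  have "(\<Sum>(x,L)\<in>p. \<zeta> (Sup L) - \<zeta> (Inf L)) = \<zeta> b - \<zeta> a"
    by (rule additive_tagged_division_1[OF ab p])
  also have "\<dots> = \<eta> d - \<eta> c"
  proof -
    have "a \<le> c" "d \<le> b" using K by auto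
    then show ?thesis using K(3) by (simp add: \<zeta>_def min_def max_def)
  qed
  finally have *: "(\<Sum>(x,L)\<in>p. \<zeta> (Sup L) - \<zeta> (Inf L)) = \<eta> d - \<eta> c" .
  have "(if K \<inter> L = {} then 0 else \<eta> (Sup (K \<inter> L)) - \<eta> (Inf (K \<inter> L))) = \<zeta> (Sup L) - \<zeta> (Inf L)"
    if xL: "(x, L) \<in> p" for x L
  proof -
    obtain u v where L: "L = {u..v}" using tagged_division_ofD(4)[OF p xL] by (auto simp: box_real)
    have uv: "u \<le> v" using tagged_division_ofD(2)[OF p xL] L by auto
    have KL: "K \<inter> L = {max c u..min d v}" using K L by auto
    show ?thesis
    proof (cases "max c u \<le> min d v")
      case True
      then have "K \<inter> L \<noteq> {}" "Sup (K \<inter> L) = min d v" "Inf (K \<inter> L) = max c u"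
        by (simp_all add: KL)
      moreover have "max c v = v" "min d (max c u) = max c u" using True by auto
      ultimately show ?thesis using uv by (simp add: \<zeta>_def L)
    next
      case False
      then have "\<zeta> u = \<zeta> v" using uv K(3) by (auto simp: \<zeta>_def min_def max_def split: if_splits)
      moreover have "K \<inter> L = {}" using False by (simp add: KL)
      ultimately show ?thesis using uv by (simp add: L)
    qed
  qed
  then show ?thesis unfolding *[symmetric] by (intro sum.cong) auto
qed

text \<open>
  The empty set is singled out because \<open>Sup {}\<close> and \<open>Inf {}\<close> are unspecified; intersections of
  intervals of two divisions may be empty.
\<close>

definition oscillation :: "(real \<Rightarrow> 'a::real_normed_vector) \<Rightarrow> real set \<Rightarrow> real" where
  "oscillation \<eta> K = (if K = {} then 0 else norm (\<eta> (Sup K) - \<eta> (Inf K)))"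

lemma oscillation_degenerate:
  assumes "box u (v :: real) = {}"
  shows "oscillation \<eta> (K \<inter> cbox u v) = 0" "oscillation \<eta> (cbox u v \<inter> K) = 0"
proof -
  have "v \<le> u" using assms by (simp add: box_real)
  then have "cbox u v = {} \<or> cbox u v = {u}" by (cases "v = u") (auto simp: box_real)
  then have "K \<inter> cbox u v = {} \<or> K \<inter> cbox u v = {u}" by auto
  then show "oscillation \<eta> (K \<inter> cbox u v) = 0" by (auto simp: oscillation_def)
  then show "oscillation \<eta> (cbox u v \<inter> K) = 0" by (simp add: Int_commute)
qed

abbreviation "variation a b \<eta> \<equiv> enn2real (total_variation a b \<eta>)"

lemma sum_oscillation_division_le:
  assumes d: "d division_of {a..b}" and V: "total_variation a b \<eta> < \<infinity>"
  shows "(\<Sum>K\<in>d. oscillation \<eta> K) \<le> variation a b \<eta>"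
proof -
  let ?s = "\<Sum>K\<in>d. norm (\<eta> (Sup K) - \<eta> (Inf K))"
  have "(\<Sum>K\<in>d. oscillation \<eta> K) = ?s"
    using division_ofD(3)[OF d] by (intro sum.cong) (auto simp: oscillation_def)
  moreover have "ennreal ?s \<le> total_variation a b \<eta>"
    unfolding total_variation_def sum_ennreal[OF norm_ge_zero, symmetric]
    using d by (intro SUP_upper) auto
  then have "enn2real (ennreal ?s) \<le> variation a b \<eta>"
    using V by (intro enn2real_mono) auto
  moreover have "enn2real (ennreal ?s) = ?s" by (simp add: sum_nonneg)
  ultimately show ?thesis by simp
qed

lemma sum_norm_increments_le:
  fixes \<eta> :: "real \<Rightarrow> 'a::real_normed_vector"
  assumes p: "p tagged_division_of {a..b}" and V: "total_variation a b \<eta> < \<infinity>"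
  shows "(\<Sum>(x,K)\<in>p. norm (\<eta> (Sup K) - \<eta> (Inf K))) \<le> variation a b \<eta>"
proof -
  have "(\<Sum>(x,K)\<in>p. norm (\<eta> (Sup K) - \<eta> (Inf K))) = (\<Sum>(x,K)\<in>p. oscillation \<eta> K)"
    using tagged_division_ofD(2)[OF p] by (intro sum.cong) (fastforce simp: oscillation_def)+
  also have "\<dots> = (\<Sum>K\<in>snd ` p. oscillation \<eta> K)"
    using oscillation_degenerate[of _ _ \<eta> UNIV]
    by (intro sum.over_tagged_division_lemma[OF p]) simp
  also have "\<dots> \<le> variation a b \<eta>"
    by (rule sum_oscillation_division_le[OF division_of_tagged_division[OF p] V])
  finally show ?thesis .
qed

text \<open>
  The nonempty intersections of the intervals of two divisions form a division; an interval
  arises from two different pairs only if it is degenerate.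
\<close>

lemma sum_oscillation_refinement_le:
  assumes dp: "d division_of {a..b}" and dq: "d' division_of {a..b}" and V: "total_variation a b \<eta> < \<infinity>"
  shows "(\<Sum>K\<in>d. \<Sum>L\<in>d'. oscillation \<eta> (K \<inter> L)) \<le> variation a b \<eta>"
proof -
  let ?P = "{z \<in> d \<times> d'. fst z \<inter> snd z \<noteq> {}}"
  have fin: "finite (d \<times> d')" using dp dq by (auto dest: division_of_finite)
  have "(\<Sum>K\<in>d. \<Sum>L\<in>d'. oscillation \<eta> (K \<inter> L)) = (\<Sum>z\<in>d \<times> d'. oscillation \<eta> (fst z \<inter> snd z))"
    by (simp add: sum.cartesian_product case_prod_beta)
  also have "\<dots> = (\<Sum>z\<in>?P. oscillation \<eta> (fst z \<inter> snd z))"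
    using fin by (intro sum.mono_neutral_right) (auto simp: oscillation_def)
  also have "\<dots> = (\<Sum>M\<in>(\<lambda>z. fst z \<inter> snd z) ` ?P. oscillation \<eta> M)"
  proof (rule sum.reindex_nontrivial[symmetric, unfolded comp_def])
    show "finite ?P" using fin by simp
    fix z z' assume z: "z \<in> ?P" "z' \<in> ?P" "z \<noteq> z'" "fst z \<inter> snd z = fst z' \<inter> snd z'"
    have zm: "fst z \<in> d" "snd z \<in> d'" "fst z' \<in> d" "snd z' \<in> d'" using z(1,2) by auto
    obtain c e where K: "fst z = cbox c e" using division_ofD(4)[OF dp zm(1)] by auto
    obtain u v where L: "snd z = cbox u v" using division_ofD(4)[OF dq zm(2)] by auto
    obtain s t where M: "fst z \<inter> snd z = cbox s t" unfolding K L Int_interval by blast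
    have "fst z \<noteq> fst z' \<or> snd z \<noteq> snd z'" using z(3) by (auto simp: prod_eq_iff)
    then have "interior (fst z) \<inter> interior (fst z') = {} \<or> interior (snd z) \<inter> interior (snd z') = {}"
      using division_ofD(5)[OF dp zm(1,3)] division_ofD(5)[OF dq zm(2,4)] by blast
    moreover have "interior (fst z \<inter> snd z) \<subseteq> interior (fst z) \<inter> interior (fst z')"
      using z(4) by (metis interior_Int inf.cobounded1 inf.boundedI)
    moreover have "interior (fst z \<inter> snd z) \<subseteq> interior (snd z) \<inter> interior (snd z')"
      using z(4) by (metis interior_Int inf.cobounded2 inf.boundedI)
    ultimately have "interior (fst z \<inter> snd z) = {}" by blast
    then have "box s t = {}" using M interior_cbox by metis
    then show "oscillation \<eta> (fst z \<inter> snd z) = 0"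
      using oscillation_degenerate(1)[of s t \<eta> UNIV] M by simp
  qed
  also have "(\<lambda>z. fst z \<inter> snd z) ` ?P = {K \<inter> L |K L. K \<in> d \<and> L \<in> d' \<and> K \<inter> L \<noteq> {}}"
    by force
  also have "(\<Sum>M\<in>\<dots>. oscillation \<eta> M) \<le> variation a b \<eta>"
    using division_inter[OF dp dq] by (intro sum_oscillation_division_le V) simp
  finally show ?thesis .
qed

definition rs_sum where
  "rs_sum \<eta> f p = (\<Sum>(x, K)\<in>p. blinfun_apply (\<eta> (Sup K) - \<eta> (Inf K)) (f x))"

lemma rs_sum_bound:
  assumes p: "p tagged_division_of {a..b}" and V: "total_variation a b \<eta> < \<infinity>"
    and C: "\<And>t. t \<in> {a..b} \<Longrightarrow> norm (f t) \<le> C" "C \<ge> 0"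
  shows "norm (rs_sum \<eta> f p) \<le> variation a b \<eta> * C"
proof -
  have "norm (rs_sum \<eta> f p) \<le> (\<Sum>(x, K)\<in>p. norm (\<eta> (Sup K) - \<eta> (Inf K)) * C)"
    unfolding rs_sum_def
  proof (rule sum_norm_le, clarify)
    fix x K assume "(x, K) \<in> p"
    then have "x \<in> {a..b}" using p by (meson tagged_division_ofD(2,3) subsetD)
    then show "norm (blinfun_apply (\<eta> (Sup K) - \<eta> (Inf K)) (f x)) \<le> norm (\<eta> (Sup K) - \<eta> (Inf K)) * C"
      using norm_blinfun[of "\<eta> (Sup K) - \<eta> (Inf K)" "f x"] C
      by (meson mult_left_mono norm_ge_zero order_trans)
  qed
  also have "\<dots> = (\<Sum>(x, K)\<in>p. norm (\<eta> (Sup K) - \<eta> (Inf K))) * C"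
    by (simp add: sum_distrib_right case_prod_beta)
  also have "\<dots> \<le> variation a b \<eta> * C"
    using sum_norm_increments_le[OF p V] C by (intro mult_right_mono) auto
  finally show ?thesis .
qed

text \<open>Two Riemann-Stieltjes sums are compared on the common refinement of their divisions.\<close>

lemma rs_sum_diff_bound:
  fixes \<eta> :: "real \<Rightarrow> 'a::real_normed_vector \<Rightarrow>\<^sub>L 'b::real_normed_vector"
  assumes p: "p tagged_division_of {a..b}" and q: "q tagged_division_of {a..b}"
    and V: "total_variation a b \<eta> < \<infinity>"
    and mesh: "\<And>x K. (x, K) \<in> p \<Longrightarrow> Sup K - Inf K < \<delta>" "\<And>x K. (x, K) \<in> q \<Longrightarrow> Sup K - Inf K < \<delta>"
    and e: "\<And>x y. x \<in> {a..b} \<Longrightarrow> y \<in> {a..b} \<Longrightarrow> \<bar>x - y\<bar> < 2 * \<delta> \<Longrightarrow> norm (f x - f y) \<le> e" "e \<ge> 0"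
  shows "norm (rs_sum \<eta> f p - rs_sum \<eta> f q) \<le> variation a b \<eta> * e"
proof -
  define D where "D K L = (if K \<inter> L = {} then 0 else \<eta> (Sup (K \<inter> L)) - \<eta> (Inf (K \<inter> L)))" for K L
  have box: "\<exists>c d. K = {c..d} \<and> c \<le> d \<and> K \<subseteq> {a..b} \<and> x \<in> K"
    if "(x, K) \<in> r" "r tagged_division_of {a..b}" for x K r
    using tagged_division_ofD(2,3,4)[OF that(2,1)] by (fastforce simp: box_real)
  have row: "(\<Sum>(y,L)\<in>q. D K L) = \<eta> (Sup K) - \<eta> (Inf K)" if "(x, K) \<in> p" for x K
    using box[OF that p] sum_increments_Int[OF q, of K _ _ \<eta>] by (auto simp: D_def)
  have col: "(\<Sum>(x,K)\<in>p. D K L) = \<eta> (Sup L) - \<eta> (Inf L)" if "(y, L) \<in> q" for y L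
  proof -
    have D_commute: "D K L = D L K" for K by (simp add: D_def Int_commute)
    show ?thesis
      unfolding D_commute using box[OF that q] sum_increments_Int[OF p, of L _ _ \<eta>] by (auto simp: D_def)
  qed
  have P: "rs_sum \<eta> f p = (\<Sum>(x,K)\<in>p. \<Sum>(y,L)\<in>q. blinfun_apply (D K L) (f x))"
    unfolding rs_sum_def
  proof (rule sum.cong[OF refl], clarify)
    fix x K assume "(x, K) \<in> p"
    show "blinfun_apply (\<eta> (Sup K) - \<eta> (Inf K)) (f x) = (\<Sum>(y,L)\<in>q. blinfun_apply (D K L) (f x))"
      unfolding row[OF \<open>(x, K) \<in> p\<close>, symmetric]
      by (simp add: blinfun.sum_left case_prod_beta)
  qed
  have "rs_sum \<eta> f q = (\<Sum>(y,L)\<in>q. \<Sum>(x,K)\<in>p. blinfun_apply (D K L) (f y))"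
    unfolding rs_sum_def
  proof (rule sum.cong[OF refl], clarify)
    fix y L assume "(y, L) \<in> q"
    show "blinfun_apply (\<eta> (Sup L) - \<eta> (Inf L)) (f y) = (\<Sum>(x,K)\<in>p. blinfun_apply (D K L) (f y))"
      unfolding col[OF \<open>(y, L) \<in> q\<close>, symmetric]
      by (simp add: blinfun.sum_left case_prod_beta)
  qed
  also have "\<dots> = (\<Sum>(x,K)\<in>p. \<Sum>(y,L)\<in>q. blinfun_apply (D K L) (f y))"
    unfolding case_prod_beta by (rule sum.swap)
  finally have Q: "rs_sum \<eta> f q = (\<Sum>(x,K)\<in>p. \<Sum>(y,L)\<in>q. blinfun_apply (D K L) (f y))" .
  have "rs_sum \<eta> f p - rs_sum \<eta> f q = (\<Sum>(x,K)\<in>p. \<Sum>(y,L)\<in>q. blinfun_apply (D K L) (f x - f y))"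
    unfolding P Q by (simp add: sum_subtractf[symmetric] case_prod_beta blinfun.diff_right)
  also have "norm \<dots> \<le> (\<Sum>(x,K)\<in>p. \<Sum>(y,L)\<in>q. norm (D K L) * e)"
  proof (intro sum_norm_le, clarify)
    fix x K assume xK: "(x, K) \<in> p"
    show "norm (\<Sum>(y,L)\<in>q. blinfun_apply (D K L) (f x - f y)) \<le> (\<Sum>(y,L)\<in>q. norm (D K L) * e)"
    proof (intro sum_norm_le, clarify)
      fix y L assume yL: "(y, L) \<in> q"
      show "norm (blinfun_apply (D K L) (f x - f y)) \<le> norm (D K L) * e"
      proof (cases "K \<inter> L = {}")
        case True
        then show ?thesis by (simp add: D_def)
      next
        case False
        then obtain z where z: "z \<in> K" "z \<in> L" by auto
        obtain c d where K: "K = {c..d}" "K \<subseteq> {a..b}" "x \<in> K" "c \<le> d" using box[OF xK p] by blast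
        obtain u v where L: "L = {u..v}" "L \<subseteq> {a..b}" "y \<in> L" "u \<le> v" using box[OF yL q] by blast
        have "d - c < \<delta>" "v - u < \<delta>" using mesh(1)[OF xK] mesh(2)[OF yL] K L by auto
        then have "\<bar>x - y\<bar> < 2 * \<delta>" using z K L by auto
        then have "norm (f x - f y) \<le> e" using K L by (intro e) auto
        then show ?thesis
          using norm_blinfun[of "D K L" "f x - f y"] by (meson mult_left_mono norm_ge_zero order_trans)
      qed
    qed
  qed
  also have "\<dots> = (\<Sum>(x,K)\<in>p. \<Sum>(y,L)\<in>q. norm (D K L)) * e"
    by (simp add: sum_distrib_right case_prod_beta)
  also have "(\<Sum>(x,K)\<in>p. \<Sum>(y,L)\<in>q. norm (D K L)) \<le> variation a b \<eta>"
  proof -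
    have D_norm: "norm (D K L) = oscillation \<eta> (K \<inter> L)" for K L
      by (simp add: D_def oscillation_def)
    have "(\<Sum>(x,K)\<in>p. \<Sum>(y,L)\<in>q. norm (D K L)) = (\<Sum>(x,K)\<in>p. \<Sum>L\<in>snd ` q. oscillation \<eta> (K \<inter> L))"
    proof (rule sum.cong[OF refl], clarify)
      fix x K assume "(x, K) \<in> p"
      show "(\<Sum>(y,L)\<in>q. norm (D K L)) = (\<Sum>L\<in>snd ` q. oscillation \<eta> (K \<inter> L))"
        unfolding D_norm by (rule sum.over_tagged_division_lemma[OF q]) (rule oscillation_degenerate)
    qed
    also have "\<dots> = (\<Sum>K\<in>snd ` p. \<Sum>L\<in>snd ` q. oscillation \<eta> (K \<inter> L))"
      by (rule sum.over_tagged_division_lemma[OF p]) (intro sum.neutral ballI oscillation_degenerate(2))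
    also have "\<dots> \<le> variation a b \<eta>"
      by (intro sum_oscillation_refinement_le division_of_tagged_division[OF p]
          division_of_tagged_division[OF q] V)
    finally show ?thesis .
  qed
  finally show ?thesis using e(2) by (simp add: mult_right_mono)
qed

abbreviation mesh_below :: "real \<Rightarrow> (real \<times> real set) set \<Rightarrow> bool" where
  "mesh_below \<delta> P \<equiv> \<forall>(x, K)\<in>P. Sup K - Inf K < \<delta>"

lemma has_rs_integral_rs_sum:
  "has_rs_integral \<eta> f I a b \<longleftrightarrow>
     (\<forall>e>0. \<exists>\<delta>>0. \<forall>P. P tagged_division_of {a..b} \<and> mesh_below \<delta> P \<longrightarrow>
        norm (rs_sum \<eta> f P - I) < e)"
  unfolding has_rs_integral_def rs_sum_def ..

definition fine_sequence :: "real \<Rightarrow> real \<Rightarrow> (nat \<Rightarrow> (real \<times> real set) set) \<Rightarrow> bool" where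
  "fine_sequence a b P \<longleftrightarrow> (\<forall>n. P n tagged_division_of {a..b}) \<and> (\<forall>\<delta>>0. \<exists>N. \<forall>n\<ge>N. mesh_below \<delta> (P n))"

lemma fine_sequence_exists: "\<exists>P. fine_sequence a b P"
proof -
  have "\<exists>p. p tagged_division_of {a..b} \<and> mesh_below \<delta> p" if "\<delta> > 0" for \<delta>
  proof -
    have "gauge (\<lambda>x::real. ball x (\<delta> / 2))" using that by (intro gauge_ball) simp
    then obtain p where p: "p tagged_division_of {a..b}" "(\<lambda>x. ball x (\<delta> / 2)) fine p"
      using fine_division_exists_real by blast
    have "Sup K - Inf K < \<delta>" if xK: "(x, K) \<in> p" for x K
    proof -
      obtain c d where K: "K = {c..d}" using tagged_division_ofD(4)[OF p(1) xK] by (auto simp: box_real)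
      have cd: "c \<le> d" using tagged_division_ofD(2)[OF p(1) xK] K by auto
      then have "c \<in> ball x (\<delta> / 2)" "d \<in> ball x (\<delta> / 2)" using fineD[OF p(2) xK] K by auto
      then have "d - c < \<delta>" unfolding mem_ball dist_real_def by linarith
      then show ?thesis using K cd by simp
    qed
    then show ?thesis using p(1) by blast
  qed
  then have "\<forall>n. \<exists>p. p tagged_division_of {a..b} \<and> mesh_below (inverse (real (Suc n))) p"
    by (metis inverse_positive_iff_positive of_nat_0_less_iff zero_less_Suc)
  then obtain P where P: "\<And>n. P n tagged_division_of {a..b}"
    "\<And>n. mesh_below (inverse (real (Suc n))) (P n)" by metis
  have "\<exists>N. \<forall>n\<ge>N. mesh_below \<delta> (P n)" if \<delta>: "\<delta> > 0" for \<delta>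
  proof -
    obtain N where N: "inverse (real (Suc N)) < \<delta>" using reals_Archimedean[OF \<delta>] by auto
    have "inverse (real (Suc n)) < \<delta>" if "n \<ge> N" for n
      using N that by (intro le_less_trans[OF _ N] le_imp_inverse_le) auto
    then show ?thesis using P(2) by fastforce
  qed
  then show ?thesis using P(1) unfolding fine_sequence_def by blast
qed

lemma has_rs_integral_LIMSEQ:
  assumes "has_rs_integral \<eta> f I a b" "fine_sequence a b P"
  shows "(\<lambda>n. rs_sum \<eta> f (P n)) \<longlonglongrightarrow> I"
proof (rule LIMSEQ_I)
  fix e :: real assume "e > 0"
  then obtain \<delta> where \<delta>: "\<delta> > 0" "\<And>P. P tagged_division_of {a..b} \<Longrightarrow> mesh_below \<delta> P \<Longrightarrow>
      norm (rs_sum \<eta> f P - I) < e"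
    using assms(1) unfolding has_rs_integral_rs_sum by meson
  obtain N where N: "\<And>n. n \<ge> N \<Longrightarrow> mesh_below \<delta> (P n)" using assms(2) \<delta>(1) unfolding fine_sequence_def by blast
  show "\<exists>N. \<forall>n\<ge>N. norm (rs_sum \<eta> f (P n) - I) < e"
    using assms(2) by (intro exI[of _ N] allI impI \<delta>(2)[OF _ N]) (auto simp: fine_sequence_def)
qed

lemma rs_integral_eqI:
  assumes I: "has_rs_integral \<eta> f I a b"
  shows "rs_integral a b \<eta> f = I"
  unfolding rs_integral_def
proof (rule the_equality)
  show "has_rs_integral \<eta> f I a b" by (rule I)
  fix I' assume I': "has_rs_integral \<eta> f I' a b"
  obtain P where "fine_sequence a b P" using fine_sequence_exists by blast
  then have "(\<lambda>n. rs_sum \<eta> f (P n)) \<longlonglongrightarrow> I'" "(\<lambda>n. rs_sum \<eta> f (P n)) \<longlonglongrightarrow> I"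
    using has_rs_integral_LIMSEQ[OF I'] has_rs_integral_LIMSEQ[OF I] by blast+
  then show "I' = I" by (rule LIMSEQ_unique)
qed

text \<open>
  Uniform continuity of \<open>f\<close> and the comparison of sums make the Riemann--Stieltjes sums Cauchy as
  the mesh tends to zero.
\<close>

lemma has_rs_integral_continuous:
  fixes \<eta> :: "real \<Rightarrow> 'a::complex_banach \<Rightarrow>\<^sub>L 'b::complex_banach"
  assumes f: "continuous_on {a..b} f" and V: "total_variation a b \<eta> < \<infinity>"
  shows "has_rs_integral \<eta> f (rs_integral a b \<eta> f) a b"
proof -
  let ?V = "variation a b \<eta>"
  have close: "\<exists>\<delta>>0. \<forall>p q. p tagged_division_of {a..b} \<and> mesh_below \<delta> p \<and>
      q tagged_division_of {a..b} \<and> mesh_below \<delta> q \<longrightarrow>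
      norm (rs_sum \<eta> f p - rs_sum \<eta> f q) < e" if "e > 0" for e
  proof -
    define e' where "e' = e / (?V + 1)"
    have V1: "?V + 1 > 0" by (simp add: add_nonneg_pos)
    then have e': "e' > 0" using \<open>e > 0\<close> by (simp add: e'_def)
    obtain d where d: "d > 0" "\<And>x y. x \<in> {a..b} \<Longrightarrow> y \<in> {a..b} \<Longrightarrow> dist y x < d \<Longrightarrow> dist (f y) (f x) < e'"
      using compact_uniformly_continuous[OF f] e' unfolding uniformly_continuous_on_def by auto
    have "norm (rs_sum \<eta> f p - rs_sum \<eta> f q) < e"
      if "p tagged_division_of {a..b}" "mesh_below (d / 2) p"
        "q tagged_division_of {a..b}" "mesh_below (d / 2) q" for p q
    proof -
      have "norm (rs_sum \<eta> f p - rs_sum \<eta> f q) \<le> ?V * e'"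
      proof (rule rs_sum_diff_bound[OF that(1,3) V, of "d / 2"])
        show "norm (f x - f y) \<le> e'" if "x \<in> {a..b}" "y \<in> {a..b}" "\<bar>x - y\<bar> < 2 * (d / 2)" for x y
          using d(2)[OF that(2,1)] that(3) by (simp add: dist_norm less_imp_le)
      qed (use that e' in auto)
      also have "\<dots> < (?V + 1) * e'" using e' by simp
      also have "\<dots> = e" using V1 by (simp add: e'_def)
      finally show ?thesis .
    qed
    then show ?thesis using d(1) by (intro exI[of _ "d / 2"]) auto
  qed
  obtain P where "fine_sequence a b P" using fine_sequence_exists by blast
  then have P: "\<And>n. P n tagged_division_of {a..b}" "\<And>\<delta>. \<delta> > 0 \<Longrightarrow> \<exists>N. \<forall>n\<ge>N. mesh_below \<delta> (P n)"
    by (auto simp: fine_sequence_def)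
  have "Cauchy (\<lambda>n. rs_sum \<eta> f (P n))"
  proof (rule metric_CauchyI)
    fix e :: real assume "e > 0"
    from close[OF this] obtain \<delta> where \<delta>: "\<delta> > 0" "\<And>p q. p tagged_division_of {a..b} \<Longrightarrow>
      mesh_below \<delta> p \<Longrightarrow> q tagged_division_of {a..b} \<Longrightarrow>
      mesh_below \<delta> q \<Longrightarrow> norm (rs_sum \<eta> f p - rs_sum \<eta> f q) < e" by blast
    obtain N where N: "\<And>n. n \<ge> N \<Longrightarrow> mesh_below \<delta> (P n)" using P(2)[OF \<delta>(1)] by blast
    show "\<exists>M. \<forall>m\<ge>M. \<forall>n\<ge>M. dist (rs_sum \<eta> f (P m)) (rs_sum \<eta> f (P n)) < e"
      unfolding dist_norm by (intro exI[of _ N] allI impI \<delta>(2)[OF P(1) N P(1) N])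
  qed
  then obtain I where I: "(\<lambda>n. rs_sum \<eta> f (P n)) \<longlonglongrightarrow> I" using Cauchy_convergent convergent_def by blast
  have "has_rs_integral \<eta> f I a b"
    unfolding has_rs_integral_rs_sum
  proof (intro allI impI)
    fix e :: real assume "e > 0"
    then have e: "e / 2 > 0" by simp
    from close[OF e] obtain \<delta> where \<delta>: "\<delta> > 0" "\<And>p q. p tagged_division_of {a..b} \<Longrightarrow>
      mesh_below \<delta> p \<Longrightarrow> q tagged_division_of {a..b} \<Longrightarrow>
      mesh_below \<delta> q \<Longrightarrow> norm (rs_sum \<eta> f p - rs_sum \<eta> f q) < e / 2" by blast
    obtain N where N: "\<And>n. n \<ge> N \<Longrightarrow> mesh_below \<delta> (P n)" using P(2)[OF \<delta>(1)] by blast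
    obtain N' where N': "\<And>n. n \<ge> N' \<Longrightarrow> norm (rs_sum \<eta> f (P n) - I) < e / 2"
      using LIMSEQ_D[OF I e] by blast
    let ?n = "max N N'"
    have "norm (rs_sum \<eta> f p - I) < e"
      if "p tagged_division_of {a..b}" "mesh_below \<delta> p" for p
      using \<delta>(2)[OF that P(1) N, of ?n] N'[of ?n]
        norm_triangle_ineq[of "rs_sum \<eta> f p - rs_sum \<eta> f (P ?n)" "rs_sum \<eta> f (P ?n) - I"]
      by simp
    then show "\<exists>\<delta>>0. \<forall>P. P tagged_division_of {a..b} \<and> mesh_below \<delta> P \<longrightarrow>
        norm (rs_sum \<eta> f P - I) < e" using \<delta>(1) by blast
  qed
  then show ?thesis using rs_integral_eqI by metis
qed

lemma rs_integral_bound: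
  fixes \<eta> :: "real \<Rightarrow> 'a::complex_banach \<Rightarrow>\<^sub>L 'b::complex_banach"
  assumes f: "continuous_on {a..b} f" and V: "total_variation a b \<eta> < \<infinity>"
    and C: "\<And>t. t \<in> {a..b} \<Longrightarrow> norm (f t) \<le> C" "C \<ge> 0"
  shows "norm (rs_integral a b \<eta> f) \<le> variation a b \<eta> * C"
proof -
  obtain P where P: "fine_sequence a b P" using fine_sequence_exists by blast
  then have Pn: "P n tagged_division_of {a..b}" for n by (simp add: fine_sequence_def)
  have "(\<lambda>n. norm (rs_sum \<eta> f (P n))) \<longlonglongrightarrow> norm (rs_integral a b \<eta> f)"
    by (rule tendsto_norm[OF has_rs_integral_LIMSEQ[OF has_rs_integral_continuous[OF f V] P]])
  then show ?thesis
    using rs_sum_bound[OF Pn V C] by (intro LIMSEQ_le_const2) auto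
qed

lemma rs_integral_add:
  fixes \<eta> :: "real \<Rightarrow> 'a::complex_banach \<Rightarrow>\<^sub>L 'b::complex_banach"
  assumes f: "continuous_on {a..b} f" and g: "continuous_on {a..b} g" and V: "total_variation a b \<eta> < \<infinity>"
  shows "rs_integral a b \<eta> (\<lambda>t. f t + g t) = rs_integral a b \<eta> f + rs_integral a b \<eta> g"
proof -
  obtain P where P: "fine_sequence a b P" using fine_sequence_exists by blast
  have lim: "(\<lambda>n. rs_sum \<eta> h (P n)) \<longlonglongrightarrow> rs_integral a b \<eta> h" if "continuous_on {a..b} h" for h
    by (rule has_rs_integral_LIMSEQ[OF has_rs_integral_continuous[OF that V] P])
  have sum: "rs_sum \<eta> (\<lambda>t. f t + g t) p = rs_sum \<eta> f p + rs_sum \<eta> g p" for p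
    by (simp add: rs_sum_def blinfun.add_right sum.distrib case_prod_beta)
  have "(\<lambda>n. rs_sum \<eta> (\<lambda>t. f t + g t) (P n)) \<longlonglongrightarrow> rs_integral a b \<eta> f + rs_integral a b \<eta> g"
    unfolding sum by (intro tendsto_add lim f g)
  from LIMSEQ_unique[OF lim[OF continuous_on_add[OF f g]] this] show ?thesis .
qed

lemma rs_integral_scaleC:
  fixes \<eta> :: "real \<Rightarrow> 'a::complex_banach \<Rightarrow>\<^sub>L 'b::complex_banach"
  assumes f: "continuous_on {a..b} f" and V: "total_variation a b \<eta> < \<infinity>"
    and lin: "\<And>t. t \<in> {a..b} \<Longrightarrow> clinear_on UNIV (blinfun_apply (\<eta> t))"
  shows "rs_integral a b \<eta> (\<lambda>t. c *\<^sub>C f t) = c *\<^sub>C rs_integral a b \<eta> f"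
proof -
  obtain P where P: "fine_sequence a b P" using fine_sequence_exists by blast
  then have Pn: "P n tagged_division_of {a..b}" for n by (simp add: fine_sequence_def)
  have lim: "(\<lambda>n. rs_sum \<eta> h (P n)) \<longlonglongrightarrow> rs_integral a b \<eta> h" if "continuous_on {a..b} h" for h
    by (rule has_rs_integral_LIMSEQ[OF has_rs_integral_continuous[OF that V] P])
  have sum: "rs_sum \<eta> (\<lambda>t. c *\<^sub>C f t) (P n) = c *\<^sub>C rs_sum \<eta> f (P n)" for n
  proof -
    have "rs_sum \<eta> (\<lambda>t. c *\<^sub>C f t) (P n)
        = (\<Sum>(x,K)\<in>P n. c *\<^sub>C blinfun_apply (\<eta> (Sup K) - \<eta> (Inf K)) (f x))"
      unfolding rs_sum_def
    proof (rule sum.cong[OF refl], clarify)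
      fix x K assume xK: "(x, K) \<in> P n"
      obtain u v where K: "K = {u..v}" using tagged_division_ofD(4)[OF Pn xK] by (auto simp: box_real)
      have "x \<in> K" "K \<subseteq> {a..b}" using tagged_division_ofD(2,3)[OF Pn xK] by auto
      then have "Sup K \<in> {a..b}" "Inf K \<in> {a..b}" using K by auto
      then show "blinfun_apply (\<eta> (Sup K) - \<eta> (Inf K)) (c *\<^sub>C f x)
          = c *\<^sub>C blinfun_apply (\<eta> (Sup K) - \<eta> (Inf K)) (f x)"
        by (simp add: blinfun.diff_left clinear_on_scaleC[OF lin] scaleC_diff_right)
    qed
    also have "\<dots> = c *\<^sub>C rs_sum \<eta> f (P n)"
      unfolding rs_sum_def case_prod_beta
      by (rule linear_sum[OF bounded_linear.linear[OF bounded_linear_scaleC], symmetric])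
    finally show ?thesis .
  qed
  have "(\<lambda>n. rs_sum \<eta> (\<lambda>t. c *\<^sub>C f t) (P n)) \<longlonglongrightarrow> c *\<^sub>C rs_integral a b \<eta> f"
    unfolding sum by (intro bounded_linear.tendsto[OF bounded_linear_scaleC] lim f)
  moreover have "continuous_on {a..b} (\<lambda>t. c *\<^sub>C f t)"
    by (intro bounded_linear.continuous_on[OF bounded_linear_scaleC] f)
  ultimately show ?thesis using LIMSEQ_unique lim by blast
qed

section \<open>Bounds up to a constant\<close>

definition dominated :: "'d set \<Rightarrow> ('d \<Rightarrow> real) \<Rightarrow> ('d \<Rightarrow> real) \<Rightarrow> bool" where
  "dominated D F N \<longleftrightarrow> (\<exists>K\<ge>0. \<forall>d\<in>D. F d \<le> K * N d)"

lemma dominatedI: "0 \<le> K \<Longrightarrow> (\<And>d. d \<in> D \<Longrightarrow> F d \<le> K * N d) \<Longrightarrow> dominated D F N"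
  unfolding dominated_def by blast

lemma dominated_trans:
  assumes "dominated U M M'" "\<And>d. d \<in> D \<Longrightarrow> \<phi> d \<in> U" "dominated D (\<lambda>d. M' (\<phi> d)) N"
  shows "dominated D (\<lambda>d. M (\<phi> d)) N"
proof -
  obtain K where K: "K \<ge> 0" "\<And>u. u \<in> U \<Longrightarrow> M u \<le> K * M' u" using assms(1) unfolding dominated_def by blast
  obtain K' where K': "K' \<ge> 0" "\<And>d. d \<in> D \<Longrightarrow> M' (\<phi> d) \<le> K' * N d"
    using assms(3) unfolding dominated_def by blast
  have "M (\<phi> d) \<le> (K * K') * N d" if "d \<in> D" for d
    using K(2)[OF assms(2)[OF that]] mult_left_mono[OF K'(2)[OF that] K(1)] by (simp add: mult.assoc)
  then show ?thesis using K(1) K'(1) by (intro dominatedI[of "K * K'"]) auto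
qed

lemma dominated_mono: "dominated D G N \<Longrightarrow> (\<And>d. d \<in> D \<Longrightarrow> F d \<le> G d) \<Longrightarrow> dominated D F N"
  unfolding dominated_def by (meson order_trans)

lemma dominated_add:
  assumes "dominated D F N" "dominated D G N"
  shows "dominated D (\<lambda>d. F d + G d) N"
proof -
  obtain K K' where "K \<ge> 0" "\<And>d. d \<in> D \<Longrightarrow> F d \<le> K * N d" "K' \<ge> 0" "\<And>d. d \<in> D \<Longrightarrow> G d \<le> K' * N d"
    using assms unfolding dominated_def by blast
  then show ?thesis by (intro dominatedI[of "K + K'"]) (auto simp: distrib_right intro: add_mono)
qed

lemma dominated_mult: "0 \<le> C \<Longrightarrow> dominated D F N \<Longrightarrow> dominated D (\<lambda>d. C * F d) N"
  using dominated_trans[of UNIV "\<lambda>x. C * x" "\<lambda>x. x" D F N] dominatedI[of C UNIV "\<lambda>x. C * x" "\<lambda>x. x"] by simp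

section \<open>Resolvents of linear maps on a carrier\<close>

lemma resolvent_eqI:
  assumes "inj_on (\<lambda>x. \<mu> *\<^sub>C x - T x) D" "x \<in> D" "\<mu> *\<^sub>C x - T x = y"
  shows "resolvent D T \<mu> y = x"
  unfolding resolvent_def using assms by (intro the_inv_into_f_eq) auto

lemma resolvent_solves:
  assumes "bij_betw (\<lambda>x. \<mu> *\<^sub>C x - T x) D R" "y \<in> R"
  shows "resolvent D T \<mu> y \<in> D" "\<mu> *\<^sub>C resolvent D T \<mu> y - T (resolvent D T \<mu> y) = y"
proof -
  obtain x where x: "x \<in> D" "\<mu> *\<^sub>C x - T x = y" using assms by (auto simp: bij_betw_def)
  have "resolvent D T \<mu> y = x" by (rule resolvent_eqI[OF bij_betw_imp_inj_on[OF assms(1)] x])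
  then show "resolvent D T \<mu> y \<in> D" "\<mu> *\<^sub>C resolvent D T \<mu> y - T (resolvent D T \<mu> y) = y"
    using x by auto
qed

lemma resolvent_add:
  assumes D: "csubspace D" "clinear_on D T" and bij: "bij_betw (\<lambda>x. \<mu> *\<^sub>C x - T x) D R"
    and y: "y \<in> R" "y' \<in> R"
  shows "resolvent D T \<mu> (y + y') = resolvent D T \<mu> y + resolvent D T \<mu> y'"
proof (rule resolvent_eqI[OF bij_betw_imp_inj_on[OF bij]])
  note r = resolvent_solves[OF bij y(1)] and r' = resolvent_solves[OF bij y(2)]
  show "resolvent D T \<mu> y + resolvent D T \<mu> y' \<in> D" using D(1) r(1) r'(1) by (simp add: csubspace_def)
  have "\<mu> *\<^sub>C (resolvent D T \<mu> y + resolvent D T \<mu> y') - T (resolvent D T \<mu> y + resolvent D T \<mu> y')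
      = (\<mu> *\<^sub>C resolvent D T \<mu> y - T (resolvent D T \<mu> y))
        + (\<mu> *\<^sub>C resolvent D T \<mu> y' - T (resolvent D T \<mu> y'))"
    using clinear_on_add[OF D(2) r(1) r'(1)] by (simp add: scaleC_add_right)
  then show "\<mu> *\<^sub>C (resolvent D T \<mu> y + resolvent D T \<mu> y') - T (resolvent D T \<mu> y + resolvent D T \<mu> y')
      = y + y'" using r(2) r'(2) by simp
qed

lemma resolvent_scaleC:
  assumes D: "csubspace D" "clinear_on D T" and bij: "bij_betw (\<lambda>x. \<mu> *\<^sub>C x - T x) D R" and y: "y \<in> R"
  shows "resolvent D T \<mu> (c *\<^sub>C y) = c *\<^sub>C resolvent D T \<mu> y"
proof (rule resolvent_eqI[OF bij_betw_imp_inj_on[OF bij]])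
  note r = resolvent_solves[OF bij y]
  show "c *\<^sub>C resolvent D T \<mu> y \<in> D" using D(1) r(1) by (simp add: csubspace_def)
  have "\<mu> *\<^sub>C c *\<^sub>C resolvent D T \<mu> y - T (c *\<^sub>C resolvent D T \<mu> y)
      = c *\<^sub>C (\<mu> *\<^sub>C resolvent D T \<mu> y - T (resolvent D T \<mu> y))"
    using clinear_on_scaleC[OF D(2) r(1)] by (simp add: scaleC_diff_right scaleC_scaleC mult.commute)
  then show "\<mu> *\<^sub>C c *\<^sub>C resolvent D T \<mu> y - T (c *\<^sub>C resolvent D T \<mu> y) = c *\<^sub>C y" using r(2) by simp
qed

lemma resolvent_set_iff:
  "\<mu> \<in> resolvent_set R N D T \<longleftrightarrow>
    bij_betw (\<lambda>x. \<mu> *\<^sub>C x - T x) D R \<and> (\<exists>K. \<forall>x\<in>D. N x \<le> K * N (\<mu> *\<^sub>C x - T x))"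
  by (simp add: resolvent_set_def)

lemma csubspace_zero: "csubspace A \<Longrightarrow> 0 \<in> A"
  and csubspace_add: "csubspace A \<Longrightarrow> x \<in> A \<Longrightarrow> y \<in> A \<Longrightarrow> x + y \<in> A"
  and csubspace_scaleC: "csubspace A \<Longrightarrow> x \<in> A \<Longrightarrow> c *\<^sub>C x \<in> A"
  by (auto simp: csubspace_def)

lemma clinear_on_zero: "csubspace A \<Longrightarrow> clinear_on A f \<Longrightarrow> f 0 = 0"
  by (metis clinear_on_scaleC csubspace_zero scaleC_zero_left)

lemma csubspace_UNIV: "csubspace UNIV" by (simp add: csubspace_def)

section \<open>The neutral delay system\<close>

text \<open>
  The conditions on \<open>M D\<^sub>\<mu>\<close> and \<open>D e\<^sub>\<mu>\<close> make \<open>R(\<mu>, A\<^sub>G\<^sub>,\<^sub>M)\<close>, \<open>R(\<mu>, Q\<^sub>D)\<close> and with them \<open>\<Delta>(\<mu>)\<close>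
  bounded operators.
\<close>

locale delay_setting =
  fixes S :: "('x::complex_banach, 'b::complex_banach, 'u::complex_banach) delay_system"
    and \<mu> :: complex
  assumes standing: "standing_assumptions S"
    and surj: "op_G S ` dom_m S = UNIV"
    and mu: "\<mu> \<in> rho_A S"
    and MD1: "1 \<in> rho_MD S \<mu>"
    and De1: "1 \<in> rho_De S \<mu>"
begin

lemma sub_m: "csubspace (dom_m S)" and lin_m: "clinear_on (dom_m S) (op_m S)"
  and lin_G: "clinear_on (dom_m S) (op_G S)" and lin_M: "clinear_on (dom_m S) (op_M S)"
  and closed_m: "closed {(z, op_m S z) | z. z \<in> dom_m S}"
  using standing by (auto simp: standing_assumptions_def)

lemma kernels: "delay_kernel (lag S) (ker_D S)" "delay_kernel (lag S) (ker_L S)"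
  "delay_kernel (lag S) (ker_B1 S)" "delay_kernel (lag S) (ker_K1 S)"
  using standing by (auto simp: standing_assumptions_def)

sublocale sobolev_interval "expo S" "- lag S" 0
  by standard (use standing in \<open>auto simp: standing_assumptions_def\<close>)

abbreviation W :: "'e::complex_banach aefun set" where "W \<equiv> WpE S"
abbreviation normW :: "'e::complex_banach aefun \<Rightarrow> real" where "normW \<equiv> WpE_norm S"
abbreviation normL :: "'e::complex_banach aefun \<Rightarrow> real" where "normL \<equiv> Lp_norm (expo S)"
abbreviation R :: "'x \<Rightarrow> 'x" where "R \<equiv> R_GM S \<mu>"
abbreviation lift :: "'x \<Rightarrow> 'x aefun" where "lift \<equiv> lift_mu S \<mu>"
abbreviation \<T> :: "'x \<times> 'x aefun \<times> 'u aefun \<Rightarrow> 'x \<times> 'x aefun \<times> 'u aefun" where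
  "\<T> \<equiv> \<lambda>w. \<mu> *\<^sub>C w - frakA S w"
abbreviation \<Delta> :: "'x aefun \<Rightarrow> 'x aefun" where "\<Delta> \<equiv> Delta S \<mu>"

subsection \<open>The boundary operators\<close>

lemma bij_A: "bij_betw (\<lambda>x. \<mu> *\<^sub>C x - op_m S x) (dom_A S) UNIV"
  using mu by (simp add: resolvent_set_iff)

lemma kernel_A: "z \<in> dom_m S \<Longrightarrow> op_G S z = 0 \<Longrightarrow> \<mu> *\<^sub>C z - op_m S z = 0 \<Longrightarrow> z = 0"
proof -
  assume "z \<in> dom_m S" "op_G S z = 0" "\<mu> *\<^sub>C z - op_m S z = 0"
  moreover have "0 \<in> dom_A S"
    using csubspace_zero[OF sub_m] clinear_on_zero[OF sub_m lin_G] by (simp add: dom_A_def)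
  ultimately show "z = 0"
    using bij_betw_imp_inj_on[OF bij_A] clinear_on_zero[OF sub_m lin_m]
    by (auto simp: inj_on_def dom_A_def)
qed

abbreviation "ker_m \<equiv> {z \<in> dom_m S. \<mu> *\<^sub>C z - op_m S z = 0}"

lemma mu_minus_m_diff:
  assumes "x \<in> dom_m S" "y \<in> dom_m S"
  shows "\<mu> *\<^sub>C (x - y) - op_m S (x - y) = (\<mu> *\<^sub>C x - op_m S x) - (\<mu> *\<^sub>C y - op_m S y)"
  using clinear_on_diff[OF sub_m lin_m assms] by (simp add: scaleC_diff_right)

lemma G_inj: "inj_on (op_G S) ker_m"
proof (rule inj_onI)
  fix z z' assume z: "z \<in> ker_m" "z' \<in> ker_m" "op_G S z = op_G S z'"
  then have zm: "z \<in> dom_m S" "z' \<in> dom_m S" by auto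
  have "z - z' = 0"
  proof (rule kernel_A)
    show "z - z' \<in> dom_m S" by (rule csubspace_diff[OF sub_m zm])
    show "op_G S (z - z') = 0" using clinear_on_diff[OF sub_m lin_G zm] z(3) by simp
    show "\<mu> *\<^sub>C (z - z') - op_m S (z - z') = 0" using mu_minus_m_diff[OF zm] z(1,2) by simp
  qed
  then show "z = z'" by simp
qed

lemma dirichlet_G: "z \<in> ker_m \<Longrightarrow> dirichlet S \<mu> (op_G S z) = z"
  unfolding dirichlet_def by (rule the_inv_into_f_f[OF G_inj])

lemma dirichlet: "dirichlet S \<mu> v \<in> ker_m" "op_G S (dirichlet S \<mu> v) = v"
proof -
  obtain z where z: "z \<in> dom_m S" "op_G S z = v" using surj by (metis UNIV_I imageE)
  obtain w where w: "w \<in> dom_A S" "\<mu> *\<^sub>C w - op_m S w = \<mu> *\<^sub>C z - op_m S z"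
    using resolvent_solves[OF bij_A] by blast
  have wm: "w \<in> dom_m S" "op_G S w = 0" using w by (auto simp: dom_A_def)
  have "z - w \<in> ker_m" using csubspace_diff[OF sub_m z(1) wm(1)] mu_minus_m_diff[OF z(1) wm(1)] w(2) by simp
  moreover have "op_G S (z - w) = v" using clinear_on_diff[OF sub_m lin_G z(1) wm(1)] z wm by simp
  ultimately show "dirichlet S \<mu> v \<in> ker_m" "op_G S (dirichlet S \<mu> v) = v"
    using dirichlet_G[of "z - w"] by auto
qed

lemma csubspace_GM: "csubspace (dom_GM S)"
  unfolding csubspace_def dom_GM_def
  using csubspace_zero[OF sub_m] csubspace_add[OF sub_m] csubspace_scaleC[OF sub_m]
    clinear_on_zero[OF sub_m lin_G] clinear_on_zero[OF sub_m lin_M]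
    clinear_on_add[OF lin_G] clinear_on_add[OF lin_M] clinear_on_scaleC[OF lin_G] clinear_on_scaleC[OF lin_M]
  by auto

lemma clinear_on_GM: "clinear_on (dom_GM S) (op_m S)"
  using lin_m by (auto simp: clinear_on_def dom_GM_def)

text \<open>
  A preimage of \<open>f\<close> is sought as \<open>w + D\<^sub>\<mu> v\<close> with \<open>w\<close> the preimage of \<open>f\<close> under \<open>\<mu> - A\<close>; the
  boundary condition then reads \<open>v - M D\<^sub>\<mu> v = M w\<close>.
\<close>

lemma bij_GM: "bij_betw (\<lambda>x. \<mu> *\<^sub>C x - op_m S x) (dom_GM S) UNIV"
  unfolding bij_betw_def
proof
  have bijMD: "bij_betw (\<lambda>v. 1 *\<^sub>C v - MD S \<mu> v) UNIV UNIV" using MD1 by (simp add: resolvent_set_iff)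
  have MD0: "MD S \<mu> 0 = 0"
    using dirichlet_G[of 0] csubspace_zero[OF sub_m] clinear_on_zero[OF sub_m lin_G]
      clinear_on_zero[OF sub_m lin_m] clinear_on_zero[OF sub_m lin_M] by (simp add: MD_def)
  show "inj_on (\<lambda>x. \<mu> *\<^sub>C x - op_m S x) (dom_GM S)"
  proof (rule inj_onI)
    fix x y assume xy: "x \<in> dom_GM S" "y \<in> dom_GM S" "\<mu> *\<^sub>C x - op_m S x = \<mu> *\<^sub>C y - op_m S y"
    let ?d = "x - y"
    have d: "?d \<in> dom_GM S" by (rule csubspace_diff[OF csubspace_GM xy(1,2)])
    then have k: "?d \<in> ker_m" using mu_minus_m_diff[of x y] xy by (simp add: dom_GM_def)
    have MDd: "MD S \<mu> (op_G S ?d) = op_M S ?d" unfolding MD_def dirichlet_G[OF k] ..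
    have "1 *\<^sub>C op_G S ?d - MD S \<mu> (op_G S ?d) = 1 *\<^sub>C 0 - MD S \<mu> 0"
      unfolding MDd using d MD0 by (simp add: dom_GM_def)
    then have "op_G S ?d = 0" using bij_betw_imp_inj_on[OF bijMD] unfolding inj_on_def by blast
    with k have "?d = 0" by (auto dest: kernel_A)
    then show "x = y" by simp
  qed
  have "f \<in> (\<lambda>x. \<mu> *\<^sub>C x - op_m S x) ` dom_GM S" for f
  proof -
    obtain w where w: "w \<in> dom_m S" "op_G S w = 0" "\<mu> *\<^sub>C w - op_m S w = f"
      using resolvent_solves[OF bij_A, of f] by (auto simp: dom_A_def)
    obtain v where v: "v - MD S \<mu> v = op_M S w"
      using resolvent_solves(2)[OF bijMD, of "op_M S w"] by auto
    have dv: "dirichlet S \<mu> v \<in> dom_m S" "\<mu> *\<^sub>C dirichlet S \<mu> v - op_m S (dirichlet S \<mu> v) = 0"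
      using dirichlet(1)[of v] by auto
    let ?x = "w + dirichlet S \<mu> v"
    have "op_M S ?x = v"
      using clinear_on_add[OF lin_M w(1) dv(1)] v by (simp add: MD_def algebra_simps)
    then have "?x \<in> dom_GM S"
      using clinear_on_add[OF lin_G w(1) dv(1)] csubspace_add[OF sub_m w(1) dv(1)] w(2) dirichlet(2)
      by (simp add: dom_GM_def)
    moreover have "\<mu> *\<^sub>C ?x - op_m S ?x = f"
      using clinear_on_add[OF lin_m w(1) dv(1)] w(3) dv(2) by (simp add: scaleC_add_right algebra_simps)
    ultimately show ?thesis by blast
  qed
  then show "(\<lambda>x. \<mu> *\<^sub>C x - op_m S x) ` dom_GM S = UNIV" by blast
qed

lemma R_GM: "R y \<in> dom_GM S" "\<mu> *\<^sub>C R y - op_m S (R y) = y"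
  unfolding R_GM_def using resolvent_solves[OF bij_GM] by auto

lemma R_GM_eqI: "x \<in> dom_GM S \<Longrightarrow> \<mu> *\<^sub>C x - op_m S x = y \<Longrightarrow> R y = x"
  unfolding R_GM_def by (rule resolvent_eqI[OF bij_betw_imp_inj_on[OF bij_GM]])

lemma R_GM_add: "R (x + y) = R x + R y"
  unfolding R_GM_def by (intro resolvent_add[OF csubspace_GM clinear_on_GM bij_GM]) auto

lemma R_GM_scaleC: "R (c *\<^sub>C x) = c *\<^sub>C R x"
  unfolding R_GM_def by (intro resolvent_scaleC[OF csubspace_GM clinear_on_GM bij_GM]) auto

lemma graph_bounded_tendsto:
  assumes F: "clinear_on (dom_m S) F" "\<And>z. z \<in> dom_m S \<Longrightarrow> norm (F z) \<le> K * (norm z + norm (op_m S z))"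
    and z: "\<And>n. z n \<in> dom_m S" "y \<in> dom_m S" "z \<longlonglongrightarrow> y" "(\<lambda>n. op_m S (z n)) \<longlonglongrightarrow> op_m S y"
  shows "(\<lambda>n. F (z n)) \<longlonglongrightarrow> F y"
proof -
  have "(\<lambda>n. norm (z n - y) + norm (op_m S (z n) - op_m S y)) \<longlonglongrightarrow> norm (y - y) + norm (op_m S y - op_m S y)"
    by (intro tendsto_intros z)
  then have lim: "(\<lambda>n. K * (norm (z n - y) + norm (op_m S (z n) - op_m S y))) \<longlonglongrightarrow> 0"
    by (intro tendsto_mult_right_zero) simp
  have le: "norm (F (z n) - F y) \<le> K * (norm (z n - y) + norm (op_m S (z n) - op_m S y))" for n
    using F(2)[OF csubspace_diff[OF sub_m z(1,2)]] clinear_on_diff[OF sub_m F(1) z(1,2)]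
      clinear_on_diff[OF sub_m lin_m z(1,2)] by simp
  have "(\<lambda>n. F (z n) - F y) \<longlonglongrightarrow> 0"
    by (rule Lim_null_comparison[OF always_eventually lim]) (rule allI, rule le)
  then show ?thesis by (simp add: LIM_zero_iff)
qed

text \<open>
  \<open>A\<^sub>m\<close> is closed and \<open>G\<close>, \<open>M\<close> are continuous along convergence in its graph norm, so the everywhere
  defined inverse has a closed graph.
\<close>

lemma R_GM_bounded: "dominated UNIV (\<lambda>y. norm (R y)) norm"
proof -
  obtain KG KM where KG: "\<And>z. z \<in> dom_m S \<Longrightarrow> norm (op_G S z) \<le> KG * (norm z + norm (op_m S z))"
    and KM: "\<And>z. z \<in> dom_m S \<Longrightarrow> norm (op_M S z) \<le> KM * (norm z + norm (op_m S z))"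
    using standing unfolding standing_assumptions_def by blast
  have "bounded_linear (R)"
  proof (rule closed_graph_theorem)
    show "linear (R)"
      by (intro clinear_on_UNIV_linear) (simp add: clinear_on_def R_GM_add R_GM_scaleC)
    fix s x y assume s: "s \<longlonglongrightarrow> x" and Rs: "(\<lambda>n. R (s n)) \<longlonglongrightarrow> y"
    define z where "z n = R (s n)" for n
    have zGM: "z n \<in> dom_GM S" and zs: "\<mu> *\<^sub>C z n - op_m S (z n) = s n" for n
      using R_GM[of "s n"] by (auto simp: z_def)
    then have zm: "z n \<in> dom_m S" "op_G S (z n) = op_M S (z n)" for n by (auto simp: dom_GM_def)
    have zy: "z \<longlonglongrightarrow> y" using Rs by (simp add: z_def[abs_def])
    have opz: "op_m S (z n) = \<mu> *\<^sub>C z n - s n" for n using zs[of n] by (simp add: algebra_simps)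
    have "(\<lambda>n. op_m S (z n)) \<longlonglongrightarrow> \<mu> *\<^sub>C y - x"
      unfolding opz by (intro tendsto_diff s bounded_linear.tendsto[OF bounded_linear_scaleC] zy)
    moreover from this have "(\<lambda>n. (z n, op_m S (z n))) \<longlonglongrightarrow> (y, \<mu> *\<^sub>C y - x)"
      by (intro tendsto_Pair zy)
    then have "(y, \<mu> *\<^sub>C y - x) \<in> {(z, op_m S z) | z. z \<in> dom_m S}"
      by (rule closed_sequentially[OF closed_m, rotated]) (use zm in auto)
    then have y: "y \<in> dom_m S" "op_m S y = \<mu> *\<^sub>C y - x" by auto
    ultimately have "(\<lambda>n. op_m S (z n)) \<longlonglongrightarrow> op_m S y" by simp
    from graph_bounded_tendsto[OF lin_G KG zm(1) y(1) zy this]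
      graph_bounded_tendsto[OF lin_M KM zm(1) y(1) zy this]
    have "op_G S y = op_M S y" unfolding zm(2) by (rule LIMSEQ_unique)
    then show "R x = y" using y by (intro R_GM_eqI) (auto simp: dom_GM_def)
  qed
  then show ?thesis unfolding dominated_def using bounded_linear.nonneg_bounded by (metis mult.commute)
qed

lemma mu_rho_GM: "\<mu> \<in> rho_GM S"
proof -
  obtain K where K: "\<And>y. norm (R y) \<le> K * norm y" using R_GM_bounded unfolding dominated_def by blast
  have "norm x \<le> K * norm (\<mu> *\<^sub>C x - op_m S x)" if "x \<in> dom_GM S" for x
    using K[of "\<mu> *\<^sub>C x - op_m S x"] R_GM_eqI[OF that refl] by simp
  then show ?thesis unfolding resolvent_set_iff using bij_GM by blast
qed

subsection \<open>The delay operators\<close>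

lemma at0_add: "u \<in> W \<Longrightarrow> v \<in> W \<Longrightarrow> at0 S (u + v) = at0 S u + at0 S v"
  and at0_scaleC: "u \<in> W \<Longrightarrow> at0 S (c *\<^sub>C u) = c *\<^sub>C at0 S u"
  and Qm_add: "u \<in> W \<Longrightarrow> v \<in> W \<Longrightarrow> Qm S (u + v) = Qm S u + Qm S v"
  and Qm_scaleC: "u \<in> W \<Longrightarrow> Qm S (c *\<^sub>C u) = c *\<^sub>C Qm S u"
  for u v :: "'e::complex_banach aefun"
  by (simp_all add: at0_def Qm_def W1p_cont_rep_add W1p_cont_rep_scaleC
      W1p_weak_deriv_add W1p_weak_deriv_scaleC)

lemma delay_op_clinear:
  fixes \<eta> :: "real \<Rightarrow> 'e::complex_banach \<Rightarrow>\<^sub>L 'x"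
  assumes "delay_kernel (lag S) \<eta>"
  shows "clinear_on (W) (delay_op S \<eta>)"
proof -
  have V: "total_variation (- lag S) 0 \<eta> < \<infinity>"
    and lin: "\<And>t. t \<in> {- lag S..0} \<Longrightarrow> clinear_on UNIV (blinfun_apply (\<eta> t))"
    using assms by (auto simp: delay_kernel_def)
  note c = triple_continuous[OF W1p_triple]
  show ?thesis
    unfolding clinear_on_def delay_op_def
  proof (intro conjI allI ballI)
    fix u v :: "'e aefun" and c' assume u: "u \<in> W"
    show "rs_integral (- lag S) 0 \<eta> (crep (c' *\<^sub>C u))
        = c' *\<^sub>C rs_integral (- lag S) 0 \<eta> (crep u)"
      unfolding W1p_cont_rep_scaleC[OF u] by (rule rs_integral_scaleC[OF c[OF u] V]) (rule lin)
    assume v: "v \<in> W"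
    show "rs_integral (- lag S) 0 \<eta> (crep (u + v))
        = rs_integral (- lag S) 0 \<eta> (crep u)
          + rs_integral (- lag S) 0 \<eta> (crep v)"
      unfolding W1p_cont_rep_add[OF u v] by (rule rs_integral_add[OF c[OF u] c[OF v] V])
  qed
qed

lemma delay_op_bounded:
  fixes \<eta> :: "real \<Rightarrow> 'e::complex_banach \<Rightarrow>\<^sub>L 'x"
  assumes "delay_kernel (lag S) \<eta>"
  shows "dominated W (\<lambda>u. norm (delay_op S \<eta> u)) normW"
proof (rule dominatedI[of "variation (- lag S) 0 \<eta> * sup_const"])
  have sup_pos: "sup_const \<ge> 0" using ab by (simp add: sup_const_def)
  then show "0 \<le> variation (- lag S) 0 \<eta> * sup_const" by simp
  fix u :: "'e aefun" assume u: "u \<in> W"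
  have "norm (delay_op S \<eta> u) \<le> variation (- lag S) 0 \<eta> * (sup_const * normW u)"
    unfolding delay_op_def
    using assms sup_pos cont_rep_bound[OF u]
    by (intro rs_integral_bound triple_continuous[OF W1p_triple[OF u]]) (auto simp: delay_kernel_def)
  then show "norm (delay_op S \<eta> u) \<le> variation (- lag S) 0 \<eta> * sup_const * normW u"
    by (simp add: mult.assoc)
qed

lemma delay_op_add:
  "delay_kernel (lag S) \<eta> \<Longrightarrow> u \<in> W \<Longrightarrow> v \<in> W \<Longrightarrow> delay_op S \<eta> (u + v) = delay_op S \<eta> u + delay_op S \<eta> v"
  by (rule clinear_on_add[OF delay_op_clinear])

subsection \<open>The shift operators\<close>

lemma e_mu_class: "e_mu S \<mu> z = ae_class (exp_fun \<mu> z)"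
  by (simp add: e_mu_def exp_fun_def[abs_def])

lemma triple_e_mu: "triple (e_mu S \<mu> z) (exp_fun \<mu> z) (\<mu> *\<^sub>C e_mu S \<mu> z)"
  unfolding e_mu_class by (rule triple_exp_fun)

lemma e_mu_W: "e_mu S \<mu> z \<in> W"
  by (rule triple_W1p[OF triple_e_mu])

lemma Qm_e_mu: "Qm S (e_mu S \<mu> z) = \<mu> *\<^sub>C e_mu S \<mu> z"
  unfolding Qm_def by (rule weak_deriv_eq[OF triple_e_mu])

lemma at0_e_mu: "at0 S (e_mu S \<mu> z) = z"
  unfolding at0_def cont_rep_eq[OF triple_e_mu] using ab by (simp add: exp_fun_def)

lemma e_mu_add: "e_mu S \<mu> (x + y) = e_mu S \<mu> x + e_mu S \<mu> y"
  and e_mu_scaleC: "e_mu S \<mu> (c *\<^sub>C x) = c *\<^sub>C e_mu S \<mu> x"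
  unfolding e_mu_class ae_class_add ae_class_scaleC
  by (auto simp: exp_fun_def[abs_def] scaleC_add_right scaleC_scaleC mult.commute intro!: arg_cong[where f = ae_class])

lemma e_mu_bounded: "dominated UNIV (\<lambda>z :: 'e::complex_banach. normW (e_mu S \<mu> z)) norm"
proof -
  let ?K = "(1 + 2 * cmod \<mu>) * (1 + (0 - - lag S)) * exp_const \<mu>"
  have "normW (e_mu S \<mu> z) \<le> ?K * norm z" for z :: 'e
  proof -
    have z0: "(0 :: 'e aefun) \<in> LpE S" "normL (0 :: 'e aefun) \<le> 0"
      unfolding ae_class_zero
      using Lp_continuous[of "expo S" "- lag S" 0 "\<lambda>_. 0 :: 'e" 0] p ab by auto
    have "normW (e_mu S \<mu> z) \<le> (1 + 2 * cmod \<mu>) * (1 + (0 - - lag S)) * (exp_const \<mu> * norm z)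
        + 2 * normL (0 :: 'e aefun)"
    proof (rule W1p_norm_bound_of_sup[OF e_mu_W z0(1)])
      show "\<mu> *\<^sub>C e_mu S \<mu> z - wderiv (e_mu S \<mu> z) = 0"
        using Qm_e_mu[of z] by (simp add: Qm_def)
      show "norm (crep (e_mu S \<mu> z) t) \<le> exp_const \<mu> * norm z"
        if "t \<in> {- lag S..0}" for t
        unfolding cont_rep_eq[OF triple_e_mu] using that exp_const_bound(1)[OF that, of \<mu>]
        by (simp add: exp_fun_def norm_scaleC mult_right_mono)
    qed
    then show ?thesis using z0(2) by (simp add: mult.assoc)
  qed
  moreover have "?K \<ge> 0" using ab exp_const_pos[of \<mu>] by simp
  ultimately show ?thesis by (intro dominatedI[of ?K])
qed

lemma homogeneous_e_mu:
  assumes "u \<in> W" "\<mu> *\<^sub>C u - Qm S u = 0"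
  shows "u = e_mu S \<mu> (at0 S u)"
  using homogeneous_equation_unique[OF assms(1), of \<mu>] assms(2)
  by (simp add: Qm_def at0_def e_mu_class)

abbreviation R0 :: "'e::complex_banach aefun \<Rightarrow> 'e aefun" where
  "R0 \<equiv> resolvent {\<xi> \<in> W. at0 S \<xi> = 0} (Qm S) \<mu>"

lemma mu_minus_Qm_diff:
  fixes u v :: "'e::complex_banach aefun"
  assumes "u \<in> W" "v \<in> W"
  shows "\<mu> *\<^sub>C (u - v) - Qm S (u - v) = (\<mu> *\<^sub>C u - Qm S u) - (\<mu> *\<^sub>C v - Qm S v)"
    "at0 S (u - v) = at0 S u - at0 S v" "u - v \<in> W"
proof -
  have uv: "u - v = u + (- 1) *\<^sub>C v" by (simp add: scaleC_minus_one)
  have v': "(- 1) *\<^sub>C v \<in> W" by (rule csubspace_scaleC[OF csubspace_W1p assms(2)])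
  show "u - v \<in> W" unfolding uv by (rule csubspace_add[OF csubspace_W1p assms(1) v'])
  show "at0 S (u - v) = at0 S u - at0 S v"
    unfolding uv at0_add[OF assms(1) v'] at0_scaleC[OF assms(2)] by (simp add: scaleC_minus_one)
  show "\<mu> *\<^sub>C (u - v) - Qm S (u - v) = (\<mu> *\<^sub>C u - Qm S u) - (\<mu> *\<^sub>C v - Qm S v)"
    unfolding uv Qm_add[OF assms(1) v'] Qm_scaleC[OF assms(2)] by (simp add: scaleC_minus_one scaleC_diff_right)
qed

lemma e_mu_zero: "e_mu S \<mu> 0 = 0"
  using e_mu_scaleC[of 0 0] by simp

lemma shift_unique:
  fixes u v :: "'e::complex_banach aefun"
  assumes "u \<in> W" "v \<in> W" "\<mu> *\<^sub>C u - Qm S u = \<mu> *\<^sub>C v - Qm S v" "at0 S u = at0 S v"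
  shows "u = v"
  using homogeneous_e_mu[of "u - v"] mu_minus_Qm_diff[OF assms(1,2)] assms(3,4) by (simp add: e_mu_zero)

definition "R0_const = (1 + 2 * cmod \<mu>) * (1 + (0 - - lag S)) *
    (exp_const \<mu> * (exp_const \<mu> * (1 + (0 - - lag S)))) + 2"

lemma R0_const_nonneg: "R0_const \<ge> 0"
  using ab exp_const_pos[of \<mu>] by (simp add: R0_const_def)

lemma R0:
  fixes g :: "'e::complex_banach aefun"
  assumes g: "g \<in> LpE S"
  shows "R0 g \<in> W" "at0 S (R0 g) = 0" "\<mu> *\<^sub>C R0 g - Qm S (R0 g) = g"
    "normW (R0 g) \<le> R0_const * normL g"
proof -
  obtain u where u: "u \<in> W" "\<mu> *\<^sub>C u - Qm S u = g" "at0 S u = 0"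
    and b: "\<And>t. t \<in> {- lag S..0} \<Longrightarrow> norm (crep u t)
      \<le> exp_const \<mu> * (exp_const \<mu> * ((1 + (0 - - lag S)) * normL g))"
    using shift_equation_exists[OF g, of \<mu>] unfolding Qm_def at0_def by blast
  have "inj_on (\<lambda>\<xi>. \<mu> *\<^sub>C \<xi> - Qm S \<xi>) {\<xi> \<in> W. at0 S \<xi> = (0 :: 'e)}"
    by (rule inj_onI, rule shift_unique) simp_all
  then have eq: "R0 g = u" using u by (intro resolvent_eqI) auto
  show "R0 g \<in> W" "at0 S (R0 g) = 0" "\<mu> *\<^sub>C R0 g - Qm S (R0 g) = g" using u eq by auto
  show "normW (R0 g) \<le> R0_const * normL g"
    unfolding eq R0_const_def using W1p_norm_bound_of_sup[OF u(1) g _ b, of \<mu>] u(2)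
    by (simp add: Qm_def distrib_right mult.assoc)
qed

subsection \<open>The neutral boundary condition\<close>

lemma opD_add: "u \<in> W \<Longrightarrow> v \<in> W \<Longrightarrow> opD S (u + v) = opD S u + opD S v"
  by (rule delay_op_add[OF kernels(1)])

lemma De_clinear: "clinear_on UNIV (De S \<mu>)"
  unfolding clinear_on_def De_def
  by (simp add: e_mu_add e_mu_scaleC e_mu_W opD_add clinear_on_scaleC[OF delay_op_clinear[OF kernels(1)]])

lemma bij_De: "bij_betw (\<lambda>z. 1 *\<^sub>C z - De S \<mu> z) UNIV UNIV"
  using De1 by (simp add: resolvent_set_iff)

abbreviation "J \<equiv> resolvent UNIV (De S \<mu>) 1"

lemma J_solves: "J y - De S \<mu> (J y) = y"
  using resolvent_solves(2)[OF bij_De, of y] by simp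

lemma J_eqI: "z - De S \<mu> z = y \<Longrightarrow> J y = z"
  by (intro resolvent_eqI[OF bij_betw_imp_inj_on[OF bij_De]]) auto

lemma J_bounded: "dominated UNIV (\<lambda>y. norm (J y)) norm"
proof -
  obtain K where K: "\<And>z. norm z \<le> K * norm (1 *\<^sub>C z - De S \<mu> z)"
    using De1 unfolding resolvent_set_iff by blast
  have "norm (J y) \<le> max 0 K * norm y" for y
    using K[of "J y"] J_solves[of y] mult_right_mono[of K "max 0 K" "norm y"] by simp
  then show ?thesis by (intro dominatedI[of "max 0 K"]) auto
qed

lemma lift_mu_add: "lift (x + y) = lift x + lift y"
  unfolding lift_mu_def
  by (simp add: resolvent_add[OF csubspace_UNIV De_clinear bij_De] e_mu_add)

lemma lift_mu_scaleC: "lift (c *\<^sub>C x) = c *\<^sub>C lift x"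
  unfolding lift_mu_def
  by (simp add: resolvent_scaleC[OF csubspace_UNIV De_clinear bij_De] e_mu_scaleC)

lemma lift_mu_W: "lift y \<in> W"
  unfolding lift_mu_def by (rule e_mu_W)

text \<open>
  \<open>e\<^sub>\<mu> (I - D e\<^sub>\<mu>)\<^sup>-\<^sup>1 y\<close> is the homogeneous solution with the defect \<open>y\<close> in the neutral boundary
  condition.
\<close>

lemma lift_mu_solves:
  "\<mu> *\<^sub>C lift y - Qm S (lift y) = 0" "at0 S (lift y) = y + opD S (lift y)"
  using J_solves[of y] by (auto simp: lift_mu_def Qm_e_mu at0_e_mu De_def algebra_simps)

lemma lift_mu_bounded: "dominated UNIV (\<lambda>y. normW (lift y)) norm"
  unfolding lift_mu_def by (rule dominated_trans[OF e_mu_bounded _ J_bounded]) simp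

lemma neutral_unique:
  assumes "u \<in> W" "v \<in> W" "\<mu> *\<^sub>C u - Qm S u = \<mu> *\<^sub>C v - Qm S v"
    and "at0 S u = y + opD S u" "at0 S v = y + opD S v"
  shows "u = v"
proof -
  let ?d = "u - v"
  have d: "?d \<in> W" "\<mu> *\<^sub>C ?d - Qm S ?d = 0" "at0 S ?d = opD S ?d"
    using mu_minus_Qm_diff[OF assms(1,2)] assms(3-5)
      clinear_on_diff[OF csubspace_W1p delay_op_clinear[OF kernels(1)] assms(1,2)] by auto
  have "?d = e_mu S \<mu> (at0 S ?d)" by (rule homogeneous_e_mu[OF d(1,2)])
  then have "at0 S ?d - De S \<mu> (at0 S ?d) = 0" using d(3) by (simp add: De_def)
  moreover have "De S \<mu> 0 = 0" by (rule clinear_on_zero[OF csubspace_UNIV De_clinear])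
  ultimately have "at0 S ?d = 0" using J_eqI[of "at0 S ?d" 0] J_eqI[of 0 0] by simp
  then have "?d = 0" using \<open>?d = e_mu S \<mu> (at0 S ?d)\<close> by (simp add: e_mu_zero)
  then show "u = v" by simp
qed

lemma neutral_exists:
  assumes g: "g \<in> LpE S"
  defines "\<phi> \<equiv> R0 g + lift (opD S (R0 g))"
  shows "\<phi> \<in> W" "\<mu> *\<^sub>C \<phi> - Qm S \<phi> = g" "at0 S \<phi> = opD S \<phi>"
proof -
  note r = R0[OF g]
  show "\<phi> \<in> W" unfolding \<phi>_def by (rule csubspace_add[OF csubspace_W1p r(1) lift_mu_W])
  show "\<mu> *\<^sub>C \<phi> - Qm S \<phi> = g"
    using r(3) lift_mu_solves(1)[of "opD S (R0 g)"]
    by (simp add: \<phi>_def Qm_add[OF r(1) lift_mu_W] scaleC_add_right algebra_simps)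
  show "at0 S \<phi> = opD S \<phi>"
    unfolding \<phi>_def at0_add[OF r(1) lift_mu_W] opD_add[OF r(1) lift_mu_W]
    using r(2) lift_mu_solves(2)[of "opD S (R0 g)"] by simp
qed

text \<open>Solve with value zero at \<open>0\<close> first; the defect in the boundary condition is then repaired by a homogeneous solution.\<close>

lemma R_QD_eq:
  assumes g: "g \<in> LpE S"
  shows "R_QD S \<mu> g = R0 g + lift (opD S (R0 g))"
  unfolding R_QD_def
proof (rule resolvent_eqI)
  show "inj_on (\<lambda>x. \<mu> *\<^sub>C x - Qm S x) {\<phi> \<in> W. at0 S \<phi> = opD S \<phi>}"
    by (rule inj_onI, rule neutral_unique[where y = 0]) simp_all
qed (use neutral_exists[OF g] in auto)

lemma R_QD:
  assumes g: "g \<in> LpE S"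
  shows "R_QD S \<mu> g \<in> W" "\<mu> *\<^sub>C R_QD S \<mu> g - Qm S (R_QD S \<mu> g) = g"
    "at0 S (R_QD S \<mu> g) = opD S (R_QD S \<mu> g)"
  unfolding R_QD_eq[OF g] using neutral_exists[OF g] by auto

lemma R0_bounded: "dominated (LpE S) (\<lambda>g :: 'e::complex_banach aefun. normW (R0 g)) normL"
  by (rule dominatedI[OF R0_const_nonneg R0(4)])

lemma R_QD_bounded: "dominated (LpE S) (\<lambda>g. normW (R_QD S \<mu> g)) normL"
proof (rule dominated_mono)
  have D: "dominated (LpE S) (\<lambda>g. norm (opD S (R0 g))) normL"
    by (rule dominated_trans[OF delay_op_bounded[OF kernels(1)] R0(1) R0_bounded])
  show "dominated (LpE S) (\<lambda>g. 2 * (normW (R0 g) + normW (lift (opD S (R0 g))))) normL"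
    by (intro dominated_mult dominated_add R0_bounded dominated_trans[OF lift_mu_bounded _ D]) auto
  show "normW (R_QD S \<mu> g) \<le> 2 * (normW (R0 g) + normW (lift (opD S (R0 g))))" if g: "g \<in> LpE S" for g
    unfolding R_QD_eq[OF g] by (rule W1p_norm_add[OF R0(1)[OF g] lift_mu_W])
qed

lemma neutral_iff:
  assumes g: "g \<in> LpE S"
  shows "\<phi> \<in> W \<and> \<mu> *\<^sub>C \<phi> - Qm S \<phi> = g \<and> at0 S \<phi> = y + opD S \<phi> \<longleftrightarrow> \<phi> = R_QD S \<mu> g + lift y"
proof -
  note q = R_QD[OF g] and l = lift_mu_W[of y] lift_mu_solves[of y]
  let ?\<phi> = "R_QD S \<mu> g + lift y"
  have "?\<phi> \<in> W" by (rule csubspace_add[OF csubspace_W1p q(1) l(1)])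
  moreover have "\<mu> *\<^sub>C ?\<phi> - Qm S ?\<phi> = g"
    using q(2) l(2) by (simp add: Qm_add[OF q(1) l(1)] scaleC_add_right algebra_simps)
  moreover have "at0 S ?\<phi> = y + opD S ?\<phi>"
    using q(3) l(3) by (simp add: at0_add[OF q(1) l(1)] opD_add[OF q(1) l(1)] algebra_simps)
  ultimately show ?thesis using neutral_unique[of \<phi> ?\<phi> y] by auto
qed

subsection \<open>Reduction to the characteristic operator\<close>

lemma Delta_clinear: "clinear_on (W) (\<Delta>)"
  unfolding clinear_on_def Delta_def
  by (simp add: delay_op_add[OF kernels(2)] clinear_on_scaleC[OF delay_op_clinear[OF kernels(2)]]
      R_GM_add R_GM_scaleC lift_mu_add lift_mu_scaleC)

lemma Delta_W: "\<Delta> \<phi> \<in> W"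
  unfolding Delta_def by (rule lift_mu_W)

text \<open>What is left of the data once \<open>x\<close> is eliminated from the equation for the history segment \<open>\<phi>\<close>.\<close>

definition reduced_data :: "'x \<Rightarrow> 'x aefun \<Rightarrow> 'u aefun \<Rightarrow> 'x aefun" where
  "reduced_data f g \<psi> = R_QD S \<mu> g + lift (R f + (opK1 S \<psi> + R (opB1 S \<psi>)))"

lemma reduced_data_W: "g \<in> LpE S \<Longrightarrow> reduced_data f g \<psi> \<in> W"
  unfolding reduced_data_def by (intro csubspace_add[OF csubspace_W1p] R_QD(1) lift_mu_W)

text \<open>
  The equation is triangular except for a loop between \<open>x\<close> and \<open>\<phi>\<close>: the third line determines
  \<open>\<psi>\<close>, the first gives \<open>x\<close> in terms of \<open>\<phi>\<close>, and the second gives \<open>\<phi>\<close> in terms of \<open>x\<close>, which enters as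
  an inhomogeneity of the neutral boundary condition.  Substituting \<open>x\<close> closes the loop with
  \<open>\<Delta>(\<mu>)\<close>.
\<close>

lemma frakA_equation_iff:
  assumes g: "g \<in> LpE S" and h: "h \<in> LpE S"
  shows "(x, \<phi>, \<psi>) \<in> dom_frakA S \<and> \<T> (x, \<phi>, \<psi>) = (f, g, h) \<longleftrightarrow>
    \<psi> = R_Q S \<mu> h \<and> \<phi> \<in> W \<and> \<phi> - \<Delta> \<phi> = reduced_data f g \<psi> \<and>
    x = R (f + opL S \<phi> + opB1 S \<psi>)"
proof -
  have 1: "\<T> (x, \<phi>, \<psi>) = (f, g, h) \<longleftrightarrow>
      \<mu> *\<^sub>C x - op_m S x = f + opL S \<phi> + opB1 S \<psi> \<and> \<mu> *\<^sub>C \<phi> - Qm S \<phi> = g \<and> \<mu> *\<^sub>C \<psi> - Qm S \<psi> = h"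
    by (auto simp: frakA_def calA_def calP_def scaleC_prod_def algebra_simps)
  have 2: "x \<in> dom_m S \<and> op_G S x = op_M S x \<and> \<mu> *\<^sub>C x - op_m S x = y \<longleftrightarrow> x = R y" for y
    using R_GM[of y] R_GM_eqI[of x y] by (auto simp: dom_GM_def)
  have 3: "\<psi> \<in> W \<and> \<mu> *\<^sub>C \<psi> - Qm S \<psi> = h \<and> at0 S \<psi> = 0 \<longleftrightarrow> \<psi> = R_Q S \<mu> h"
    using R0[OF h] shift_unique[of \<psi> "R0 h"] by (auto simp: R_Q_def)
  have 4: "\<phi> = R_QD S \<mu> g + lift (R (f + opL S \<phi> + opB1 S \<psi>) + opK1 S \<psi>) \<longleftrightarrow>
      \<phi> - \<Delta> \<phi> = reduced_data f g \<psi>"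
    by (auto simp: reduced_data_def Delta_def R_GM_add lift_mu_add algebra_simps)
  have "(x, \<phi>, \<psi>) \<in> dom_frakA S \<and> \<T> (x, \<phi>, \<psi>) = (f, g, h) \<longleftrightarrow>
      (\<psi> \<in> W \<and> \<mu> *\<^sub>C \<psi> - Qm S \<psi> = h \<and> at0 S \<psi> = 0) \<and>
      (x \<in> dom_m S \<and> op_G S x = op_M S x \<and> \<mu> *\<^sub>C x - op_m S x = f + opL S \<phi> + opB1 S \<psi>) \<and>
      (\<phi> \<in> W \<and> \<mu> *\<^sub>C \<phi> - Qm S \<phi> = g \<and> at0 S \<phi> = (x + opK1 S \<psi>) + opD S \<phi>)"
    unfolding 1 by (auto simp: dom_frakA_def algebra_simps)
  also have "\<dots> \<longleftrightarrow> \<psi> = R_Q S \<mu> h \<and> x = R (f + opL S \<phi> + opB1 S \<psi>) \<and>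
      \<phi> = R_QD S \<mu> g + lift (x + opK1 S \<psi>)"
    unfolding 2 3 neutral_iff[OF g] ..
  also have "\<dots> \<longleftrightarrow> \<psi> = R_Q S \<mu> h \<and> \<phi> \<in> W \<and> \<phi> - \<Delta> \<phi> = reduced_data f g \<psi> \<and>
      x = R (f + opL S \<phi> + opB1 S \<psi>)"
    using 4 csubspace_add[OF csubspace_W1p R_QD(1)[OF g] lift_mu_W] by metis
  finally show ?thesis .
qed

lemma mu_minus_Qm_Lp:
  assumes "u \<in> W"
  shows "\<mu> *\<^sub>C u - Qm S u \<in> LpE S"
proof -
  have "\<mu> *\<^sub>C u + (- 1) *\<^sub>C Qm S u \<in> LpE S"
    unfolding Qm_def by (intro Lp_add Lp_scaleC p W1p_Lp W1p_weak_deriv_Lp assms)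
  then show ?thesis by (simp add: scaleC_minus_one)
qed

lemma frakA_range: "w \<in> dom_frakA S \<Longrightarrow> \<T> w \<in> prod_space S"
proof -
  assume w: "w \<in> dom_frakA S"
  obtain x \<phi> \<psi> where [simp]: "w = (x, \<phi>, \<psi>)" by (cases w)
  have "\<phi> \<in> W" "\<psi> \<in> W" using w by (auto simp: dom_frakA_def)
  then show ?thesis
    by (simp add: prod_space_def frakA_def calA_def calP_def scaleC_prod_def mu_minus_Qm_Lp)
qed

lemma zero_Lp: "(0 :: 'e::complex_banach aefun) \<in> LpE S"
  by (rule W1p_Lp[OF csubspace_zero[OF csubspace_W1p]])

lemma Lp_norm_zero: "normL (0 :: 'e::complex_banach aefun) = 0"
proof (rule antisym[OF _ Lp_norm_nonneg])
  have "(0 :: 'e aefun) \<in> LpE S" by (rule zero_Lp)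
  from Lp_scaleC(2)[OF p this, of 0] show "normL (0 :: 'e aefun) \<le> 0" by simp
qed

lemma R_Q_zero: "R_Q S \<mu> 0 = 0"
proof -
  have "Qm S (0 :: 'u aefun) = 0" "at0 S (0 :: 'u aefun) = 0"
    using Qm_scaleC[of "0 :: 'u aefun" 0] at0_scaleC[of "0 :: 'u aefun" 0] csubspace_zero[OF csubspace_W1p] by auto
  then show ?thesis
    using shift_unique[of "R0 (0 :: 'u aefun)" 0] R0[OF zero_Lp] csubspace_zero[OF csubspace_W1p]
    by (simp add: R_Q_def)
qed

lemma reduced_data_zero: "reduced_data f 0 0 = lift (R f)"
proof -
  have W0: "(0 :: 'u aefun) \<in> W" "(0 :: 'x aefun) \<in> W" by (rule csubspace_zero[OF csubspace_W1p])+
  have "opK1 S (0 :: 'u aefun) = 0" "opB1 S (0 :: 'u aefun) = 0"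
    using clinear_on_zero[OF csubspace_W1p delay_op_clinear] kernels by blast+
  moreover have "R 0 = 0" using R_GM_scaleC[of 0 0] by simp
  moreover have "R_QD S \<mu> 0 = 0"
  proof -
    have "Qm S (0 :: 'x aefun) = 0" "at0 S (0 :: 'x aefun) = 0" "opD S (0 :: 'x aefun) = 0"
      using Qm_scaleC[OF W0(2), of 0] at0_scaleC[OF W0(2), of 0]
        clinear_on_zero[OF csubspace_W1p delay_op_clinear[OF kernels(1)]] by auto
    then show ?thesis using neutral_unique[of "R_QD S \<mu> 0" 0 0] R_QD[OF zero_Lp] W0 by simp
  qed
  ultimately show ?thesis by (simp add: reduced_data_def)
qed

text \<open>
  For \<open>f = L y\<close> the right-hand side below is \<open>\<Delta>(\<mu>) y\<close>, and a solution \<open>\<phi>\<close> yields the solution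
  \<open>\<phi> + y\<close> of \<open>u - \<Delta>(\<mu>) u = y\<close>.  This is how solvability of the full problem carries over to the
  characteristic operator.
\<close>

lemma frakA_reduced_iff:
  "(x, \<phi>, \<psi>) \<in> dom_frakA S \<and> \<T> (x, \<phi>, \<psi>) = (f, 0, 0) \<longleftrightarrow>
    \<psi> = 0 \<and> \<phi> \<in> W \<and> \<phi> - \<Delta> \<phi> = lift (R f) \<and> x = R (f + opL S \<phi>)"
  unfolding frakA_equation_iff[OF zero_Lp zero_Lp]
  using clinear_on_zero[OF csubspace_W1p delay_op_clinear[OF kernels(3)]]
  by (auto simp: R_Q_zero reduced_data_zero)

lemma one_minus_Delta_range: "\<phi> \<in> W \<Longrightarrow> \<phi> - \<Delta> \<phi> \<in> W"
  by (rule csubspace_diff[OF csubspace_W1p _ Delta_W])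

lemma bij_frakA_of_bij_Delta:
  assumes bij: "bij_betw (\<lambda>\<phi>. 1 *\<^sub>C \<phi> - \<Delta> \<phi>) (W) (W)"
  shows "bij_betw \<T> (dom_frakA S) (prod_space S)"
  unfolding bij_betw_def
proof
  show "inj_on \<T> (dom_frakA S)"
  proof (rule inj_onI)
    fix w w' assume w: "w \<in> dom_frakA S" "w' \<in> dom_frakA S" and eq: "\<T> w = \<T> w'"
    obtain x \<phi> \<psi> where w1: "w = (x, \<phi>, \<psi>)" by (cases w)
    obtain x' \<phi>' \<psi>' where w2: "w' = (x', \<phi>', \<psi>')" by (cases w')
    obtain f g h where fgh: "\<T> w = (f, g, h)" by (cases "\<T> w")
    have gh: "g \<in> LpE S" "h \<in> LpE S" using frakA_range[OF w(1)] fgh by (auto simp: prod_space_def)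
    have s1: "\<psi> = R_Q S \<mu> h \<and> \<phi> \<in> W \<and> \<phi> - \<Delta> \<phi> = reduced_data f g \<psi> \<and>
        x = R (f + opL S \<phi> + opB1 S \<psi>)"
      using frakA_equation_iff[OF gh, of x \<phi> \<psi> f] w(1) fgh unfolding w1 by blast
    have s2: "\<psi>' = R_Q S \<mu> h \<and> \<phi>' \<in> W \<and> \<phi>' - \<Delta> \<phi>' = reduced_data f g \<psi>' \<and>
        x' = R (f + opL S \<phi>' + opB1 S \<psi>')"
      using frakA_equation_iff[OF gh, of x' \<phi>' \<psi>' f] w(2) fgh eq unfolding w2 by metis
    have "\<phi> = \<phi>'" using s1 s2 bij_betw_imp_inj_on[OF bij] unfolding inj_on_def by simp
    then show "w = w'" using s1 s2 w1 w2 by simp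
  qed
  show "\<T> ` dom_frakA S = prod_space S"
  proof (intro equalityI subsetI)
    show "y \<in> prod_space S" if "y \<in> \<T> ` dom_frakA S" for y
      using that frakA_range by blast
    fix y assume "y \<in> prod_space S"
    then obtain f g h where y: "y = (f, g, h)" "g \<in> LpE S" "h \<in> LpE S" by (auto simp: prod_space_def)
    let ?\<psi> = "R_Q S \<mu> h"
    obtain \<phi> where "\<phi> \<in> W" "\<phi> - \<Delta> \<phi> = reduced_data f g ?\<psi>"
      using resolvent_solves[OF bij reduced_data_W[OF y(2), of f ?\<psi>]] by auto
    moreover define x where "x = R (f + opL S \<phi> + opB1 S ?\<psi>)"
    ultimately have w: "(x, \<phi>, ?\<psi>) \<in> dom_frakA S \<and> \<T> (x, \<phi>, ?\<psi>) = y"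
      unfolding y(1) frakA_equation_iff[OF y(2,3)] by simp
    show "y \<in> \<T> ` dom_frakA S"
    proof (rule image_eqI)
      show "y = \<T> (x, \<phi>, ?\<psi>)" by (rule sym, rule conjunct2[OF w])
      show "(x, \<phi>, ?\<psi>) \<in> dom_frakA S" using w by (rule conjunct1)
    qed
  qed
qed

lemma bij_Delta_of_bij_frakA:
  assumes bij: "bij_betw \<T> (dom_frakA S) (prod_space S)"
  shows "bij_betw (\<lambda>\<phi>. 1 *\<^sub>C \<phi> - \<Delta> \<phi>) (W) (W)"
  unfolding bij_betw_def
proof
  show "inj_on (\<lambda>\<phi>. 1 *\<^sub>C \<phi> - \<Delta> \<phi>) (W)"
  proof (rule inj_onI)
    fix \<phi> \<phi>' assume \<phi>: "\<phi> \<in> W" "\<phi>' \<in> W" "1 *\<^sub>C \<phi> - \<Delta> \<phi> = 1 *\<^sub>C \<phi>' - \<Delta> \<phi>'"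
    let ?d = "\<phi> - \<phi>'"
    have d: "?d \<in> W" by (rule csubspace_diff[OF csubspace_W1p \<phi>(1,2)])
    have "?d - \<Delta> ?d = (\<phi> - \<Delta> \<phi>) - (\<phi>' - \<Delta> \<phi>')"
      unfolding clinear_on_diff[OF csubspace_W1p Delta_clinear \<phi>(1,2)] by (simp add: algebra_simps)
    also have "\<dots> = 0" using \<phi>(3) by simp
    finally have eq: "?d - \<Delta> ?d = 0" .
    have lift0: "lift (R 0) = 0"
      using R_GM_scaleC[of 0 0] lift_mu_scaleC[of 0 0] by simp
    let ?w = "(R (0 + opL S ?d), ?d, 0 :: 'u aefun)" and ?v = "(R (0 + opL S 0), 0 :: 'x aefun, 0 :: 'u aefun)"
    have W0: "(0 :: 'x aefun) \<in> W" by (rule csubspace_zero[OF csubspace_W1p])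
    have D0: "\<Delta> 0 = 0" by (rule clinear_on_zero[OF csubspace_W1p Delta_clinear])
    have "?w \<in> dom_frakA S \<and> \<T> ?w = (0, 0, 0)"
      unfolding frakA_reduced_iff lift0 using d eq by simp
    moreover have "?v \<in> dom_frakA S \<and> \<T> ?v = (0, 0, 0)"
      unfolding frakA_reduced_iff lift0 using W0 D0 by simp
    ultimately have "?w = ?v" using bij_betw_imp_inj_on[OF bij] unfolding inj_on_def by metis
    then show "\<phi> = \<phi>'" by simp
  qed
  show "(\<lambda>\<phi>. 1 *\<^sub>C \<phi> - \<Delta> \<phi>) ` W = W"
  proof (intro equalityI subsetI)
    show "y \<in> W" if "y \<in> (\<lambda>\<phi>. 1 *\<^sub>C \<phi> - \<Delta> \<phi>) ` W" for y
      using that one_minus_Delta_range by auto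
    fix y :: "'x aefun" assume y: "y \<in> W"
    have "(opL S y, 0, 0) \<in> prod_space S" by (simp add: prod_space_def zero_Lp)
    from resolvent_solves[OF bij this] obtain x \<phi> \<psi> where
      "(x, \<phi>, \<psi>) \<in> dom_frakA S \<and> \<T> (x, \<phi>, \<psi>) = (opL S y, 0, 0)"
      by (metis prod_cases3)
    then have \<phi>: "\<phi> \<in> W" "\<phi> - \<Delta> \<phi> = \<Delta> y"
      unfolding frakA_reduced_iff by (auto simp: Delta_def)
    show "y \<in> (\<lambda>\<phi>. 1 *\<^sub>C \<phi> - \<Delta> \<phi>) ` W"
    proof (rule image_eqI)
      show "y = 1 *\<^sub>C (\<phi> + y) - \<Delta> (\<phi> + y)"
        using \<phi>(2) clinear_on_add[OF Delta_clinear \<phi>(1) y] by (simp add: algebra_simps)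
      show "\<phi> + y \<in> W" by (rule csubspace_add[OF csubspace_W1p \<phi>(1) y])
    qed
  qed
qed

lemma Lp_norm_le_W: "normL u \<le> normW u"
  by (simp add: W1p_norm_def)

text \<open>
  The norm of the product space controls \<open>\<Delta>(\<mu>) \<phi>\<close> only in \<open>L\<^sup>p\<close>, but it controls \<open>R L \<phi>\<close>, and
  \<open>\<Delta>(\<mu>) \<phi>\<close> is the image of the latter under an operator bounded into \<open>W\<^sup>1\<^sup>,\<^sup>p\<close>.
\<close>

lemma Delta_inverse_bounded:
  assumes K: "\<And>w. w \<in> dom_frakA S \<Longrightarrow> prod_norm S w \<le> K * prod_norm S (\<T> w)"
  shows "\<exists>C. \<forall>\<phi>\<in>W. normW \<phi> \<le> C * normW (1 *\<^sub>C \<phi> - \<Delta> \<phi>)"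
proof -
  let ?y = "\<lambda>\<phi>. \<phi> - \<Delta> \<phi>"
  let ?N = "\<lambda>\<phi>. normW (?y \<phi>)"
  have y: "dominated W ?N ?N" by (rule dominatedI[of 1]) auto
  have Ly: "dominated W (\<lambda>\<phi>. norm (opL S (?y \<phi>))) ?N"
    by (rule dominated_trans[OF delay_op_bounded[OF kernels(2)] one_minus_Delta_range y])
  have le: "norm (R (opL S \<phi>)) \<le> max 0 K * norm (opL S (?y \<phi>))" if \<phi>: "\<phi> \<in> W" for \<phi>
  proof -
    let ?x = "R (opL S \<phi>)"
    have DW: "\<Delta> \<phi> \<in> W" by (rule Delta_W)
    have L: "opL S \<phi> = opL S (?y \<phi>) + opL S (\<Delta> \<phi>)"
      using delay_op_add[OF kernels(2) one_minus_Delta_range[OF \<phi>] DW] by simp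
    \<comment> \<open>The pair \<open>(R L \<phi>, \<Delta> \<phi>)\<close> solves the full problem with data \<open>L (\<phi> - \<Delta> \<phi>)\<close>.\<close>
    have "(?x, \<Delta> \<phi>, 0) \<in> dom_frakA S \<and> \<T> (?x, \<Delta> \<phi>, 0) = (opL S (?y \<phi>), 0, 0)"
      unfolding frakA_reduced_iff
    proof (intro conjI refl DW)
      have "\<Delta> \<phi> - \<Delta> (\<Delta> \<phi>) = \<Delta> (?y \<phi>)"
        using clinear_on_diff[OF csubspace_W1p Delta_clinear \<phi> DW] by simp
      then show "\<Delta> \<phi> - \<Delta> (\<Delta> \<phi>) = lift (R (opL S (?y \<phi>)))"
        by (simp add: Delta_def[of S \<mu> "?y \<phi>"])
      show "?x = R (opL S (?y \<phi>) + opL S (\<Delta> \<phi>))" using L by simp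
    qed
    then have "prod_norm S (?x, \<Delta> \<phi>, 0 :: 'u aefun) \<le> K * prod_norm S (opL S (?y \<phi>), 0 :: 'x aefun, 0 :: 'u aefun)"
      using K by metis
    then have "norm ?x + normL (\<Delta> \<phi>) \<le> K * norm (opL S (?y \<phi>))"
      by (simp add: prod_norm_def Lp_norm_zero)
    also have "\<dots> \<le> max 0 K * norm (opL S (?y \<phi>))" by (intro mult_right_mono) auto
    finally show ?thesis using Lp_norm_nonneg[of "expo S" "\<Delta> \<phi>"] by linarith
  qed
  have "dominated W (\<lambda>\<phi>. norm (R (opL S \<phi>))) ?N"
    by (rule dominated_mono[OF dominated_mult[OF max.cobounded1 Ly]]) (rule le)
  then have "dominated W (\<lambda>\<phi>. normW (\<Delta> \<phi>)) ?N"
    unfolding Delta_def by (rule dominated_trans[OF lift_mu_bounded UNIV_I])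
  with y have "dominated W (\<lambda>\<phi>. 2 * (normW (?y \<phi>) + normW (\<Delta> \<phi>))) ?N"
    by (intro dominated_mult dominated_add) auto
  then have "dominated W normW ?N"
  proof (rule dominated_mono)
    show "normW \<phi> \<le> 2 * (normW (?y \<phi>) + normW (\<Delta> \<phi>))" if "\<phi> \<in> W" for \<phi>
      using W1p_norm_add[OF one_minus_Delta_range[OF that] Delta_W, of \<phi>] by simp
  qed
  then show ?thesis unfolding dominated_def by auto
qed

lemma frakA_inverse_bounded:
  assumes C: "\<And>\<phi>. \<phi> \<in> W \<Longrightarrow> normW \<phi> \<le> C * normW (1 *\<^sub>C \<phi> - \<Delta> \<phi>)"
  shows "\<exists>K. \<forall>w\<in>dom_frakA S. prod_norm S w \<le> K * prod_norm S (\<T> w)"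
proof -
  define N where "N w = prod_norm S (\<T> w)" for w
  define f where "f w = fst (\<T> w)" for w
  define g where "g w = fst (snd (\<T> w))" for w
  define h where "h w = snd (snd (\<T> w))" for w
  define \<phi> :: "'x \<times> 'x aefun \<times> 'u aefun \<Rightarrow> _" where "\<phi> w = fst (snd w)" for w
  define \<psi> :: "'x \<times> 'x aefun \<times> 'u aefun \<Rightarrow> _" where "\<psi> w = snd (snd w)" for w
  let ?r = "\<lambda>w. reduced_data (f w) (g w) (\<psi> w)"
  have gh: "g w \<in> LpE S" "h w \<in> LpE S" if "w \<in> dom_frakA S" for w
    using frakA_range[OF that] by (auto simp: prod_space_def g_def h_def mem_Times_iff simp del: fst_diff snd_diff)
  have eq: "(fst w, \<phi> w, \<psi> w) \<in> dom_frakA S \<and> \<T> (fst w, \<phi> w, \<psi> w) = (f w, g w, h w)" if "w \<in> dom_frakA S" for w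
    using that unfolding \<phi>_def \<psi>_def f_def g_def h_def by (simp only: prod.collapse)
  have sol: "\<psi> w = R0 (h w)" "\<phi> w \<in> W" "\<phi> w - \<Delta> (\<phi> w) = ?r w"
    "fst w = R (f w + opL S (\<phi> w) + opB1 S (\<psi> w))" "\<psi> w \<in> W" if w: "w \<in> dom_frakA S" for w
    using iffD1[OF frakA_equation_iff[OF gh[OF w]] eq[OF w]] R0(1)[OF gh(2)[OF w]] by (auto simp: R_Q_def)
  let ?dom = "\<lambda>F. dominated (dom_frakA S) F N"
  have data: "?dom (\<lambda>w. norm (f w))" "?dom (\<lambda>w. normL (g w))" "?dom (\<lambda>w. normL (h w))"
    by (rule dominatedI[of 1]; simp add: N_def f_def g_def h_def prod_norm_def case_prod_beta)+
  have \<psi>: "?dom (\<lambda>w. normW (\<psi> w))"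
    by (rule dominated_mono[OF dominated_trans[OF R0_bounded gh(2) data(3)]]) (simp_all add: sol(1))
  note B = dominated_trans[OF delay_op_bounded[OF kernels(3)] sol(5) \<psi>]
  note K = dominated_trans[OF delay_op_bounded[OF kernels(4)] sol(5) \<psi>]
  let ?y = "\<lambda>w. R (f w) + (opK1 S (\<psi> w) + R (opB1 S (\<psi> w)))"
  have "?dom (\<lambda>w. norm (R (f w)) + (norm (opK1 S (\<psi> w)) + norm (R (opB1 S (\<psi> w)))))"
    by (intro dominated_add K dominated_trans[OF R_GM_bounded UNIV_I data(1)] dominated_trans[OF R_GM_bounded UNIV_I B])
  then have "?dom (\<lambda>w. norm (?y w))"
    by (rule dominated_mono) (intro order_trans[OF norm_triangle_ineq] add_left_mono norm_triangle_ineq)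
  note lift = dominated_trans[OF lift_mu_bounded UNIV_I this]
  have "?dom (\<lambda>w. max 0 C * (2 * (normW (R_QD S \<mu> (g w)) + normW (lift (?y w)))))"
    by (intro dominated_mult dominated_add lift dominated_trans[OF R_QD_bounded gh(1) data(2)]) auto
  then have \<phi>: "?dom (\<lambda>w. normW (\<phi> w))"
  proof (rule dominated_mono)
    fix w assume w: "w \<in> dom_frakA S"
    have "normW (\<phi> w) \<le> C * normW (?r w)" using C[OF sol(2)[OF w]] sol(3)[OF w] by simp
    also have "\<dots> \<le> max 0 C * normW (?r w)" by (intro mult_right_mono) auto
    also have "normW (?r w) \<le> 2 * (normW (R_QD S \<mu> (g w)) + normW (lift (?y w)))"
      unfolding reduced_data_def by (rule W1p_norm_add[OF R_QD(1)[OF gh(1)[OF w]] lift_mu_W])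
    finally show "normW (\<phi> w) \<le> max 0 C * (2 * (normW (R_QD S \<mu> (g w)) + normW (lift (?y w))))"
      by (simp add: mult_left_mono)
  qed
  note L = dominated_trans[OF delay_op_bounded[OF kernels(2)] sol(2) \<phi>]
  have "?dom (\<lambda>w. norm (f w) + norm (opL S (\<phi> w)) + norm (opB1 S (\<psi> w)))"
    by (intro dominated_add data(1) L B)
  then have "?dom (\<lambda>w. norm (f w + opL S (\<phi> w) + opB1 S (\<psi> w)))"
    by (rule dominated_mono) (intro order_trans[OF norm_triangle_ineq] add_right_mono norm_triangle_ineq)
  note x = dominated_trans[OF R_GM_bounded UNIV_I this]
  have "?dom (prod_norm S)"
  proof (rule dominated_mono[OF dominated_add[OF dominated_add[OF x \<phi>] \<psi>]])
    fix w assume w: "w \<in> dom_frakA S"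
    show "prod_norm S w \<le> norm (R (f w + opL S (\<phi> w) + opB1 S (\<psi> w))) + normW (\<phi> w) + normW (\<psi> w)"
      unfolding sol(4)[OF w, symmetric] using Lp_norm_le_W[of "\<phi> w"] Lp_norm_le_W[of "\<psi> w"]
      by (simp add: prod_norm_def case_prod_beta \<phi>_def \<psi>_def)
  qed
  then show ?thesis unfolding dominated_def N_def by blast
qed

lemma rho_frakA_iff: "\<mu> \<in> rho_frakA S \<longleftrightarrow> 1 \<in> rho_Delta S \<mu>"
  unfolding resolvent_set_iff
  using bij_frakA_of_bij_Delta bij_Delta_of_bij_frakA Delta_inverse_bounded frakA_inverse_bounded
  by meson

text \<open>The operator matrix is the solution of the reduced equation, expanded by linearity in the data.\<close>

lemma resolvent_frakA:
  assumes "1 \<in> rho_Delta S \<mu>" and g: "g \<in> LpE S" and h: "h \<in> LpE S"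
  shows "resolvent (dom_frakA S) (frakA S) \<mu> (f, g, h) =
     (R (f + opL S (Gamma_op S \<mu> (R f)))
        + R (opL S (R_Delta S \<mu> (R_QD S \<mu> g)))
        + Lambda_op S \<mu> (R_Q S \<mu> h),
      Gamma_op S \<mu> (R f) + R_Delta S \<mu> (R_QD S \<mu> g) + Omega_op S \<mu> (R_Q S \<mu> h),
      R_Q S \<mu> h)"
    (is "_ = (?x, ?\<phi>, ?\<psi>)")
proof -
  have bij: "bij_betw (\<lambda>\<phi>. 1 *\<^sub>C \<phi> - \<Delta> \<phi>) (W) (W)"
    using assms(1) by (simp add: resolvent_set_iff)
  have R_add: "R_Delta S \<mu> (u + v) = R_Delta S \<mu> u + R_Delta S \<mu> v" if "u \<in> W" "v \<in> W" for u v
    unfolding R_Delta_def by (rule resolvent_add[OF csubspace_W1p Delta_clinear bij that])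
  have R_W: "R_Delta S \<mu> u \<in> W" and R_eq: "R_Delta S \<mu> u - \<Delta> (R_Delta S \<mu> u) = u"
    if "u \<in> W" for u
    unfolding R_Delta_def using resolvent_solves[OF bij that] by auto
  let ?k = "opK1 S ?\<psi> + R (opB1 S ?\<psi>)"
  have W: "R_QD S \<mu> g \<in> W" "lift (R f) \<in> W" "lift ?k \<in> W"
    by (intro R_QD(1) g lift_mu_W)+
  have "?\<phi> = R_Delta S \<mu> (reduced_data f g ?\<psi>)"
    unfolding reduced_data_def lift_mu_add[of "R f"] Gamma_op_def Omega_op_def
    by (simp add: R_add W csubspace_add[OF csubspace_W1p] add_ac)
  then have \<phi>: "?\<phi> \<in> W" "?\<phi> - \<Delta> ?\<phi> = reduced_data f g ?\<psi>"
    using R_W R_eq reduced_data_W[OF g] by auto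
  have "opL S ?\<phi> = opL S (Gamma_op S \<mu> (R f)) + opL S (R_Delta S \<mu> (R_QD S \<mu> g)) + opL S (Omega_op S \<mu> ?\<psi>)"
    by (simp add: delay_op_add[OF kernels(2)] csubspace_add[OF csubspace_W1p] R_W W Gamma_op_def Omega_op_def)
  then have x: "?x = R (f + opL S ?\<phi> + opB1 S ?\<psi>)"
    by (simp add: R_GM_add Lambda_op_def add_ac)
  have "(?x, ?\<phi>, ?\<psi>) \<in> dom_frakA S \<and> \<T> (?x, ?\<phi>, ?\<psi>) = (f, g, h)"
    unfolding frakA_equation_iff[OF g h] using \<phi> x by blast
  then show ?thesis
    by (intro resolvent_eqI[OF bij_betw_imp_inj_on[OF bij_frakA_of_bij_Delta[OF bij]]]) auto
qed

end

theorem proposition3p2: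
  fixes S :: "('x::complex_banach, 'b::complex_banach, 'u::complex_banach) delay_system"
    and T :: "real \<Rightarrow> 'x \<Rightarrow> 'x"
    and j :: "'x \<Rightarrow> 'y::complex_banach"
    and Te :: "real \<Rightarrow> 'y \<Rightarrow> 'y"
    and Ae :: "'x \<Rightarrow> 'y"
    and \<mu> :: complex
  assumes standing: "standing_assumptions S"
    and A1: "generates (dom_A S) (op_m S) T"
    and A2: "op_G S ` dom_m S = UNIV"
    and mu: "\<mu> \<in> rho_A S"
    and extrap: "extrapolation (dom_A S) (op_m S) T j Te Ae"
    and A3: "regular_triple (expo S) (dom_A S) T j Te (control_op S j Ae \<mu>) (op_M S)"
  shows
    "1 \<in> rho_MD S \<mu> \<inter> rho_De S \<mu> \<longrightarrow>
       \<mu> \<in> rho_GM S \<and>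
       (\<mu> \<in> rho_frakA S \<longleftrightarrow> 1 \<in> rho_Delta S \<mu>) \<and>
       (1 \<in> rho_Delta S \<mu> \<longrightarrow>
         (\<forall>f. \<forall>g\<in>LpE S. \<forall>h\<in>LpE S.
            resolvent (dom_frakA S) (frakA S) \<mu> (f, g, h) =
             (R_GM S \<mu> (f + opL S (Gamma_op S \<mu> (R_GM S \<mu> f)))
                + R_GM S \<mu> (opL S (R_Delta S \<mu> (R_QD S \<mu> g)))
                + Lambda_op S \<mu> (R_Q S \<mu> h),
              Gamma_op S \<mu> (R_GM S \<mu> f)
                + R_Delta S \<mu> (R_QD S \<mu> g)
                + Omega_op S \<mu> (R_Q S \<mu> h),
              R_Q S \<mu> h)))"
proof -
  have "delay_setting S \<mu>" if "1 \<in> rho_MD S \<mu> \<inter> rho_De S \<mu>"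
    by unfold_locales (use that standing A2 mu in auto)
  then show ?thesis
    using delay_setting.mu_rho_GM delay_setting.rho_frakA_iff delay_setting.resolvent_frakA by blast
qed

end
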